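(* Let $M$ be a matroid of rank $d$ on a finite ground set $E$ and let $\mathbb H$ be a hyperfield with an involution $\tau$. Then there exist bijections $$\Upsilon_\tau:\mathcal M^{\tau,w}_{\mathbb H}(M)\to\mathcal M^{p,w}_{\mathbb H}(M),\qquad \overline{\Upsilon}_\tau:\mathcal R^{\tau,w}_{\mathbb H}(M)\to\mathcal R^{p,w}_{\mathbb H}(M)$$ such that the square they form with the quotient maps $\mathcal M^{\tau,w}_{\mathbb H}(M)\to\mathcal R^{\tau,w}_{\mathbb H}(M)$ (quotient by $\cong_\tau$) and $\mathcal M^{p,w}_{\mathbb H}(M)\to\mathcal R^{p,w}_{\mathbb H}(M)$ (quotient by $\cong_p$) commutes. The same holds in the strong case, i.e. with the superscript $w$ replaced by $s$ throughout. In both cases, if $\mathbb H$ is a topological hyperfield, then $\Upsilon_\tau$ and $\overline\Upsilon_\tau$ are homeomorphisms.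
   Context: Hyperfields. A hyperfield is $(\mathbb H,\boxplus,\odot,0,1)$ with $0\ne1$ where: $\boxplus$ is a commutative, associative hyperoperation (each $a\boxplus b$ is a nonempty subset of $\mathbb H$; for subsets, $A\boxplus B=\bigcup_{a\in A,b\in B}a\boxplus b$) with $0\boxplus x=\{x\}$, each $x$ has a unique $-x$ with $0\in x\boxplus -x$, and $x\in y\boxplus z\iff z\in x\boxplus -y$; $(\mathbb H,\odot,1)$ is a commutative monoid, $0\odot x=0$, $a\odot(x\boxplus y)=(a\odot x)\boxplus(a\odot y)$; and $\mathbb H^*=\mathbb H\setminus\{0\}$ is a group under $\odot$. A homomorphism of hyperfields is a map $f$ with $f(0)=0$, $f(1)=1$, $f(x\odot y)=f(x)\odot f(y)$, $f(x\boxplus y)\subseteq f(x)\boxplus f(y)$. An involution is a homomorphism $\tau:\mathbb H\to\mathbb H$ with $\tau\circ\tau=\mathrm{id}$. A topological hyperfield is a hyperfield with a topology such that $\mathbb H^*$ is open, $\odot:\mathbb H\times\mathbb H\to\mathbb H$ is continuous and inversion $\mathbb H^*\to\mathbb H^*$ is continuous; involutions of topological hyperfields are required to be continuous. Grassmann–Plücker functions. A strong Grassmann–Plücker function of rank $d$ on $E$ is a nonzero alternating function $\varphi:E^d\to\mathbb H$ with $$0\in\boxplus_{k=1}^{d+1}(-1)^k\odot\varphi(x_1,\dots,\hat x_k,\dots,x_{d+1})\odot\varphi(x_k,y_1,\dots,y_{d-1})$$ for all subsets $I=\{x_1,\dots,x_{d+1}\}$, $J=\{y_1,\dots,y_{d-1}\}$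 of $E$. A weak one is a nonzero alternating function whose support is the set of bases of a matroid and which satisfies this condition whenever $|I\setminus J|\le3$. Its underlying matroid is the matroid whose bases are the sets $\{x_1,\dots,x_d\}$ with $\varphi(x_1,\dots,x_d)\neq0$. $\mathcal N^{p,w}_{\mathbb H}(M)$ (resp. $\mathcal N^{p,s}_{\mathbb H}(M)$) is the set of weak (resp. strong) Grassmann–Plücker functions with underlying matroid $M$, topologized (when $\mathbb H$ is topological) as a subset of the product $\mathbb H^{E^d}$. Write $\varphi_1\sim_p\varphi_2$ if $\varphi_1=a\odot\varphi_2$ for some $a\in\mathbb H^*$; $\mathcal M^{p,\bullet}_{\mathbb H}(M)=\mathcal N^{p,\bullet}_{\mathbb H}(M)/\!\sim_p$ for $\bullet\in\{w,s\}$. Write $\varphi_1\approx_p\varphi_2$ if there is $h:E\to\mathbb H^*$ with $\varphi_1(x_1,\dots,x_d)=\left(\bigodot_{j=1}^d h(x_j)\right)\odot\varphi_2(x_1,\dots,x_d)$ for all $(x_1,\dots,x_d)\in E^d$. Two $\sim_p$-classes are $\cong_p$-equivalent if they have $\approx_p$-equivalent representatives; $\mathcal R^{p,\bullet}_{\mathbb H}(M)=\mathcal M^{p,\bullet}_{\mathbb H}(M)/\!\cong_p$. Signatures. Let $\mathfrak C,\mathfrak C^*$ be the sets of circuits and cocircuits of $M$. An $\mathbb H^*$-circuit signature is a family $\gamma=\{\gamma C:C\to\mathbb H^*\}_{C\in\mathfrak C}$; an $\mathbb H^*$-cocircuit signature is a family $\delta=\{\delta D:D\to\mathbb H^*\}_{D\in\mathfrak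 C^*}$. They are strong orthogonal with respect to $\tau$ if $0\in\boxplus_{x\in C\cap D}\gamma C(x)\odot\tau(\delta D(x))$ for all $C\in\mathfrak C$, $D\in\mathfrak C^*$ (an empty sum being $0$), and weak orthogonal if this holds whenever $|C\cap D|\le3$. $\mathcal N^{\tau,w}_{\mathbb H}(M)$ (resp. $\mathcal N^{\tau,s}_{\mathbb H}(M)$) is the set of pairs $(\gamma,\delta)$ that are weak (resp. strong) orthogonal with respect to $\tau$, topologized as a subset of a finite power of $\mathbb H^*$. Write $(\gamma_1,\delta_1)\sim_\tau(\gamma_2,\delta_2)$ if there are functions $C\mapsto b_C\in\mathbb H^*$ on $\mathfrak C$ and $D\mapsto l_D\in\mathbb H^*$ on $\mathfrak C^*$ with $\gamma_1C(x)=b_C\odot\gamma_2C(x)$ and $\delta_1D(y)=l_D\odot\delta_2D(y)$ for all $C$, $x\in C$, $D$, $y\in D$; $\mathcal M^{\tau,\bullet}_{\mathbb H}(M)=\mathcal N^{\tau,\bullet}_{\mathbb H}(M)/\!\sim_\tau$. Write $(\gamma_1,\delta_1)\approx_\tau(\gamma_2,\delta_2)$ if there is $h:E\to\mathbb H^*$ with $\gamma_1C(x)=h(x)\odot\gamma_2C(x)$ and $\delta_1D(y)=\tau(h(y)^{-1})\odot\delta_2D(y)$ for all $C$, $x\in C$, $D$, $y\in D$. Two $\sim_\tau$-classes are $\cong_\tau$-equivalent if they have $\approx_\tau$-equivalent representatives; $\mathcal R^{\tau,\bullet}_{\mathbb H}(M)=\mathcal M^{\tau,\bullet}_{\mathbb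 H}(M)/\!\cong_\tau$. All quotients carry the quotient topology when $\mathbb H$ is a topological hyperfield. *)

theory Defs
  imports "HOL-Analysis.Analysis" "HOL-Combinatorics.Permutations" "HOL-Library.NList"
begin

section \<open>Hyperfields\<close>

class hyperadd =
  fixes hyperadd :: "'a \<Rightarrow> 'a \<Rightarrow> 'a set"  (infixl \<open>\<boxplus>\<close> 65)
begin

definition set_hyperadd :: "'a set \<Rightarrow> 'a set \<Rightarrow> 'a set"
  where "set_hyperadd A B = (\<Union>a\<in>A. \<Union>b\<in>B. a \<boxplus> b)"

end

text \<open>
  Only the values of \<open>inverse\<close> on nonzero elements matter; \<open>inverse_hyper_zero\<close> and
  \<open>divide_hyper_inverse\<close> fix the usual conventions for the total operations of the
  syntactic class and do not restrict the hyperfield.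
\<close>

class hyperfield = comm_monoid_mult + mult_zero + zero_neq_one + uminus + inverse + hyperadd +
  assumes hyperadd_nonempty: "x \<boxplus> y \<noteq> {}"
    and hyperadd_commute: "x \<boxplus> y = y \<boxplus> x"
    and hyperadd_assoc: "set_hyperadd (x \<boxplus> y) {z} = set_hyperadd {x} (y \<boxplus> z)"
    and hyperadd_zero: "0 \<boxplus> x = {x}"
    and zero_in_hyperadd_uminus: "0 \<in> x \<boxplus> - x"
    and uminus_hyper_unique: "0 \<in> x \<boxplus> y \<Longrightarrow> y = - x"
    and hyperadd_reversible: "x \<in> y \<boxplus> z \<longleftrightarrow> z \<in> x \<boxplus> - y"
    and hyperadd_distrib: "(\<lambda>u. a * u) ` (x \<boxplus> y) = a * x \<boxplus> a * y"
    and inverse_hyper_left: "x \<noteq> 0 \<Longrightarrow> inverse x * x = 1"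
    and inverse_hyper_zero: "inverse 0 = 0"
    and divide_hyper_inverse: "x / y = x * inverse y"
begin

sublocale set_hypersum: comm_monoid_set set_hyperadd "{0}"
  defines set_hypersum = set_hypersum.F
proof
  fix A B C :: "'a set"
  have elem: "(\<Union>u\<in>a \<boxplus> b. u \<boxplus> c) = (\<Union>v\<in>b \<boxplus> c. a \<boxplus> v)" for a b c
    using hyperadd_assoc[of a b c] by (simp add: set_hyperadd_def)
  show "set_hyperadd (set_hyperadd A B) C = set_hyperadd A (set_hyperadd B C)"
  proof -
    have "set_hyperadd (set_hyperadd A B) C = (\<Union>a\<in>A. \<Union>b\<in>B. \<Union>c\<in>C. \<Union>u\<in>a \<boxplus> b. u \<boxplus> c)"
      unfolding set_hyperadd_def by blast
    also have "\<dots> = (\<Union>a\<in>A. \<Union>b\<in>B. \<Union>c\<in>C. \<Union>v\<in>b \<boxplus> c. a \<boxplus> v)"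
      by (simp only: elem)
    also have "\<dots> = set_hyperadd A (set_hyperadd B C)"
      unfolding set_hyperadd_def by blast
    finally show ?thesis .
  qed
  show "set_hyperadd A B = set_hyperadd B A"
    unfolding set_hyperadd_def using hyperadd_commute by blast
  show "set_hyperadd A {0} = A"
    unfolding set_hyperadd_def using hyperadd_commute[of _ 0] by (simp add: hyperadd_zero)
qed

text \<open>The finite hypersum of the elements \<open>f i\<close>, \<open>i \<in> I\<close>; it is \<open>{0}\<close> for empty \<open>I\<close>.\<close>

definition hypersum :: "('i \<Rightarrow> 'a) \<Rightarrow> 'i set \<Rightarrow> 'a set"
  where "hypersum f I = set_hypersum (\<lambda>i. {f i}) I"

end

definition hyperfield_hom :: "('a::hyperfield \<Rightarrow> 'b::hyperfield) \<Rightarrow> bool"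
  where "hyperfield_hom f \<longleftrightarrow> f 0 = 0 \<and> f 1 = 1 \<and> (\<forall>x y. f (x * y) = f x * f y) \<and>
    (\<forall>x y. f ` (x \<boxplus> y) \<subseteq> f x \<boxplus> f y)"

definition hyperfield_involution :: "('a::hyperfield \<Rightarrow> 'a) \<Rightarrow> bool"
  where "hyperfield_involution \<tau> \<longleftrightarrow> hyperfield_hom \<tau> \<and> \<tau> \<circ> \<tau> = id"

definition topological_hyperfield :: "'a::hyperfield topology \<Rightarrow> bool"
  where "topological_hyperfield T \<longleftrightarrow> topspace T = UNIV \<and> openin T (- {0}) \<and>
    continuous_map (prod_topology T T) T (\<lambda>(x, y). x * y) \<and>
    continuous_map (subtopology T (- {0})) (subtopology T (- {0})) inverse"


section \<open>Matroids\<close>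

record 'e pre_matroid =
  ground :: "'e set"
  indep_sets :: "'e set set"

locale matroid =
  fixes M :: "'e pre_matroid"
  assumes finite_ground: "finite (ground M)"
    and indep_subset_ground: "X \<in> indep_sets M \<Longrightarrow> X \<subseteq> ground M"
    and indep_empty: "{} \<in> indep_sets M"
    and indep_subset: "X \<in> indep_sets M \<Longrightarrow> Y \<subseteq> X \<Longrightarrow> Y \<in> indep_sets M"
    and indep_augment: "X \<in> indep_sets M \<Longrightarrow> Y \<in> indep_sets M \<Longrightarrow> card X < card Y \<Longrightarrow>
      \<exists>y\<in>Y - X. insert y X \<in> indep_sets M"

definition bases :: "'e pre_matroid \<Rightarrow> 'e set set"
  where "bases M = {B \<in> indep_sets M. \<forall>X\<in>indep_sets M. B \<subseteq> X \<longrightarrow> X = B}"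

definition matroid_rank :: "'e pre_matroid \<Rightarrow> nat"
  where "matroid_rank M = Max (card ` indep_sets M)"

definition circuits :: "'e pre_matroid \<Rightarrow> 'e set set"
  where "circuits M = {C. C \<subseteq> ground M \<and> C \<notin> indep_sets M \<and> (\<forall>X. X \<subset> C \<longrightarrow> X \<in> indep_sets M)}"

text \<open>The bases of the dual are the complements of the bases.\<close>

definition dual_matroid :: "'e pre_matroid \<Rightarrow> 'e pre_matroid"
  where "dual_matroid M = \<lparr> ground = ground M,
    indep_sets = {X. \<exists>B\<in>bases M. X \<subseteq> ground M - B} \<rparr>"

definition cocircuits :: "'e pre_matroid \<Rightarrow> 'e set set"
  where "cocircuits M = circuits (dual_matroid M)"


section \<open>Quotient topology\<close>

definition quotient_topology :: "'a topology \<Rightarrow> ('a \<times> 'a) set \<Rightarrow> 'a set topology"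
  where "quotient_topology X r =
    topology (\<lambda>U. U \<subseteq> topspace X // r \<and> openin X {x \<in> topspace X. r `` {x} \<in> U})"

lemma openin_quotient_topology:
  "openin (quotient_topology X r) U \<longleftrightarrow>
    U \<subseteq> topspace X // r \<and> openin X {x \<in> topspace X. r `` {x} \<in> U}"
proof -
  let ?P = "\<lambda>U. {x \<in> topspace X. r `` {x} \<in> U}"
  have "istopology (\<lambda>U. U \<subseteq> topspace X // r \<and> openin X (?P U))"
    unfolding istopology_def
  proof (rule conjI; intro allI impI)
    fix S T assume "S \<subseteq> topspace X // r \<and> openin X (?P S)" "T \<subseteq> topspace X // r \<and> openin X (?P T)"
    moreover have "?P (S \<inter> T) = ?P S \<inter> ?P T" by auto
    ultimately show "S \<inter> T \<subseteq> topspace X // r \<and> openin X (?P (S \<inter> T))" by auto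
  next
    fix K assume K: "\<forall>S\<in>K. S \<subseteq> topspace X // r \<and> openin X (?P S)"
    have "?P (\<Union>K) = (\<Union>S\<in>K. ?P S)" by auto
    with K show "\<Union>K \<subseteq> topspace X // r \<and> openin X (?P (\<Union>K))" by auto
  qed
  then show ?thesis
    by (simp add: quotient_topology_def topology_inverse')
qed

lemma topspace_quotient_topology [simp]: "topspace (quotient_topology X r) = topspace X // r"
proof -
  have "{x \<in> topspace X. r `` {x} \<in> topspace X // r} = topspace X"
    by (auto intro: quotientI)
  then have "openin (quotient_topology X r) (topspace X // r)"
    by (simp add: openin_quotient_topology)
  moreover have "openin (quotient_topology X r) U \<Longrightarrow> U \<subseteq> topspace X // r" for U
    by (simp add: openin_quotient_topology)
  ultimately show ?thesis
    by (metis openin_subset openin_topspace subset_antisym)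
qed


datatype strength = Weak | Strong

text \<open>
  In the names below the suffix \<open>p\<close> refers to Grassmann--Pluecker functions and \<open>t\<close> to pairs
  of signatures orthogonal with respect to \<open>\<tau>\<close>.  Each \<open>N\<close> is the space of such objects,
  \<open>M\<close> its quotient by \<open>sim\<close> and \<open>R\<close> the quotient of \<open>M\<close> by \<open>cong\<close>.
\<close>


section \<open>Grassmann--Pluecker functions\<close>

text \<open>
  The set \<open>E\<^sup>d\<close> is \<open>nlists d E\<close>, and a function on \<open>E\<^sup>d\<close> is represented by its extensional
  extension to all lists.
\<close>

definition alternating :: "nat \<Rightarrow> 'e set \<Rightarrow> ('e list \<Rightarrow> 'h::hyperfield) \<Rightarrow> bool"
  where "alternating d E \<phi> \<longleftrightarrow> (\<forall>xs\<in>nlists d E.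
    (\<forall>p. p permutes {..<d} \<longrightarrow> \<phi> (permute_list p xs) = (if evenperm p then \<phi> xs else - \<phi> xs)) \<and>
    (\<not> distinct xs \<longrightarrow> \<phi> xs = 0))"

text \<open>
  The relation for \<open>I = {x\<^sub>1, \<dots>, x\<^sub>d\<^sub>+\<^sub>1}\<close> and \<open>J = {y\<^sub>1, \<dots>, y\<^sub>d\<^sub>-\<^sub>1}\<close>, listed by \<open>xs\<close> and \<open>ys\<close>;
  the index \<open>k\<close> is shifted by one in \<open>xs ! (k - 1)\<close>.
\<close>

definition gp_relation :: "('e list \<Rightarrow> 'h::hyperfield) \<Rightarrow> 'e list \<Rightarrow> 'e list \<Rightarrow> bool"
  where "gp_relation \<phi> xs ys \<longleftrightarrow>
    0 \<in> hypersum (\<lambda>k. (- 1) ^ k * \<phi> (take (k - 1) xs @ drop k xs) * \<phi> (xs ! (k - 1) # ys))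
      {1..length xs}"

definition gp_bases :: "nat \<Rightarrow> 'e set \<Rightarrow> ('e list \<Rightarrow> 'h::hyperfield) \<Rightarrow> 'e set set"
  where "gp_bases d E \<phi> = set ` {xs \<in> nlists d E. \<phi> xs \<noteq> 0}"

definition strong_gp :: "nat \<Rightarrow> 'e set \<Rightarrow> ('e list \<Rightarrow> 'h::hyperfield) \<Rightarrow> bool"
  where "strong_gp d E \<phi> \<longleftrightarrow> (\<exists>xs\<in>nlists d E. \<phi> xs \<noteq> 0) \<and> alternating d E \<phi> \<and>
    (\<forall>xs ys. set xs \<subseteq> E \<and> set ys \<subseteq> E \<and> distinct xs \<and> distinct ys \<and>
      length xs = d + 1 \<and> length ys + 1 = d \<longrightarrow> gp_relation \<phi> xs ys)"

definition weak_gp :: "nat \<Rightarrow> 'e set \<Rightarrow> ('e list \<Rightarrow> 'h::hyperfield) \<Rightarrow> bool"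
  where "weak_gp d E \<phi> \<longleftrightarrow> (\<exists>xs\<in>nlists d E. \<phi> xs \<noteq> 0) \<and> alternating d E \<phi> \<and>
    (\<exists>M. matroid M \<and> ground M = E \<and> bases M = gp_bases d E \<phi>) \<and>
    (\<forall>xs ys. set xs \<subseteq> E \<and> set ys \<subseteq> E \<and> distinct xs \<and> distinct ys \<and>
      length xs = d + 1 \<and> length ys + 1 = d \<and> card (set xs - set ys) \<le> 3 \<longrightarrow> gp_relation \<phi> xs ys)"

definition Np :: "strength \<Rightarrow> nat \<Rightarrow> 'e pre_matroid \<Rightarrow> ('e list \<Rightarrow> 'h::hyperfield) set"
  where "Np s d M = {\<phi> \<in> extensional (nlists d (ground M)).
    (case s of Weak \<Rightarrow> weak_gp d (ground M) \<phi> | Strong \<Rightarrow> strong_gp d (ground M) \<phi>) \<and>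
    gp_bases d (ground M) \<phi> = bases M}"

definition sim_p :: "strength \<Rightarrow> nat \<Rightarrow> 'e pre_matroid \<Rightarrow>
    (('e list \<Rightarrow> 'h::hyperfield) \<times> ('e list \<Rightarrow> 'h)) set"
  where "sim_p s d M = {(\<phi>1, \<phi>2) \<in> Np s d M \<times> Np s d M.
    \<exists>a. a \<noteq> 0 \<and> (\<forall>xs\<in>nlists d (ground M). \<phi>1 xs = a * \<phi>2 xs)}"

definition Mp :: "strength \<Rightarrow> nat \<Rightarrow> 'e pre_matroid \<Rightarrow> ('e list \<Rightarrow> 'h::hyperfield) set set"
  where "Mp s d M = Np s d M // sim_p s d M"

definition approx_p :: "nat \<Rightarrow> 'e pre_matroid \<Rightarrow>
    ('e list \<Rightarrow> 'h::hyperfield) \<Rightarrow> ('e list \<Rightarrow> 'h) \<Rightarrow> bool"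
  where "approx_p d M \<phi>1 \<phi>2 \<longleftrightarrow> (\<exists>h. (\<forall>e\<in>ground M. h e \<noteq> 0) \<and>
    (\<forall>xs\<in>nlists d (ground M). \<phi>1 xs = prod_list (map h xs) * \<phi>2 xs))"

definition cong_p :: "strength \<Rightarrow> nat \<Rightarrow> 'e pre_matroid \<Rightarrow>
    (('e list \<Rightarrow> 'h::hyperfield) set \<times> ('e list \<Rightarrow> 'h) set) set"
  where "cong_p s d M = {(X, Y) \<in> Mp s d M \<times> Mp s d M. \<exists>\<phi>1\<in>X. \<exists>\<phi>2\<in>Y. approx_p d M \<phi>1 \<phi>2}"

definition Rp :: "strength \<Rightarrow> nat \<Rightarrow> 'e pre_matroid \<Rightarrow> ('e list \<Rightarrow> 'h::hyperfield) set set set"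
  where "Rp s d M = Mp s d M // cong_p s d M"

definition Np_topology :: "'h::hyperfield topology \<Rightarrow> strength \<Rightarrow> nat \<Rightarrow> 'e pre_matroid \<Rightarrow>
    ('e list \<Rightarrow> 'h) topology"
  where "Np_topology T s d M =
    subtopology (product_topology (\<lambda>_. T) (nlists d (ground M))) (Np s d M)"

definition Mp_topology :: "'h::hyperfield topology \<Rightarrow> strength \<Rightarrow> nat \<Rightarrow> 'e pre_matroid \<Rightarrow>
    ('e list \<Rightarrow> 'h) set topology"
  where "Mp_topology T s d M = quotient_topology (Np_topology T s d M) (sim_p s d M)"

definition Rp_topology :: "'h::hyperfield topology \<Rightarrow> strength \<Rightarrow> nat \<Rightarrow> 'e pre_matroid \<Rightarrow>
    ('e list \<Rightarrow> 'h) set set topology"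
  where "Rp_topology T s d M = quotient_topology (Mp_topology T s d M) (cong_p s d M)"


section \<open>Orthogonal pairs of signatures\<close>

text \<open>
  A signature assigns to each set \<open>C\<close> of a family an extensional function on \<open>C\<close> with nonzero
  values.
\<close>

type_synonym ('e, 'h) signature = "'e set \<Rightarrow> 'e \<Rightarrow> 'h"

definition signatures :: "'e set set \<Rightarrow> ('e, 'h::hyperfield) signature set"
  where "signatures F = (\<Pi>\<^sub>E C\<in>F. \<Pi>\<^sub>E x\<in>C. - {0})"

definition orthogonal_on :: "('h::hyperfield \<Rightarrow> 'h) \<Rightarrow> ('e, 'h) signature \<Rightarrow> ('e, 'h) signature \<Rightarrow>
    'e set \<Rightarrow> 'e set \<Rightarrow> bool"
  where "orthogonal_on \<tau> \<gamma> \<delta> C D \<longleftrightarrow> 0 \<in> hypersum (\<lambda>x. \<gamma> C x * \<tau> (\<delta> D x)) (C \<inter> D)"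

definition strong_orthogonal :: "('h::hyperfield \<Rightarrow> 'h) \<Rightarrow> 'e pre_matroid \<Rightarrow>
    ('e, 'h) signature \<Rightarrow> ('e, 'h) signature \<Rightarrow> bool"
  where "strong_orthogonal \<tau> M \<gamma> \<delta> \<longleftrightarrow>
    (\<forall>C\<in>circuits M. \<forall>D\<in>cocircuits M. orthogonal_on \<tau> \<gamma> \<delta> C D)"

definition weak_orthogonal :: "('h::hyperfield \<Rightarrow> 'h) \<Rightarrow> 'e pre_matroid \<Rightarrow>
    ('e, 'h) signature \<Rightarrow> ('e, 'h) signature \<Rightarrow> bool"
  where "weak_orthogonal \<tau> M \<gamma> \<delta> \<longleftrightarrow>
    (\<forall>C\<in>circuits M. \<forall>D\<in>cocircuits M. card (C \<inter> D) \<le> 3 \<longrightarrow> orthogonal_on \<tau> \<gamma> \<delta> C D)"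

definition Nt :: "strength \<Rightarrow> ('h::hyperfield \<Rightarrow> 'h) \<Rightarrow> 'e pre_matroid \<Rightarrow>
    (('e, 'h) signature \<times> ('e, 'h) signature) set"
  where "Nt s \<tau> M = {(\<gamma>, \<delta>) \<in> signatures (circuits M) \<times> signatures (cocircuits M).
    case s of Weak \<Rightarrow> weak_orthogonal \<tau> M \<gamma> \<delta> | Strong \<Rightarrow> strong_orthogonal \<tau> M \<gamma> \<delta>}"

definition sim_t :: "strength \<Rightarrow> ('h::hyperfield \<Rightarrow> 'h) \<Rightarrow> 'e pre_matroid \<Rightarrow>
    ((('e, 'h) signature \<times> ('e, 'h) signature) \<times> (('e, 'h) signature \<times> ('e, 'h) signature)) set"
  where "sim_t s \<tau> M = {((\<gamma>1, \<delta>1), (\<gamma>2, \<delta>2)). (\<gamma>1, \<delta>1) \<in> Nt s \<tau> M \<and> (\<gamma>2, \<delta>2) \<in> Nt s \<tau> M \<and>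
    (\<exists>b l. (\<forall>C\<in>circuits M. b C \<noteq> 0 \<and> (\<forall>x\<in>C. \<gamma>1 C x = b C * \<gamma>2 C x)) \<and>
           (\<forall>D\<in>cocircuits M. l D \<noteq> 0 \<and> (\<forall>y\<in>D. \<delta>1 D y = l D * \<delta>2 D y)))}"

definition Mt :: "strength \<Rightarrow> ('h::hyperfield \<Rightarrow> 'h) \<Rightarrow> 'e pre_matroid \<Rightarrow>
    (('e, 'h) signature \<times> ('e, 'h) signature) set set"
  where "Mt s \<tau> M = Nt s \<tau> M // sim_t s \<tau> M"

definition approx_t :: "('h::hyperfield \<Rightarrow> 'h) \<Rightarrow> 'e pre_matroid \<Rightarrow>
    ('e, 'h) signature \<times> ('e, 'h) signature \<Rightarrow> ('e, 'h) signature \<times> ('e, 'h) signature \<Rightarrow> bool"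
  where "approx_t \<tau> M = (\<lambda>(\<gamma>1, \<delta>1) (\<gamma>2, \<delta>2). \<exists>h. (\<forall>e\<in>ground M. h e \<noteq> 0) \<and>
    (\<forall>C\<in>circuits M. \<forall>x\<in>C. \<gamma>1 C x = h x * \<gamma>2 C x) \<and>
    (\<forall>D\<in>cocircuits M. \<forall>y\<in>D. \<delta>1 D y = \<tau> (inverse (h y)) * \<delta>2 D y))"

definition cong_t :: "strength \<Rightarrow> ('h::hyperfield \<Rightarrow> 'h) \<Rightarrow> 'e pre_matroid \<Rightarrow>
    ((('e, 'h) signature \<times> ('e, 'h) signature) set \<times>
     (('e, 'h) signature \<times> ('e, 'h) signature) set) set"
  where "cong_t s \<tau> M = {(X, Y) \<in> Mt s \<tau> M \<times> Mt s \<tau> M. \<exists>P\<in>X. \<exists>Q\<in>Y. approx_t \<tau> M P Q}"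

definition Rt :: "strength \<Rightarrow> ('h::hyperfield \<Rightarrow> 'h) \<Rightarrow> 'e pre_matroid \<Rightarrow>
    (('e, 'h) signature \<times> ('e, 'h) signature) set set set"
  where "Rt s \<tau> M = Mt s \<tau> M // cong_t s \<tau> M"

definition signature_topology :: "'h::hyperfield topology \<Rightarrow> 'e set set \<Rightarrow>
    ('e, 'h) signature topology"
  where "signature_topology T F =
    product_topology (\<lambda>C. product_topology (\<lambda>_. subtopology T (- {0})) C) F"

definition Nt_topology :: "'h::hyperfield topology \<Rightarrow> strength \<Rightarrow> ('h \<Rightarrow> 'h) \<Rightarrow> 'e pre_matroid \<Rightarrow>
    (('e, 'h) signature \<times> ('e, 'h) signature) topology"
  where "Nt_topology T s \<tau> M = subtopology
    (prod_topology (signature_topology T (circuits M)) (signature_topology T (cocircuits M)))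
    (Nt s \<tau> M)"

definition Mt_topology :: "'h::hyperfield topology \<Rightarrow> strength \<Rightarrow> ('h \<Rightarrow> 'h) \<Rightarrow> 'e pre_matroid \<Rightarrow>
    (('e, 'h) signature \<times> ('e, 'h) signature) set topology"
  where "Mt_topology T s \<tau> M = quotient_topology (Nt_topology T s \<tau> M) (sim_t s \<tau> M)"

definition Rt_topology :: "'h::hyperfield topology \<Rightarrow> strength \<Rightarrow> ('h \<Rightarrow> 'h) \<Rightarrow> 'e pre_matroid \<Rightarrow>
    (('e, 'h) signature \<times> ('e, 'h) signature) set set topology"
  where "Rt_topology T s \<tau> M = quotient_topology (Mt_topology T s \<tau> M) (cong_t s \<tau> M)"

end

theory Submission
  imports Defs
begin

text \<open>
  A function \<open>\<phi>\<close> on the ordered bases and a pair \<open>(\<gamma>, \<delta>)\<close> determine each other up to scaling by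
  \<open>\<gamma> C x / \<gamma> C y = - \<phi> (y # zs) / \<phi> (x # zs)\<close> and
  \<open>\<tau> (\<delta> D x) / \<tau> (\<delta> D y) = \<phi> (x # zs) / \<phi> (y # zs)\<close>.  For such a triple the terms of the
  Grassmann--Pluecker relation of \<open>I\<close> and \<open>J\<close> are, up to a common factor, those of the orthogonality
  relation of the circuit in \<open>I\<close> and the cocircuit avoiding \<open>J\<close>; since \<open>I\<close> and \<open>J\<close> can be chosen
  with \<open>I - J \<subseteq> C \<inter> D\<close>, this matches the weak and the strong conditions.

  Starting from \<open>\<phi>\<close>, the ratios are independent of \<open>zs\<close> by the three-term relations.  Starting from
  \<open>(\<gamma>, \<delta>)\<close>, the ratios prescribe \<open>\<phi>\<close> along the edges of the basis graph, and orthogonality for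
  \<open>card (C \<inter> D) = 2\<close> makes this consistent; instead of a homotopy theorem for the basis graph, an
  induction over the ground set glues solutions for the bases containing and avoiding an element.
  All choices can be made by products and inverses of the data, hence continuously.
\<close>

section \<open>Arithmetic in hyperfields\<close>

text \<open>The two sides are scaled by different groups: one scalar for \<open>\<phi>\<close>, but
  one for every circuit and every cocircuit on the side of pairs. The bridge is therefore a
  relation, \<open>compatible\<close>, stated through ratios in which these scalars cancel, and the
  bijection sends a class to its image under this relation. The continuous choices of
  representatives only show that images are classes and vary continuously, so one bijection, fixed
  before any topology is mentioned, serves all topologies.

  Strength enters only where relations are translated. Both constructions use what the weak case
  already provides.

  Sign is the second obstacle. A potential lives on unordered bases, while \<open>\<phi>\<close>
  alternates. A parity correction along a linear order of the ground set turns the twisted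
  consistency conditions into plain equations in the group of units. Two configurations suffice for
  the gluing: a triangle of bases, and a square of four bases one of whose missing neighbours is
  known not to be a basis.\<close>

lemma hyper_inverse_right: "x \<noteq> 0 \<Longrightarrow> x * inverse x = (1::'h::hyperfield)"
  by (metis inverse_hyper_left mult.commute)

lemma hyper_mult_left_cancel: "c \<noteq> 0 \<Longrightarrow> c * a = c * b \<longleftrightarrow> a = (b::'h::hyperfield)"
  by (metis inverse_hyper_left mult.assoc mult_1)

lemma hyper_mult_eq_0_iff [simp]: "a * b = 0 \<longleftrightarrow> a = 0 \<or> b = (0::'h::hyperfield)"
  by (metis hyper_mult_left_cancel mult_zero_left mult_zero_right)

lemma hyper_inverse_eq_0_iff [simp]: "inverse x = 0 \<longleftrightarrow> x = (0::'h::hyperfield)"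
  by (metis inverse_hyper_left inverse_hyper_zero mult_zero_left zero_neq_one)

lemma hyper_power_eq_0_iff [simp]: "a ^ n = 0 \<longleftrightarrow> a = 0 \<and> n > 0" for a :: "'h::hyperfield"
  by (induction n) auto

lemma hyper_inverse_inverse [simp]: "inverse (inverse x) = (x::'h::hyperfield)"
proof (cases "x = 0")
  case False
  have "inverse x * inverse (inverse x) = inverse x * x"
    using False by (simp add: hyper_inverse_right inverse_hyper_left)
  then show ?thesis using False by (simp add: hyper_mult_left_cancel)
qed (simp add: inverse_hyper_zero)

lemma hyper_inverse_1 [simp]: "inverse 1 = (1::'h::hyperfield)"
  by (metis hyper_inverse_right mult_1 zero_neq_one)

lemma prod_list_map_1: "prod_list (map (\<lambda>e. 1) xs) = (1::'h::monoid_mult)"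
  by (induction xs) auto

text \<open>Read as proportions, a : b = c : d = e : f. Multiplying the two hypotheses leaves the
  factor \<open>c * d\<close> to be cancelled.\<close>

lemma hyper_ratio_trans:
  fixes a b c d e f :: "'h::hyperfield"
  assumes "a * d = b * c" "c * f = d * e" "c \<noteq> 0" "d \<noteq> 0"
  shows "a * f = b * e"
proof -
  have "(c * d) * (a * f) = (a * d) * (c * f)" by (simp add: mult_ac)
  also have "\<dots> = (b * c) * (d * e)" by (simp only: assms)
  also have "\<dots> = (c * d) * (b * e)" by (simp add: mult_ac)
  finally show ?thesis using assms(3,4) by (simp add: hyper_mult_left_cancel)
qed

text \<open>Multiplying \<open>0 \<in> 1 \<boxplus> -1\<close> by \<open>x\<close> exhibits
  \<open>x * (-1)\<close> as an additive inverse of \<open>x\<close>, and that inverse is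
  unique.\<close>

lemma hyper_uminus_conv: "- x = (-1) * (x::'h::hyperfield)"
proof -
  have "x * 0 \<in> (\<lambda>u. x * u) ` (1 \<boxplus> -1)"
    using zero_in_hyperadd_uminus by blast
  then have "0 \<in> x \<boxplus> x * (-1)"
    by (simp add: hyperadd_distrib)
  then show ?thesis
    by (metis mult.commute uminus_hyper_unique)
qed

lemma hyper_uminus_uminus [simp]: "- (- x) = (x::'h::hyperfield)"
  by (metis hyperadd_commute uminus_hyper_unique zero_in_hyperadd_uminus)

lemma hyper_mult_minus_left [simp]: "(- a) * b = - (a * b :: 'h::hyperfield)"
  by (metis hyper_uminus_conv mult.assoc)

lemma hyper_mult_minus_right [simp]: "a * (- b) = - (a * b :: 'h::hyperfield)"
  by (metis hyper_mult_minus_left mult.commute)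

lemma hyper_uminus_0 [simp]: "- 0 = (0::'h::hyperfield)"
  by (metis hyper_uminus_conv mult_zero_right)

lemma hyper_uminus_eq_0_iff [simp]: "- x = 0 \<longleftrightarrow> x = (0::'h::hyperfield)"
  by (metis hyper_uminus_0 hyper_uminus_uminus)

lemma hyper_uminus_inject [simp]: "- x = - y \<longleftrightarrow> x = (y::'h::hyperfield)"
  by (metis hyper_uminus_uminus)

lemma hyper_power_minus_one_square [simp]: "(-1) ^ n * (-1) ^ n = (1::'h::hyperfield)"
  by (induction n) (auto simp: mult_ac)

section \<open>Finite hypersums\<close>

lemma hypersum_empty [simp]: "hypersum f {} = {0}"
  by (simp add: hypersum_def)

lemma hypersum_insert:
  "finite I \<Longrightarrow> i \<notin> I \<Longrightarrow> hypersum f (insert i I) = set_hyperadd {f i} (hypersum f I)"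
  by (simp add: hypersum_def)

lemma hypersum_cong: "(\<And>i. i \<in> I \<Longrightarrow> f i = g i) \<Longrightarrow> hypersum f I = hypersum g I"
  unfolding hypersum_def by (rule set_hypersum.cong) auto

lemma hypersum_reindex: "inj_on h I \<Longrightarrow> hypersum f (h ` I) = hypersum (\<lambda>i. f (h i)) I"
  by (simp add: hypersum_def set_hypersum.reindex)

lemma hypersum_neutral_cong:
  "finite T \<Longrightarrow> S \<subseteq> T \<Longrightarrow> (\<And>i. i \<in> T - S \<Longrightarrow> f i = 0) \<Longrightarrow> hypersum f T = hypersum f S"
  unfolding hypersum_def by (rule set_hypersum.mono_neutral_right) auto

lemma hypersum_mult:
  "finite I \<Longrightarrow> hypersum (\<lambda>i. a * f i) I = (\<lambda>u. a * u) ` hypersum f I"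
proof (induction rule: finite_induct)
  case (insert i I)
  have "set_hyperadd {a * f i} ((\<lambda>u. a * u) ` A) = (\<lambda>u. a * u) ` set_hyperadd {f i} A" for A
    by (simp add: set_hyperadd_def image_UN hyperadd_distrib)
  with insert show ?case
    by (simp add: hypersum_insert)
qed simp

lemma zero_in_hypersum_mult_iff:
  assumes "finite I" "a \<noteq> 0"
  shows "0 \<in> hypersum (\<lambda>i. a * f i) I \<longleftrightarrow> 0 \<in> hypersum f I"
  using assms by (auto simp: hypersum_mult image_iff intro: bexI[of _ 0])

text \<open>Uniqueness of the additive inverse makes a two-term relation an equation. This is how
  set-valued conditions come to yield exact ratios.\<close>

lemma zero_in_hypersum_pair:
  assumes "x \<noteq> y"
  shows "0 \<in> hypersum f {x, y} \<longleftrightarrow> f x = - f y"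
proof -
  have "hypersum f {x, y} = f x \<boxplus> f y"
    using assms hyperadd_commute[of "f y" 0]
    by (simp add: hypersum_insert set_hyperadd_def hyperadd_zero)
  then show ?thesis
    by (metis hyper_uminus_uminus uminus_hyper_unique zero_in_hyperadd_uminus hyperadd_commute)
qed

lemma hyperfield_involutionD:
  assumes "hyperfield_involution \<tau>"
  shows "\<tau> (\<tau> x) = x" "\<tau> (x * y) = \<tau> x * \<tau> y" "\<tau> x = 0 \<longleftrightarrow> x = 0" "\<tau> 1 = 1"
proof -
  show *: "\<tau> (\<tau> x) = x" for x
    using assms by (auto simp: hyperfield_involution_def fun_eq_iff)
  show "\<tau> (x * y) = \<tau> x * \<tau> y" "\<tau> 1 = 1"
    using assms by (auto simp: hyperfield_involution_def hyperfield_hom_def)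
  have "\<tau> 0 = 0"
    using assms by (auto simp: hyperfield_involution_def hyperfield_hom_def)
  then show "\<tau> x = 0 \<longleftrightarrow> x = 0"
    by (metis *)
qed

section \<open>Circuits and cocircuits\<close>

context matroid
begin

abbreviation rk :: nat
  where "rk \<equiv> matroid_rank M"

section \<open>Independent sets and bases\<close>

lemma finite_indep: "X \<in> indep_sets M \<Longrightarrow> finite X"
  using finite_ground finite_subset indep_subset_ground by blast

lemma finite_indep_sets: "finite (indep_sets M)"
  by (rule finite_subset[of _ "Pow (ground M)"]) (auto simp: finite_ground dest: indep_subset_ground)

lemma card_indep_le_rank: "X \<in> indep_sets M \<Longrightarrow> card X \<le> rk"
  by (simp add: matroid_rank_def finite_indep_sets)

lemma indep_extend:
  assumes "X \<in> indep_sets M" "Y \<in> indep_sets M" "card X \<le> card Y"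
  shows "\<exists>Z\<in>indep_sets M. X \<subseteq> Z \<and> Z \<subseteq> X \<union> Y \<and> card Z = card Y"
  using assms
proof (induction "card Y - card X" arbitrary: X)
  case 0
  then show ?case by auto
next
  case (Suc n)
  then have "card X < card Y" by linarith
  then obtain y where y: "y \<in> Y - X" "insert y X \<in> indep_sets M"
    using indep_augment[of X Y] Suc.prems by blast
  have "card (insert y X) = Suc (card X)"
    using y Suc.prems finite_indep by auto
  with Suc y have "\<exists>Z\<in>indep_sets M. insert y X \<subseteq> Z \<and> Z \<subseteq> insert y X \<union> Y \<and> card Z = card Y"
    by (intro Suc.hyps(1)) auto
  then show ?case using y by blast
qed

lemma exists_indep_rank: "\<exists>X\<in>indep_sets M. card X = rk"
proof -
  have "Max (card ` indep_sets M) \<in> card ` indep_sets M"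
    using finite_indep_sets indep_empty by (intro Max_in) auto
  then show ?thesis by (auto simp: matroid_rank_def)
qed

lemma bases_iff: "B \<in> bases M \<longleftrightarrow> B \<in> indep_sets M \<and> card B = rk"
proof
  assume B: "B \<in> bases M"
  then have "B \<in> indep_sets M" by (simp add: bases_def)
  moreover obtain Y where "Y \<in> indep_sets M" "card Y = rk"
    using exists_indep_rank by auto
  ultimately obtain Z where "Z \<in> indep_sets M" "B \<subseteq> Z" "card Z = rk"
    using indep_extend card_indep_le_rank by metis
  with B show "B \<in> indep_sets M \<and> card B = rk"
    by (auto simp: bases_def)
next
  assume B: "B \<in> indep_sets M \<and> card B = rk"
  have "X = B" if "X \<in> indep_sets M" "B \<subseteq> X" for X
    using that B card_indep_le_rank[of X] finite_indep[of X] card_seteq[of X B] by simp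
  with B show "B \<in> bases M"
    by (simp add: bases_def)
qed

lemma bases_nonempty: "\<exists>B. B \<in> bases M"
  using exists_indep_rank bases_iff by blast

lemma basis_finite: "B \<in> bases M \<Longrightarrow> finite B"
  and basis_subset: "B \<in> bases M \<Longrightarrow> B \<subseteq> ground M"
  and basis_indep: "B \<in> bases M \<Longrightarrow> B \<in> indep_sets M"
  and basis_card: "B \<in> bases M \<Longrightarrow> card B = rk"
  using bases_iff finite_indep indep_subset_ground by auto

lemma indep_extend_basis:
  assumes "X \<in> indep_sets M" "B \<in> bases M"
  shows "\<exists>B'\<in>bases M. X \<subseteq> B' \<and> B' \<subseteq> X \<union> B"
  using indep_extend[of X B] assms card_indep_le_rank bases_iff by metis

lemma basis_exchange:
  assumes "B \<in> bases M" "B' \<in> bases M" "x \<in> B - B'"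
  shows "\<exists>y\<in>B' - B. insert y (B - {x}) \<in> bases M"
proof -
  have card: "card B' = Suc (card (B - {x}))"
    using assms basis_finite[of B] basis_card[of B] basis_card[of B'] by (metis DiffD1 card_Suc_Diff1)
  moreover have "B - {x} \<in> indep_sets M"
    using assms basis_indep indep_subset by blast
  ultimately obtain y where y: "y \<in> B' - (B - {x})" "insert y (B - {x}) \<in> indep_sets M"
    using indep_augment[of "B - {x}" B'] assms basis_indep by auto
  then have "card (insert y (B - {x})) = card B'"
    using card assms basis_finite[of B] by auto
  then have "insert y (B - {x}) \<in> bases M"
    using y assms basis_card by (simp add: bases_iff)
  moreover have "y \<in> B' - B"
    using y assms by blast
  ultimately show ?thesis by blast
qed

text \<open>Here the incoming element is prescribed. A basis between
  \<open>insert y (B \<inter> B')\<close> and \<open>insert y B\<close> omits exactly one element of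
  \<open>B\<close>, and that element is not in \<open>B'\<close>.\<close>

lemma basis_exchange_dual:
  assumes "B \<in> bases M" "B' \<in> bases M" "y \<in> B' - B"
  shows "\<exists>x\<in>B - B'. insert y (B - {x}) \<in> bases M"
proof -
  have "insert y (B \<inter> B') \<in> indep_sets M"
    by (rule indep_subset[OF basis_indep[OF assms(2)]]) (use assms in blast)
  then obtain B2 where B2: "B2 \<in> bases M" "insert y (B \<inter> B') \<subseteq> B2" "B2 \<subseteq> insert y B"
    using indep_extend_basis[of "insert y (B \<inter> B')" B] assms by auto
  have fin: "finite B" "finite B2" using assms B2 basis_finite by auto
  have "card B2 = card B" using assms B2 basis_card by simp
  moreover have "card (B2 - {y}) = card B2 - 1" "card B2 > 0"
    using B2 fin by (auto simp: card_gt_0_iff)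
  moreover have "B2 - {y} \<subseteq> B" using B2 by blast
  ultimately have "card (B - (B2 - {y})) = 1"
    using fin by (simp add: card_Diff_subset)
  then obtain x where x: "B - (B2 - {y}) = {x}" by (metis card_1_singletonE)
  then have "B2 = insert y (B - {x})" "x \<in> B - B'"
    using B2 assms by auto
  then show ?thesis using B2 by blast
qed

section \<open>Fundamental circuits and cocircuits\<close>

lemma dependent_contains_circuit:
  assumes "X \<subseteq> ground M" "X \<notin> indep_sets M"
  shows "\<exists>C\<in>circuits M. C \<subseteq> X"
proof -
  have "finite X" using assms finite_ground finite_subset by blast
  then show ?thesis using assms
  proof (induction rule: finite_psubset_induct)
    case (psubset X)
    show ?case
    proof (cases "\<forall>Y. Y \<subset> X \<longrightarrow> Y \<in> indep_sets M")
      case True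
      with psubset.prems show ?thesis by (auto simp: circuits_def)
    next
      case False
      then obtain Y where "Y \<subset> X" "Y \<notin> indep_sets M" by auto
      then obtain C where "C \<in> circuits M" "C \<subseteq> Y" using psubset by blast
      with \<open>Y \<subset> X\<close> show ?thesis by blast
    qed
  qed
qed

lemma circuitD:
  assumes "C \<in> circuits M"
  shows "C \<subseteq> ground M" "C \<notin> indep_sets M" "X \<subset> C \<Longrightarrow> X \<in> indep_sets M" "finite C" "C \<noteq> {}"
  using assms finite_ground finite_subset indep_empty by (auto simp: circuits_def)

text \<open>For \<open>z\<close> in \<open>C\<close>, the independent set \<open>C - {z}\<close>
  extends to a basis inside \<open>I\<close> that misses \<open>z\<close>; by cardinality it is
  \<open>I - {z}\<close>. Conversely a basis \<open>I - {z}\<close> cannot contain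
  \<open>C\<close>.\<close>

lemma circuit_eq_fundamental:
  assumes "C \<in> circuits M" "C \<subseteq> I" "B \<in> bases M" "B \<subseteq> I" "finite I" "card I = Suc rk"
  shows "C = {z\<in>I. I - {z} \<in> bases M}"
proof (intro equalityI subsetI)
  fix z assume z: "z \<in> C"
  then have "C - {z} \<in> indep_sets M" using circuitD(3)[OF assms(1)] by blast
  then obtain B' where B': "B' \<in> bases M" "C - {z} \<subseteq> B'" "B' \<subseteq> (C - {z}) \<union> B"
    using indep_extend_basis assms by blast
  have "z \<notin> B'"
    using B' circuitD(2)[OF assms(1)] basis_indep[OF B'(1)] indep_subset[of B' C] by blast
  moreover have "B' \<subseteq> I" using B' assms by blast
  ultimately have "B' \<subseteq> I - {z}" by blast
  moreover have "card (I - {z}) = card B'" using assms z basis_card[OF B'(1)] by auto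
  ultimately have "B' = I - {z}" using assms by (simp add: card_subset_eq)
  then show "z \<in> {z\<in>I. I - {z} \<in> bases M}" using B' z assms by blast
next
  fix z assume z: "z \<in> {z\<in>I. I - {z} \<in> bases M}"
  then show "z \<in> C"
    using circuitD(2)[OF assms(1)] basis_indep[of "I - {z}"] indep_subset[of "I - {z}" C] assms(2)
    by blast
qed

lemma fundamental_circuit:
  assumes "I \<subseteq> ground M" "B \<in> bases M" "B \<subseteq> I" "card I = Suc rk"
  shows "{z\<in>I. I - {z} \<in> bases M} \<in> circuits M"
proof -
  have "I \<notin> indep_sets M" using card_indep_le_rank[of I] assms by auto
  then obtain C where C: "C \<in> circuits M" "C \<subseteq> I" using dependent_contains_circuit assms by blast
  moreover have "finite I" using assms finite_ground finite_subset by blast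
  ultimately show ?thesis using circuit_eq_fundamental[of C I B] assms by simp
qed

text \<open>\<open>I\<close> arises by extending \<open>C - {c}\<close> to a basis within
  \<open>C \<union> B\<close> and putting \<open>c\<close> back. The bound
  \<open>I \<subseteq> C \<union> B\<close> lets a suitable \<open>B\<close> keep
  \<open>I - J\<close> small later.\<close>

lemma circuit_in_spanning:
  assumes "C \<in> circuits M" "B \<in> bases M"
  shows "\<exists>I. C \<subseteq> I \<and> I \<subseteq> C \<union> B \<and> card I = Suc rk \<and> C = {z\<in>I. I - {z} \<in> bases M}"
proof -
  obtain c where c: "c \<in> C" using circuitD[OF assms(1)] by blast
  then have "C - {c} \<in> indep_sets M" using circuitD(3)[OF assms(1)] by blast
  then obtain B' where B': "B' \<in> bases M" "C - {c} \<subseteq> B'" "B' \<subseteq> (C - {c}) \<union> B"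
    using indep_extend_basis assms by blast
  then have "c \<notin> B'"
    using circuitD(2)[OF assms(1)] basis_indep[OF B'(1)] indep_subset[of B' C] by blast
  then have card: "card (insert c B') = Suc rk" using B' basis_finite basis_card by simp
  have "C \<subseteq> insert c B'" using B' c by blast
  moreover have "insert c B' \<subseteq> C \<union> B" using B' c by blast
  moreover have "C = {z\<in>insert c B'. insert c B' - {z} \<in> bases M}"
    using B'(1) card by (intro circuit_eq_fundamental[OF assms(1) calculation(1)] basis_finite finite.insertI) auto
  ultimately show ?thesis using card by blast
qed

text \<open>Cocircuits are the minimal sets meeting every basis; all later arguments about them take
  place in \<open>M\<close> itself through this description.\<close>

lemma cocircuits_iff: "D \<in> cocircuits M \<longleftrightarrow> D \<subseteq> ground M \<and> (\<forall>B\<in>bases M. B \<inter> D \<noteq> {}) \<and>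
    (\<forall>X. X \<subset> D \<longrightarrow> (\<exists>B\<in>bases M. B \<inter> X = {}))"
proof -
  have eq: "(\<exists>B\<in>bases M. X \<subseteq> ground M - B) \<longleftrightarrow> (\<exists>B\<in>bases M. B \<inter> X = {})" if "X \<subseteq> ground M" for X
    using that by blast
  have "D \<in> cocircuits M \<longleftrightarrow> D \<subseteq> ground M \<and> \<not> (\<exists>B\<in>bases M. D \<subseteq> ground M - B) \<and>
      (\<forall>X. X \<subset> D \<longrightarrow> (\<exists>B\<in>bases M. X \<subseteq> ground M - B))"
    by (simp add: cocircuits_def circuits_def dual_matroid_def)
  also have "\<dots> \<longleftrightarrow> D \<subseteq> ground M \<and> \<not> (\<exists>B\<in>bases M. B \<inter> D = {}) \<and>
      (\<forall>X. X \<subset> D \<longrightarrow> (\<exists>B\<in>bases M. B \<inter> X = {}))"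
  proof (cases "D \<subseteq> ground M")
    case True
    then have "X \<subset> D \<Longrightarrow> X \<subseteq> ground M" for X by blast
    with True show ?thesis by (simp add: eq)
  qed simp
  finally show ?thesis by blast
qed

lemma cocircuit_subset: "D \<in> cocircuits M \<Longrightarrow> D \<subseteq> ground M"
  by (simp add: cocircuits_iff)

lemma cocircuit_inter_nonempty: "D \<in> cocircuits M \<Longrightarrow> B \<in> bases M \<Longrightarrow> B \<inter> D \<noteq> {}"
  and cocircuit_minimal: "D \<in> cocircuits M \<Longrightarrow> X \<subset> D \<Longrightarrow> \<exists>B\<in>bases M. B \<inter> X = {}"
  by (simp_all add: cocircuits_iff)

lemma cocircuit_nonempty: "D \<in> cocircuits M \<Longrightarrow> D \<noteq> {}"
  using bases_nonempty by (auto simp: cocircuits_iff)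

lemma cocircuit_inter_basis: "D \<in> cocircuits M \<Longrightarrow> x \<in> D \<Longrightarrow> \<exists>B\<in>bases M. B \<inter> D = {x}"
proof -
  assume D: "D \<in> cocircuits M" "x \<in> D"
  then have "D - {x} \<subset> D" by blast
  then obtain B where B: "B \<in> bases M" "B \<inter> (D - {x}) = {}" using cocircuit_minimal D(1) by blast
  moreover have "B \<inter> D \<noteq> {}" using cocircuit_inter_nonempty D(1) B(1) by blast
  ultimately show ?thesis by blast
qed

lemma insert_basis_notin:
  assumes "Suc (card Z) = rk" "insert x Z \<in> bases M"
  shows "x \<notin> Z"
  using assms basis_card[of "insert x Z"] by (auto simp: insert_absorb)

lemma insert_basis_card:
  assumes "x \<notin> Z" "insert x Z \<in> bases M"
  shows "Suc (card Z) = rk"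
  using assms basis_card[of "insert x Z"] basis_finite[of "insert x Z"] by auto

text \<open>\<open>Z\<close> spans the hyperplane complementary to \<open>D\<close>. For
  \<open>x\<close> in \<open>D\<close> take a basis meeting \<open>D\<close> only in
  \<open>x\<close> and augment \<open>Z\<close> from it: the result is a basis, so it must meet
  \<open>D\<close>, which forces the new element to be \<open>x\<close>.\<close>

lemma cocircuit_eq_fundamental:
  assumes D: "D \<in> cocircuits M" and Z: "Z \<in> indep_sets M" "Suc (card Z) = rk" "Z \<inter> D = {}"
  shows "D = {x\<in>ground M. insert x Z \<in> bases M}"
proof (intro equalityI subsetI)
  fix x assume x: "x \<in> D"
  then obtain B where B: "B \<in> bases M" "B \<inter> D = {x}" using cocircuit_inter_basis D by blast
  then obtain y where y: "y \<in> B - Z" "insert y Z \<in> indep_sets M"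
    using indep_augment[of Z B] Z basis_card[of B] basis_indep by auto
  have "insert y Z \<in> bases M" using y Z finite_indep[of Z] by (simp add: bases_iff)
  moreover from this have "insert y Z \<inter> D \<noteq> {}" using D cocircuit_inter_nonempty by blast
  then have "y = x" using Z y B by blast
  ultimately show "x \<in> {x\<in>ground M. insert x Z \<in> bases M}" using x cocircuit_subset D by blast
next
  fix x assume "x \<in> {x\<in>ground M. insert x Z \<in> bases M}"
  then have "insert x Z \<inter> D \<noteq> {}" using D cocircuit_inter_nonempty by blast
  then show "x \<in> D" using Z(3) by blast
qed

text \<open>Every basis contains an element that augments \<open>Z\<close>. For minimality, if
  \<open>w\<close> is dropped from the set, then the basis \<open>insert w Z\<close> avoids what
  remains, because no element of \<open>Z\<close> belongs to the set.\<close>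

lemma fundamental_cocircuit:
  assumes Z: "insert x Z \<in> bases M" "x \<notin> Z"
  shows "{x\<in>ground M. insert x Z \<in> bases M} \<in> cocircuits M"
  unfolding cocircuits_iff
proof (intro conjI allI impI ballI)
  have card: "Suc (card Z) = rk" using insert_basis_card Z by blast
  have indep: "Z \<in> indep_sets M" using indep_subset[OF basis_indep[OF Z(1)]] by blast
  fix B assume B: "B \<in> bases M"
  then obtain y where y: "y \<in> B - Z" "insert y Z \<in> indep_sets M"
    using indep_augment[of Z B] card indep basis_card[of B] basis_indep by auto
  then have "insert y Z \<in> bases M" using card finite_indep[OF indep] by (simp add: bases_iff)
  then show "B \<inter> {x\<in>ground M. insert x Z \<in> bases M} \<noteq> {}" using y B basis_subset by blast
next
  have card: "Suc (card Z) = rk" using insert_basis_card Z by blast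
  fix X assume "X \<subset> {x\<in>ground M. insert x Z \<in> bases M}"
  then obtain w where w: "insert w Z \<in> bases M" "w \<notin> X" "X \<subseteq> {x\<in>ground M. insert x Z \<in> bases M}"
    by blast
  then have "insert w Z \<inter> X = {}" using insert_basis_notin[OF card] by blast
  then show "\<exists>B\<in>bases M. B \<inter> X = {}" using w by blast
qed auto

text \<open>
  The set \<open>J\<close> extends \<open>C - D\<close> to a basis of the hyperplane complementary to \<open>D\<close>, and \<open>I\<close> is chosen
  inside \<open>C \<union> J\<close>, so that \<open>I - J\<close> is no larger than \<open>C \<inter> D\<close>.
\<close>

lemma circuit_cocircuit_representatives:
  assumes C: "C \<in> circuits M" and D: "D \<in> cocircuits M" and "C \<inter> D \<noteq> {}"
  shows "\<exists>I J. C \<subseteq> I \<and> I \<subseteq> ground M \<and> card I = Suc rk \<and>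
    C = {z\<in>I. I - {z} \<in> bases M} \<and>
    J \<in> indep_sets M \<and> Suc (card J) = rk \<and> J \<inter> D = {} \<and> I - J \<subseteq> C \<inter> D"
proof -
  obtain x where x: "x \<in> C" "x \<in> D" using assms by blast
  obtain B where B: "B \<in> bases M" "B \<inter> D = {x}" using cocircuit_inter_basis D x by blast
  have B': "B - {x} \<in> indep_sets M" "Suc (card (B - {x})) = rk"
    using B indep_subset[OF basis_indep[OF B(1)], of "B - {x}"] basis_card[OF B(1)]
      card_Suc_Diff1[OF basis_finite[OF B(1)], of x] by (metis Diff_subset Int_iff insertI1)+
  have CD: "C - D \<in> indep_sets M" using circuitD(3)[OF C] x by blast
  have "insert x (C - D) \<subseteq> C" "x \<notin> C - D" using x by auto
  \<comment> \<open>Both sets are independent and avoid \<open>D\<close>. If \<open>C - D\<close>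
    were larger, augmenting \<open>B - {x}\<close> from it would give a basis disjoint from
    \<open>D\<close>.\<close>
  have "card (C - D) \<le> card (B - {x})"
  proof (rule ccontr)
    assume "\<not> ?thesis"
    then obtain y where "y \<in> (C - D) - (B - {x})" "insert y (B - {x}) \<in> indep_sets M"
      using indep_augment[OF B'(1) CD] by auto
    moreover from this have "insert y (B - {x}) \<in> bases M"
      using B' finite_indep[OF B'(1)] by (simp add: bases_iff)
    then have "insert y (B - {x}) \<inter> D \<noteq> {}" using D cocircuit_inter_nonempty by blast
    ultimately show False using B by blast
  qed
  then obtain J where J: "J \<in> indep_sets M" "C - D \<subseteq> J" "J \<subseteq> (C - D) \<union> (B - {x})" "card J = card (B - {x})"
    using indep_extend[OF CD B'(1)] by blast
  have JD: "J \<inter> D = {}" using J B by blast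
  have xJ: "insert x J \<in> bases M"
    using cocircuit_eq_fundamental[OF D J(1) _ JD] J B' x by auto
  obtain I where I: "C \<subseteq> I" "I \<subseteq> C \<union> insert x J" "card I = Suc rk"
      "C = {z\<in>I. I - {z} \<in> bases M}"
    using circuit_in_spanning[OF C xJ] by blast
  have "I \<subseteq> ground M" using I circuitD[OF C] basis_subset[OF xJ] by blast
  \<comment> \<open>\<open>I\<close> lies in \<open>C \<union> insert x J\<close>, the part
    \<open>C - D\<close> is absorbed by \<open>J\<close>, and \<open>x\<close> itself lies in
    \<open>C \<inter> D\<close>.\<close>
  moreover have "I - J \<subseteq> C \<inter> D" using I J x by blast
  moreover have "Suc (card J) = rk" using J B' by simp
  ultimately show ?thesis using I J(1) JD by blast
qed

end

section \<open>Alternating functions\<close>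

text \<open>As simp rules these two loop when \<open>nlists_def\<close> is unfolded.\<close>

declare nlistsE_length [simp del] nlistsE_set [simp del]

lemma in_nlists_iff: "xs \<in> nlists n A \<longleftrightarrow> length xs = n \<and> set xs \<subseteq> A"
  by (simp add: nlists_def)

text \<open>A selection sort: each entry of \<open>ys\<close> is bubbled to its place behind an
  already correct prefix. The multiset condition in the swap step tells the user that the
  intermediate lists are still rearrangements of \<open>xs\<close>.\<close>

lemma adjacent_swap_induct:
  assumes "mset xs = mset ys" "P xs"
    and swap: "\<And>A x y B. mset (A @ x # y # B) = mset xs \<Longrightarrow> P (A @ x # y # B) \<Longrightarrow> P (A @ y # x # B)"
  shows "P ys"
proof -
  have move: "P (A @ x # B @ C)" if "P (A @ B @ x # C)" "mset (A @ B @ x # C) = mset xs" for A B C x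
    using that
  proof (induction B arbitrary: C rule: rev_induct)
    case (snoc b B)
    have mset: "mset (A @ B @ x # b # C) = mset xs"
      using snoc.prems(2) by (simp add: add_mset_commute[of x b])
    have "P ((A @ B) @ x # b # C)"
      by (rule swap) (use snoc.prems in simp_all)
    with mset show ?case
      using snoc.IH[of "b # C"] by simp
  qed simp
  have "P (A @ ys)" if "P (A @ zs)" "mset zs = mset ys" "mset (A @ zs) = mset xs" for A zs
    using that
  proof (induction ys arbitrary: A zs)
    case (Cons y ys)
    then have "y \<in> set zs" by (metis list.set_intros(1) mset_eq_setD)
    then obtain B C where zs: "zs = B @ y # C" by (meson split_list)
    have "P ((A @ [y]) @ B @ C)" using move[of A B y C] Cons.prems(1,3) by (simp add: zs)
    moreover have "mset (B @ C) = mset ys" using Cons.prems(2) by (simp add: zs)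
    moreover have "mset ((A @ [y]) @ B @ C) = mset xs" using Cons.prems(3) by (simp add: zs)
    ultimately have "P ((A @ [y]) @ ys)" by (rule Cons.IH)
    then show ?case by simp
  qed simp
  from this[of "[]" xs] show ?thesis using assms(1,2) by simp
qed

lemma split_nth_pair:
  assumes "a < b" "b < length xs"
  shows "\<exists>A B C. xs = A @ xs ! a # B @ xs ! b # C \<and> length A = a \<and> Suc (a + length B) = b"
proof (intro exI conjI)
  have "drop (Suc a) xs = take (b - Suc a) (drop (Suc a) xs) @ (xs ! b) # drop (Suc b) xs"
    using assms id_take_nth_drop[of "b - Suc a" "drop (Suc a) xs"] by simp
  then show "xs = take a xs @ (xs ! a) # take (b - Suc a) (drop (Suc a) xs) @ (xs ! b) # drop (Suc b) xs"
    using assms id_take_nth_drop[of a xs] by simp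
qed (use assms in auto)

lemma permute_list_transpose:
  "permute_list (Transposition.transpose (length A) (Suc (length A + length B))) (A @ x # B @ y # C) =
    A @ y # B @ x # C"
proof (rule nth_equalityI)
  let ?a = "length A" and ?b = "Suc (length A + length B)" and ?xs = "A @ x # B @ y # C"
  fix i assume "i < length (permute_list (Transposition.transpose ?a ?b) ?xs)"
  then have i: "i < length ?xs" by simp
  have nth: "?xs ! ?a = x" "?xs ! ?b = y" "(A @ y # B @ x # C) ! ?a = y" "(A @ y # B @ x # C) ! ?b = x"
    by (simp_all add: nth_append)
  have other: "?xs ! i = (A @ y # B @ x # C) ! i" if "i \<noteq> ?a" "i \<noteq> ?b"
    using that by (auto simp: nth_append nth_Cons split: nat.splits)
  have "permute_list (Transposition.transpose ?a ?b) ?xs ! i = ?xs ! Transposition.transpose ?a ?b i"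
    using i unfolding permute_list_def by (simp only: nth_map_upt length_map length_upt add_0 diff_zero)
  also have "\<dots> = (A @ y # B @ x # C) ! i"
    using nth other by (cases "i = ?a"; cases "i = ?b") simp_all
  finally show "permute_list (Transposition.transpose ?a ?b) ?xs ! i = (A @ y # B @ x # C) ! i" .
qed simp

lemma alternating_swap:
  assumes "alternating d E \<phi>" "A @ x # y # B \<in> nlists d E"
  shows "\<phi> (A @ y # x # B) = - \<phi> (A @ x # y # B)"
proof -
  let ?p = "Transposition.transpose (length A) (Suc (length A))"
  have "length (A @ x # y # B) = d" using assms by (simp only: in_nlists_iff)
  then have "?p permutes {..<d}" by (intro permutes_swap_id) auto
  moreover have "permute_list ?p (A @ x # y # B) = A @ y # x # B"
    using permute_list_transpose[of A "[]"] by simp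
  moreover have "\<not> evenperm ?p" by (simp add: evenperm_swap)
  ultimately show ?thesis
    using assms unfolding alternating_def by metis
qed

lemma alternating_not_distinct:
  "alternating d E \<phi> \<Longrightarrow> xs \<in> nlists d E \<Longrightarrow> \<not> distinct xs \<Longrightarrow> \<phi> xs = 0"
  by (simp add: alternating_def)

text \<open>Only the sign rule for adjacent swaps is assumed here. The results thus help to
  establish \<open>alternating\<close> for a newly built function, and apply to a given alternating
  function through \<open>alternating_swap\<close>.\<close>

context
  fixes d :: nat and E :: "'e set" and \<phi> :: "'e list \<Rightarrow> 'h::hyperfield"
  assumes swap: "\<And>A x y B. A @ x # y # B \<in> nlists d E \<Longrightarrow> \<phi> (A @ y # x # B) = - \<phi> (A @ x # y # B)"
begin

lemma swap_move:
  "A @ B @ x # C \<in> nlists d E \<Longrightarrow> \<phi> (A @ B @ x # C) = (-1) ^ length B * \<phi> (A @ x # B @ C)"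
proof (induction B arbitrary: C rule: rev_induct)
  case (snoc b B)
  have "\<phi> ((A @ B) @ b # x # C) = - \<phi> ((A @ B) @ x # b # C)"
    using snoc.prems by (intro swap) (auto simp: in_nlists_iff)
  moreover have "\<phi> (A @ B @ x # b # C) = (-1) ^ length B * \<phi> (A @ x # B @ b # C)"
    using snoc.prems by (intro snoc.IH) (auto simp: in_nlists_iff)
  ultimately show ?case by simp
qed simp

text \<open>Bringing the later of the two entries next to the earlier one costs
  \<open>(-1) ^ length B\<close> on both sides, so only the sign of one adjacent swap is
  left.\<close>

lemma swap_transpose:
  assumes "A @ x # B @ y # C \<in> nlists d E"
  shows "\<phi> (A @ y # B @ x # C) = - \<phi> (A @ x # B @ y # C)"
proof -
  have "\<phi> ((A @ [x]) @ B @ y # C) = (-1) ^ length B * \<phi> ((A @ [x]) @ y # B @ C)"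
    using assms by (intro swap_move) (auto simp: in_nlists_iff)
  moreover have "\<phi> ((A @ [y]) @ B @ x # C) = (-1) ^ length B * \<phi> ((A @ [y]) @ x # B @ C)"
    using assms by (intro swap_move) (auto simp: in_nlists_iff)
  moreover have "\<phi> (A @ y # x # B @ C) = - \<phi> (A @ x # y # B @ C)"
    using assms by (intro swap) (auto simp: in_nlists_iff)
  ultimately show ?thesis by simp
qed

lemma alternating_if_swap:
  assumes "\<And>xs. xs \<in> nlists d E \<Longrightarrow> \<not> distinct xs \<Longrightarrow> \<phi> xs = 0"
  shows "alternating d E \<phi>"
  unfolding alternating_def
proof (intro ballI conjI allI impI)
  fix xs p
  assume xs: "xs \<in> nlists d E" and p: "p permutes {..<d}"
  \<comment> \<open>The list stays quantified because a transposition composed in front of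
    \<open>p\<close> acts first on the list; the induction hypothesis is then applied to the
    transposed list.\<close>
  from p finite_lessThan have "\<forall>xs\<in>nlists d E. \<phi> (permute_list p xs) = (if evenperm p then \<phi> xs else - \<phi> xs)"
  proof (induction rule: permutes_induct)
    case (swap a b p)
    have transpose: "permute_list (Transposition.transpose a b) xs \<in> nlists d E \<and>
        \<phi> (permute_list (Transposition.transpose a b) xs) = - \<phi> xs"
      if "a < b" "b < d" "xs \<in> nlists d E" for a b xs
    proof -
      have len: "length xs = d" using that by (simp add: in_nlists_iff)
      have "b < length xs" using that len by simp
      from split_nth_pair[OF \<open>a < b\<close> this]
      obtain A B C where xs_eq: "xs = A @ xs ! a # B @ xs ! b # C" and "length A = a" "Suc (a + length B) = b"
        by blast
      then have ab: "Transposition.transpose a b =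
          Transposition.transpose (length A) (Suc (length A + length B))"
        by simp
      have perm: "permute_list (Transposition.transpose a b) xs = A @ (xs ! b) # B @ (xs ! a) # C"
        unfolding ab by (subst (1) xs_eq) (rule permute_list_transpose)
      have "A @ (xs ! a) # B @ (xs ! b) # C \<in> nlists d E"
        using that(3) by (simp only: xs_eq[symmetric])
      from swap_transpose[OF this] this show ?thesis
        unfolding perm by (subst (2) xs_eq) (auto simp: in_nlists_iff)
    qed
    define q where "q = Transposition.transpose a b \<circ> p"
    have "permutation p" using swap.hyps permutation_permutes by blast
    then have parity: "evenperm q \<longleftrightarrow> \<not> evenperm p"
      unfolding q_def using swap.hyps
      by (subst evenperm_comp) (simp_all add: evenperm_swap permutation_swap_id)
    show ?case
      unfolding q_def[symmetric]
    proof
      fix xs assume xs: "xs \<in> nlists d E"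
      then have t: "permute_list (Transposition.transpose a b) xs \<in> nlists d E"
          "\<phi> (permute_list (Transposition.transpose a b) xs) = - \<phi> xs"
        using transpose[of a b xs] transpose[of b a xs] swap.hyps
        by (metis lessThan_iff nat_neq_iff transpose_commute)+
      have "permute_list q xs = permute_list p (permute_list (Transposition.transpose a b) xs)"
        unfolding q_def using xs swap.hyps by (intro permute_list_compose) (simp add: in_nlists_iff)
      then have "\<phi> (permute_list q xs) = (if evenperm p then - \<phi> xs else \<phi> xs)"
        using swap.IH t by auto
      then show "\<phi> (permute_list q xs) = (if evenperm q then \<phi> xs else - \<phi> xs)"
        using parity by simp
    qed
  qed simp_all
  then show "\<phi> (permute_list p xs) = (if evenperm p then \<phi> xs else - \<phi> xs)" using xs by blast
qed (use assms in blast)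

end

text \<open>The factor is the same for all prefixes \<open>A\<close>, so ratios of values such as
  \<open>\<phi> (x # zs)\<close> and \<open>\<phi> (y # zs)\<close> depend only on the entries of
  \<open>zs\<close> and not on their order.\<close>

lemma alternating_perm:
  assumes "alternating d E \<phi>" "mset zs = mset zs'"
  shows "\<exists>s. s \<noteq> 0 \<and> (\<forall>A. A @ zs \<in> nlists d E \<longrightarrow> \<phi> (A @ zs') = s * \<phi> (A @ zs))"
  using assms(2)
proof (rule adjacent_swap_induct)
  show "\<exists>s. s \<noteq> 0 \<and> (\<forall>A. A @ zs \<in> nlists d E \<longrightarrow> \<phi> (A @ zs) = s * \<phi> (A @ zs))"
    by (rule exI[of _ 1]) simp
next
  fix P x y Q
  assume mset: "mset (P @ x # y # Q) = mset zs"
  assume "\<exists>s. s \<noteq> 0 \<and> (\<forall>A. A @ zs \<in> nlists d E \<longrightarrow> \<phi> (A @ P @ x # y # Q) = s * \<phi> (A @ zs))"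
  then obtain s where s: "s \<noteq> 0"
      "\<And>A. A @ zs \<in> nlists d E \<Longrightarrow> \<phi> (A @ P @ x # y # Q) = s * \<phi> (A @ zs)"
    by blast
  have "\<phi> (A @ P @ y # x # Q) = (- s) * \<phi> (A @ zs)" if "A @ zs \<in> nlists d E" for A
  proof -
    have "(A @ P) @ x # y # Q \<in> nlists d E"
      using that mset_eq_setD[OF mset] mset_eq_length[OF mset] by (auto simp: in_nlists_iff)
    from alternating_swap[OF assms(1) this] show ?thesis using s(2)[OF that] by simp
  qed
  with s(1) show "\<exists>s. s \<noteq> 0 \<and> (\<forall>A. A @ zs \<in> nlists d E \<longrightarrow> \<phi> (A @ P @ y # x # Q) = s * \<phi> (A @ zs))"
    by (intro exI[of _ "- s"]) auto
qed

lemma mset_eq_distinct: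
  "distinct xs \<Longrightarrow> distinct ys \<Longrightarrow> set xs = set ys \<Longrightarrow> mset xs = mset ys"
  by (simp add: set_eq_iff_mset_eq_distinct)

text \<open>The sign of moving \<open>x\<close> from the front of a list of \<open>Z\<close>, sorted
  by \<open>n\<close>, to its sorted position.\<close>

definition ins_sign :: "('e \<Rightarrow> nat) \<Rightarrow> 'e \<Rightarrow> 'e set \<Rightarrow> 'h::hyperfield"
  where "ins_sign n x Z = (-1) ^ card {z\<in>Z. n z < n x}"

text \<open>For distinct lists this is -1 to the number of inversions with respect to
  \<open>n\<close>; it turns a function of unordered bases into an alternating one.\<close>

fun list_sign :: "('e \<Rightarrow> nat) \<Rightarrow> 'e list \<Rightarrow> 'h::hyperfield"
  where "list_sign n [] = 1"
  | "list_sign n (x # xs) = ins_sign n x (set xs) * list_sign n xs"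

lemma ins_sign_square [simp]: "ins_sign n x Z * ins_sign n x Z = (1::'h::hyperfield)"
  by (simp add: ins_sign_def)

lemma ins_sign_nonzero [simp]: "ins_sign n x Z \<noteq> (0::'h::hyperfield)"
  using ins_sign_square[of n x Z] by (metis mult_zero_left zero_neq_one)

lemma list_sign_nonzero [simp]: "list_sign n xs \<noteq> (0::'h::hyperfield)"
  by (induction xs) auto

lemma ins_sign_insert:
  assumes "finite Z" "y \<notin> Z"
  shows "ins_sign n x (insert y Z) =
    (if n y < n x then - ins_sign n x Z else ins_sign n x Z :: 'h::hyperfield)"
proof -
  have "{z \<in> insert y Z. n z < n x} =
      (if n y < n x then insert y {z \<in> Z. n z < n x} else {z \<in> Z. n z < n x})"
    by auto
  with assms show ?thesis
    by (simp add: ins_sign_def)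
qed

text \<open>The comparisons with \<open>Y\<close> agree on both sides. Each of the three pairs among
  \<open>a\<close>, \<open>b\<close>, \<open>c\<close> contributes a sign to exactly one side, which
  makes three signs in total.\<close>

lemma ins_sign_triangle:
  assumes "distinct [a, b, c]" "{a, b, c} \<inter> Y = {}" "finite Y" "inj_on n {a, b, c}"
  shows "ins_sign n b (insert a Y) * ins_sign n c (insert b Y) * ins_sign n a (insert c Y) =
    - (ins_sign n c (insert a Y) * ins_sign n a (insert b Y) * ins_sign n b (insert c Y) :: 'h::hyperfield)"
proof -
  have "n a \<noteq> n b" "n a \<noteq> n c" "n b \<noteq> n c" using assms(1,4) by (auto simp: inj_on_def)
  then show ?thesis using assms(1-3) by (auto simp: ins_sign_insert mult_ac not_less)
qed

text \<open>The same count as for the triangle, now with the four pairs that join \<open>u\<close>,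
  \<open>v\<close> to \<open>x\<close>, \<open>e\<close>; four signs cancel.\<close>

lemma ins_sign_square_relation:
  assumes "distinct [u, v, x, e]" "{u, v, x, e} \<inter> W = {}" "finite W" "inj_on n {u, v, x, e}"
  shows "ins_sign n u (insert x W) * ins_sign n x (insert v W) * ins_sign n v (insert e W) *
      ins_sign n e (insert u W) =
    (ins_sign n v (insert x W) * ins_sign n e (insert v W) * ins_sign n u (insert e W) *
      ins_sign n x (insert u W) :: 'h::hyperfield)"
proof -
  have "n u \<noteq> n x" "n u \<noteq> n e" "n v \<noteq> n x" "n v \<noteq> n e" using assms(1,4) by (auto simp: inj_on_def)
  then show ?thesis using assms(1-3) by (auto simp: ins_sign_insert mult_ac not_less)
qed

lemma list_sign_swap:
  assumes "distinct (A @ x # y # B)" "inj_on n {x, y}"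
  shows "list_sign n (A @ y # x # B) = - (list_sign n (A @ x # y # B) :: 'h::hyperfield)"
  using assms
proof (induction A)
  case Nil
  then have "n x \<noteq> n y" by (auto simp: inj_on_def)
  with Nil show ?case by (auto simp: ins_sign_insert mult_ac)
qed (simp add: insert_commute)

section \<open>Potentials on the bases of a matroid\<close>

text \<open>Reduces an argument that adds two equations to a single formal identity.\<close>

lemma eq_if_diff_eq:
  fixes a b c d x y :: "'g::ab_group_add"
  shows "a = b \<Longrightarrow> c = d \<Longrightarrow> x - y = (a - b) + (c - d) \<Longrightarrow> x = y"
  by simp

text \<open>
  The equations \<open>f (Z + x) - f (Z + y) = \<rho> Z x - \<rho> Z y\<close> prescribe \<open>f\<close> along the edges of the
  basis graph.  Both exchange properties pass to the subfamilies of bases that contain,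
  respectively avoid, a fixed element \<open>e\<close>; solutions on the two parts differ along the edges
  joining them by a constant, so they can be glued.
\<close>

lemma exchange_family_potential:
  fixes \<rho> :: "'e set \<Rightarrow> 'e \<Rightarrow> 'g::ab_group_add"
  assumes "finite F" and "\<And>B B'. B \<in> \<B> \<Longrightarrow> B' \<in> \<B> \<Longrightarrow> B - F = B' - F"
    and "\<And>B. B \<in> \<B> \<Longrightarrow> finite B"
    and "\<And>B B' x. B \<in> \<B> \<Longrightarrow> B' \<in> \<B> \<Longrightarrow> x \<in> B - B' \<Longrightarrow> \<exists>y\<in>B' - B. insert y (B - {x}) \<in> \<B>"
    and "\<And>B B' y. B \<in> \<B> \<Longrightarrow> B' \<in> \<B> \<Longrightarrow> y \<in> B' - B \<Longrightarrow> \<exists>x\<in>B - B'. insert y (B - {x}) \<in> \<B>"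
    and "\<And>Y a b c. distinct [a, b, c] \<Longrightarrow> {a, b, c} \<inter> Y = {} \<Longrightarrow> insert a (insert b Y) \<in> \<B> \<Longrightarrow>
      insert a (insert c Y) \<in> \<B> \<Longrightarrow> insert b (insert c Y) \<in> \<B> \<Longrightarrow>
      \<rho> (insert a Y) b + \<rho> (insert b Y) c + \<rho> (insert c Y) a =
      \<rho> (insert a Y) c + \<rho> (insert b Y) a + \<rho> (insert c Y) b"
    and "\<And>W u v x e. distinct [u, v, x, e] \<Longrightarrow> {u, v, x, e} \<inter> W = {} \<Longrightarrow>
      insert u (insert x W) \<in> \<B> \<Longrightarrow> insert v (insert x W) \<in> \<B> \<Longrightarrow>
      insert u (insert e W) \<in> \<B> \<Longrightarrow> insert v (insert e W) \<in> \<B> \<Longrightarrow> insert x (insert e W) \<notin> \<B> \<Longrightarrow>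
      \<rho> (insert x W) u + \<rho> (insert v W) x + \<rho> (insert e W) v + \<rho> (insert u W) e =
      \<rho> (insert x W) v + \<rho> (insert v W) e + \<rho> (insert e W) u + \<rho> (insert u W) x"
  shows "\<exists>f. \<forall>Z x y. x \<notin> Z \<longrightarrow> y \<notin> Z \<longrightarrow> insert x Z \<in> \<B> \<longrightarrow> insert y Z \<in> \<B> \<longrightarrow>
    f (insert x Z) + \<rho> Z y = f (insert y Z) + \<rho> Z x"
  using assms
proof (induction F arbitrary: \<B> rule: finite_induct)
  case empty
  \<comment> \<open>With nothing left to vary, all members of the family coincide, so the ends of an
    edge are equal.\<close>
  have "x = y" if "x \<notin> Z" "y \<notin> Z" "insert x Z \<in> \<B>" "insert y Z \<in> \<B>" for x y Z
    using empty(1)[of "insert x Z" "insert y Z"] that by auto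
  then show ?case by blast
next
  case (insert e F)
  note agree = insert.prems(1) and fin = insert.prems(2) and exch = insert.prems(3)
    and exch_dual = insert.prems(4) and triangle = insert.prems(5) and square = insert.prems(6)
  let ?S = "\<lambda>t. {B\<in>\<B>. (e \<in> B) = t}"
  have "\<exists>f. \<forall>Z x y. x \<notin> Z \<longrightarrow> y \<notin> Z \<longrightarrow> insert x Z \<in> ?S t \<longrightarrow>
      insert y Z \<in> ?S t \<longrightarrow>
      f (insert x Z) + \<rho> Z y = f (insert y Z) + \<rho> Z x" for t
  proof (rule insert.IH)
    fix B B' assume "B \<in> ?S t" "B' \<in> ?S t"
    then show "B - F = B' - F" using agree[of B B'] by blast
  next
    fix B B' x assume *: "B \<in> ?S t" "B' \<in> ?S t" "x \<in> B - B'"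
    then obtain y where "y \<in> B' - B" "insert y (B - {x}) \<in> \<B>" using exch[of B B' x] by blast
    with * show "\<exists>y\<in>B' - B. insert y (B - {x}) \<in> ?S t"
      by (intro bexI[of _ y]) auto
  next
    fix B B' y assume *: "B \<in> ?S t" "B' \<in> ?S t" "y \<in> B' - B"
    then obtain x where "x \<in> B - B'" "insert y (B - {x}) \<in> \<B>" using exch_dual[of B B' y] by blast
    with * show "\<exists>x\<in>B - B'. insert y (B - {x}) \<in> ?S t"
      by (intro bexI[of _ x]) auto
  next
    fix W u v x e'
    assume *: "distinct [u, v, x, e']" "{u, v, x, e'} \<inter> W = {}"
      "insert u (insert x W) \<in> ?S t" "insert v (insert x W) \<in> ?S t"
      "insert u (insert e' W) \<in> ?S t" "insert v (insert e' W) \<in> ?S t"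
      "insert x (insert e' W) \<notin> ?S t"
    \<comment> \<open>The four bases agree on whether they contain \<open>e\<close>, so
      \<open>e\<close> is none of \<open>u\<close>, \<open>v\<close>, \<open>x\<close>,
      \<open>e'\<close>. Hence the fifth set agrees with them too, and can only fail to be in
      \<open>?S t\<close> by not being in \<open>\<B>\<close>.\<close>
    then have "insert x (insert e' W) \<notin> \<B>" by auto
    then show "\<rho> (insert x W) u + \<rho> (insert v W) x + \<rho> (insert e' W) v + \<rho> (insert u W) e' =
        \<rho> (insert x W) v + \<rho> (insert v W) e' + \<rho> (insert e' W) u + \<rho> (insert u W) x"
      by (intro square) (use * in auto)
  next
    fix Y a b c
    assume *: "distinct [a, b, c]" "{a, b, c} \<inter> Y = {}" "insert a (insert b Y) \<in> ?S t"
      "insert a (insert c Y) \<in> ?S t" "insert b (insert c Y) \<in> ?S t"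
    show "\<rho> (insert a Y) b + \<rho> (insert b Y) c + \<rho> (insert c Y) a =
        \<rho> (insert a Y) c + \<rho> (insert b Y) a + \<rho> (insert c Y) b"
      by (rule triangle) (use * in auto)
  qed (use fin in auto)
  note part = this
  obtain f where f: "\<And>Z x y. x \<notin> Z \<Longrightarrow> y \<notin> Z \<Longrightarrow> insert x Z \<in> \<B> \<Longrightarrow> insert y Z \<in> \<B> \<Longrightarrow>
      e \<in> insert x Z \<Longrightarrow> e \<in> insert y Z \<Longrightarrow> f (insert x Z) + \<rho> Z y = f (insert y Z) + \<rho> Z x"
  proof -
    from part[of True] obtain f where "\<forall>Z x y. x \<notin> Z \<longrightarrow> y \<notin> Z \<longrightarrow> insert x Z \<in> ?S True \<longrightarrow>
      insert y Z \<in> ?S True \<longrightarrow> f (insert x Z) + \<rho> Z y = f (insert y Z) + \<rho> Z x" ..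
    then show thesis by (intro that[of f]) simp
  qed
  obtain g where g: "\<And>Z x y. x \<notin> Z \<Longrightarrow> y \<notin> Z \<Longrightarrow> insert x Z \<in> \<B> \<Longrightarrow> insert y Z \<in> \<B> \<Longrightarrow>
      e \<notin> insert x Z \<Longrightarrow> e \<notin> insert y Z \<Longrightarrow> g (insert x Z) + \<rho> Z y = g (insert y Z) + \<rho> Z x"
  proof -
    from part[of False] obtain g where "\<forall>Z x y. x \<notin> Z \<longrightarrow> y \<notin> Z \<longrightarrow> insert x Z \<in> ?S False \<longrightarrow>
      insert y Z \<in> ?S False \<longrightarrow> g (insert x Z) + \<rho> Z y = g (insert y Z) + \<rho> Z x" ..
    then show thesis by (intro that[of g]) simp
  qed
  \<comment> \<open>A crossing edge joins \<open>insert x Z\<close>, which avoids \<open>e\<close>,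
    to \<open>insert e Z\<close>. Below, \<open>k Z x\<close> is the amount that must be added to
    \<open>f\<close> for the required equation to hold on this edge.\<close>
  define crossing where "crossing Z x \<longleftrightarrow>
    x \<notin> Z \<and> e \<notin> Z \<and> x \<noteq> e \<and> insert x Z \<in> \<B> \<and> insert e Z \<in> \<B>" for Z x
  define k where "k Z x = \<rho> Z e - \<rho> Z x - f (insert e Z) + g (insert x Z)" for Z x
  \<comment> \<open>Two crossing edges that leave the same basis form a triangle with the edge
    between their ends, and both of those ends contain \<open>e\<close>, where \<open>f\<close>
    applies.\<close>
  have k_same: "k Z x = k Z' x'" if "crossing Z x" "crossing Z' x'" "insert x Z = insert x' Z'" for Z x Z' x'
  proof (cases "x = x'")
    case True
    with that have "Z = Z'" by (auto simp: crossing_def)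
    with True show ?thesis by simp
  next
    case False
    define Y where "Y = Z - {x'}"
    have Z: "Z = insert x' Y" "Z' = insert x Y" "x \<notin> Y" "x' \<notin> Y" "e \<notin> Y" "e \<noteq> x" "e \<noteq> x'"
      using that False unfolding Y_def crossing_def by auto
    have "\<rho> (insert e Y) x + \<rho> (insert x Y) x' + \<rho> (insert x' Y) e =
        \<rho> (insert e Y) x' + \<rho> (insert x Y) e + \<rho> (insert x' Y) x"
      using that Z False by (intro triangle) (auto simp: crossing_def insert_commute)
    moreover have "f (insert x (insert e Y)) + \<rho> (insert e Y) x' =
        f (insert x' (insert e Y)) + \<rho> (insert e Y) x"
      using that Z False by (intro f) (auto simp: crossing_def insert_commute)
    ultimately show ?thesis
    proof (rule eq_if_diff_eq)
      show "k Z x - k Z' x' =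
          (\<rho> (insert e Y) x + \<rho> (insert x Y) x' + \<rho> (insert x' Y) e -
            (\<rho> (insert e Y) x' + \<rho> (insert x Y) e + \<rho> (insert x' Y) x)) +
          (f (insert x (insert e Y)) + \<rho> (insert e Y) x' -
            (f (insert x' (insert e Y)) + \<rho> (insert e Y) x))"
        unfolding k_def Z by (simp add: insert_commute algebra_simps)
    qed
  qed
  \<comment> \<open>Dual exchange is used here because the incoming element must be
    \<open>e\<close>.\<close>
  have crossing_ex: "\<exists>Z x. crossing Z x \<and> insert x Z = B"
    if *: "B \<in> \<B>" "e \<notin> B" "B' \<in> \<B>" "e \<in> B'" for B B'
  proof -
    obtain x where "x \<in> B - B'" "insert e (B - {x}) \<in> \<B>" using exch_dual[of B B' e] * by blast
    then have "crossing (B - {x}) x \<and> insert x (B - {x}) = B"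
      using * by (auto simp: crossing_def insert_absorb)
    then show ?thesis by blast
  qed
  have k_adjacent: "k Z x = k Z' x'"
    if cr: "crossing Z x" "crossing Z' x'" and Z: "insert x Z = insert u Y" "insert x' Z' = insert v Y"
      and uv: "u \<notin> Y" "v \<notin> Y" for Z x Z' x' u v Y
  proof (cases "u = v")
    case True
    with k_same cr Z show ?thesis by metis
  next
    case False
    note neq = this
    have uB: "insert u Y \<in> \<B>" "insert v Y \<in> \<B>" and eY: "e \<notin> Y" "e \<noteq> u" "e \<noteq> v"
      using cr Z by (auto simp: crossing_def)
    show ?thesis
    proof (cases "insert e Y \<in> \<B>")
      case True
      then have c: "crossing Y u" "crossing Y v"
        using uB eY uv by (auto simp: crossing_def)
      have "k Y u = k Y v"
        using g[of u Y v] uB eY uv by (simp add: k_def algebra_simps)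
      then show ?thesis using k_same[OF cr(1) c(1)] k_same[OF cr(2) c(2)] Z by simp
    next
      \<comment> \<open>The two bases have no common neighbour \<open>insert e Y\<close>, so their
        crossing edges must be compared through a square.\<close>
      case notB: False
      have "x \<noteq> u"
        using notB cr(1) Z(1) uv by (auto simp: crossing_def insert_eq_iff)
      define W where "W = Y - {x}"
      have xY: "x \<in> Y" using Z(1) \<open>x \<noteq> u\<close> by blast
      have "Z = insert x Z - {x}" using cr(1) by (simp add: crossing_def)
      also have "\<dots> = insert u W" using Z(1) \<open>x \<noteq> u\<close> by (auto simp: W_def)
      finally have "Z = insert u W" .
      then have W: "Y = insert x W" "x \<notin> W" "Z = insert u W" "u \<notin> W" "v \<notin> W" "v \<noteq> x" "e \<notin> W" "x \<noteq> e"
        using xY uv eY unfolding W_def by blast+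
      have eu: "insert e (insert u W) \<in> \<B>" using cr(1) W by (auto simp: crossing_def)
      \<comment> \<open>Bringing \<open>e\<close> into \<open>insert v Y\<close> can only remove
        \<open>v\<close> or \<open>x\<close>. Removing \<open>v\<close> would make
        \<open>insert e Y\<close> a basis, so \<open>x\<close> goes and the fourth corner of the
        square is a basis.\<close>
      have "\<exists>z\<in>insert v Y - insert e (insert u W). insert e (insert v Y - {z}) \<in> \<B>"
        using exch_dual[of "insert v Y" "insert e (insert u W)" e] uB eu eY by blast
      then obtain z where z: "z \<in> insert v Y - insert e (insert u W)" "insert e (insert v Y - {z}) \<in> \<B>"
        by blast
      have "z \<noteq> v" using z notB uv by auto
      then have "z = x" using z W by auto
      then have ev: "insert e (insert v W) \<in> \<B>" using z W by (simp add: insert_Diff_if)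
      have c: "crossing (insert v W) x"
        using W ev uB eY by (auto simp: crossing_def insert_commute)
      have "\<rho> (insert x W) u + \<rho> (insert v W) x + \<rho> (insert e W) v + \<rho> (insert u W) e =
          \<rho> (insert x W) v + \<rho> (insert v W) e + \<rho> (insert e W) u + \<rho> (insert u W) x"
        using W neq eY uB eu ev notB \<open>x \<noteq> u\<close> by (intro square) (auto simp: insert_commute)
      moreover have f_eq: "f (insert v (insert e W)) + \<rho> (insert e W) u = f (insert u (insert e W)) + \<rho> (insert e W) v"
        by (rule f) (use W eY eu ev in \<open>auto simp: insert_commute\<close>)
      have g_eq: "g (insert u (insert x W)) + \<rho> (insert x W) v = g (insert v (insert x W)) + \<rho> (insert x W) u"
        by (rule g) (use W eY uB \<open>x \<noteq> u\<close> in \<open>auto simp: insert_commute\<close>)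
      have
        "f (insert v (insert e W)) + \<rho> (insert e W) u + (g (insert u (insert x W)) + \<rho> (insert x W) v) =
          f (insert u (insert e W)) + \<rho> (insert e W) v + (g (insert v (insert x W)) + \<rho> (insert x W) u)"
        by (simp only: f_eq g_eq)
      ultimately have "k (insert u W) x = k (insert v W) x"
      proof (rule eq_if_diff_eq)
        show "k (insert u W) x - k (insert v W) x =
          (\<rho> (insert x W) u + \<rho> (insert v W) x + \<rho> (insert e W) v + \<rho> (insert u W) e -
            (\<rho> (insert x W) v + \<rho> (insert v W) e + \<rho> (insert e W) u + \<rho> (insert u W) x)) +
          (f (insert v (insert e W)) + \<rho> (insert e W) u + (g (insert u (insert x W)) + \<rho> (insert x W) v) -
            (f (insert u (insert e W)) + \<rho> (insert e W) v + (g (insert v (insert x W)) + \<rho> (insert x W) u)))"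
          unfolding k_def by (simp add: insert_commute algebra_simps)
      qed
      then show ?thesis
        using k_same[OF cr(2) c] Z W by (simp add: insert_commute)
    qed
  qed
  have k_const: "k Z x = k Z' x'" if "crossing Z x" "crossing Z' x'" for Z x Z' x'
    using that
  proof (induction "card (insert x Z - insert x' Z')" arbitrary: Z x rule: less_induct)
    case less
    let ?B = "insert x Z" and ?B' = "insert x' Z'"
    have B: "?B \<in> \<B>" "?B' \<in> \<B>" "e \<notin> ?B" "e \<notin> ?B'" using less.prems by (auto simp: crossing_def)
    show ?case
    proof (cases "?B \<subseteq> ?B'")
      case True
      have "?B = ?B'"
      proof (rule ccontr)
        assume "?B \<noteq> ?B'"
        then obtain y where "y \<in> ?B' - ?B" using True by blast
        then show False using exch_dual[of ?B ?B' y] B True by blast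
      qed
      then show ?thesis using k_same less.prems by blast
    next
      case False
      then obtain u where u: "u \<in> ?B - ?B'" by blast
      then obtain v where v: "v \<in> ?B' - ?B" "insert v (?B - {u}) \<in> \<B>" using exch[of ?B ?B' u] B by blast
      \<comment> \<open>The exchange towards \<open>?B'\<close> stays among bases avoiding
        \<open>e\<close>, and \<open>insert e Z\<close> supplies a basis containing
        \<open>e\<close>; so the new basis also has a crossing edge.\<close>
      have "e \<notin> insert v (?B - {u})" using B v by auto
      then obtain Z1 x1 where Z1: "crossing Z1 x1" "insert x1 Z1 = insert v (?B - {u})"
        using crossing_ex[of "insert v (?B - {u})" "insert e Z"] v less.prems(1)
        by (auto simp: crossing_def)
      have "insert x1 Z1 - ?B' \<subset> ?B - ?B'" using u v Z1 by auto
      then have "card (insert x1 Z1 - ?B') < card (?B - ?B')"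
        using fin[OF B(1)] by (intro psubset_card_mono) auto
      then have "k Z1 x1 = k Z' x'" using less.hyps Z1 less.prems by blast
      moreover have "k Z x = k Z1 x1"
        using u v by (intro k_adjacent[OF less.prems(1) Z1(1), of u "?B - {u}" v] Z1(2)) auto
      ultimately show ?thesis by simp
    qed
  qed
  \<comment> \<open>If no edge crosses, any constant will do. Adding the same \<open>c\<close> to
    every value of \<open>f\<close> leaves its own equations intact and repairs all the crossing
    ones.\<close>
  obtain c where c: "\<And>Z x. crossing Z x \<Longrightarrow> k Z x = c"
    using k_const by metis
  have cross: "f (insert e Z) + c + \<rho> Z x = g (insert x Z) + \<rho> Z e" if "crossing Z x" for Z x
    using c[OF that] by (auto simp: k_def algebra_simps)
  define F where "F B = (if e \<in> B then f B + c else g B)" for B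
  have "F (insert x Z) + \<rho> Z y = F (insert y Z) + \<rho> Z x"
    if *: "x \<notin> Z" "y \<notin> Z" "insert x Z \<in> \<B>" "insert y Z \<in> \<B>" for Z x y
  proof -
    consider "e \<in> Z \<or> x = y" | "e \<notin> Z" "x \<noteq> e" "y \<noteq> e" | "e \<notin> Z" "x \<noteq> y" "x = e" | "e \<notin> Z" "x \<noteq> y" "y = e"
      by blast
    then show ?thesis
    proof cases
      case 1
      then show ?thesis using f[of x Z y] * by (auto simp: F_def algebra_simps)
    next
      case 2
      then show ?thesis using g[of x Z y] * by (auto simp: F_def)
    next
      case 3
      then have "crossing Z y" using * by (auto simp: crossing_def)
      from cross[OF this] show ?thesis using 3 by (auto simp: F_def)
    next
      case 4
      then have "crossing Z x" using * by (auto simp: crossing_def)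
      from cross[OF this] show ?thesis using 4 by (auto simp: F_def)
    qed
  qed
  then show ?case by blast
qed

section \<open>Functions supported on the bases of a matroid\<close>

text \<open>The sizes for which a relation is demanded: the size of \<open>I - J\<close> for
  functions and of \<open>C \<inter> D\<close> for signatures. It allows one proof for both
  strengths.\<close>

definition within_strength :: "strength \<Rightarrow> nat \<Rightarrow> bool"
  where "within_strength s n \<longleftrightarrow> s = Strong \<or> n \<le> 3"

context matroid
begin

abbreviation rank_tuples :: "'e list set"
  where "rank_tuples \<equiv> nlists rk (ground M)"

definition basis_list :: "'e list \<Rightarrow> bool"
  where "basis_list xs \<longleftrightarrow> distinct xs \<and> set xs \<in> bases M"

definition basis_function :: "('e list \<Rightarrow> 'h::hyperfield) \<Rightarrow> bool"
  where "basis_function \<phi> \<longleftrightarrow> alternating rk (ground M) \<phi> \<and>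
    (\<forall>xs\<in>rank_tuples. \<phi> xs \<noteq> 0 \<longleftrightarrow> basis_list xs)"

lemma basis_list_nlists: "basis_list xs \<Longrightarrow> xs \<in> rank_tuples"
  using basis_card[of "set xs"] basis_subset[of "set xs"]
  by (auto simp: basis_list_def in_nlists_iff distinct_card)

lemma basis_list_perm: "mset xs = mset ys \<Longrightarrow> basis_list xs \<longleftrightarrow> basis_list ys"
  by (metis basis_list_def mset_eq_setD mset_eq_imp_distinct_iff)

lemma ex_basis_list: "B \<in> bases M \<Longrightarrow> \<exists>xs. set xs = B \<and> basis_list xs"
  by (metis basis_finite basis_list_def finite_distinct_list)

lemma basis_function_nonzero: "basis_function \<phi> \<Longrightarrow> basis_list xs \<Longrightarrow> \<phi> xs \<noteq> 0"
  using basis_list_nlists by (auto simp: basis_function_def)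

lemma basis_function_eq_0:
  "basis_function \<phi> \<Longrightarrow> xs \<in> rank_tuples \<Longrightarrow> \<not> basis_list xs \<Longrightarrow> \<phi> xs = 0"
  by (auto simp: basis_function_def)

lemma basis_function_swap:
  "basis_function \<phi> \<Longrightarrow> basis_list (A @ x # y # B) \<Longrightarrow> \<phi> (A @ y # x # B) = - \<phi> (A @ x # y # B)"
  by (metis alternating_swap basis_function_def basis_list_nlists)

lemma basis_list_Cons_rank: "basis_list (x # zs) \<Longrightarrow> Suc (length zs) = rk"
  using basis_list_nlists[of "x # zs"] by (simp add: in_nlists_iff)

lemma basis_list_tail:
  assumes "basis_list (x # zs)"
  shows "set zs \<in> indep_sets M" "Suc (card (set zs)) = rk"
  using assms indep_subset[OF basis_indep, of "set (x # zs)" "set zs"] basis_list_Cons_rank[OF assms]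
  by (auto simp: basis_list_def distinct_card)

text \<open>Connectivity of the basis graph as an induction rule. Exchanges replace only the first
  entry, which is the form in which \<open>compatible\<close> speaks about \<open>\<phi>\<close>;
  swaps provide the rest.\<close>

lemma basis_list_induct:
  assumes "basis_list xs0" "basis_list xs" "P xs0"
    and swap: "\<And>A x y B. basis_list (A @ x # y # B) \<Longrightarrow> P (A @ x # y # B) \<Longrightarrow> P (A @ y # x # B)"
    and exchange: "\<And>x y zs. basis_list (x # zs) \<Longrightarrow> basis_list (y # zs) \<Longrightarrow> P (x # zs) \<Longrightarrow> P (y # zs)"
  shows "P xs"
  using assms(2)
proof (induction "card (set xs - set xs0)" arbitrary: xs rule: less_induct)
  case less
  have perm: "P ys'" if "basis_list ys" "P ys" "mset ys = mset ys'" for ys ys'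
    using that(3,2) by (rule adjacent_swap_induct) (metis swap basis_list_perm that(1))
  have bases: "set xs \<in> bases M" "set xs0 \<in> bases M" and dist: "distinct xs" "distinct xs0"
    using less.prems assms(1) by (auto simp: basis_list_def)
  show ?case
  proof (cases "set xs \<subseteq> set xs0")
    case True
    then have "set xs = set xs0"
      using bases by (metis card_subset_eq basis_card basis_finite)
    then show ?thesis
      using perm[OF assms(1) assms(3)] dist mset_eq_distinct by metis
  next
    case False
    then obtain x where x: "x \<in> set xs - set xs0" by blast
    then obtain y where y: "y \<in> set xs0 - set xs" "insert y (set xs - {x}) \<in> bases M"
      using basis_exchange[OF bases] by blast
    define zs where "zs = remove1 x xs"
    have zs: "mset (x # zs) = mset xs" "set zs = set xs - {x}" "distinct zs"
      using x dist by (auto simp: zs_def)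
    have b: "basis_list (x # zs)" using basis_list_perm[OF zs(1)] less.prems by blast
    have c: "basis_list (y # zs)" using y zs by (auto simp: basis_list_def)
    have "set (y # zs) - set xs0 \<subset> set xs - set xs0" using x y zs by auto
    then have "card (set (y # zs) - set xs0) < card (set xs - set xs0)"
      by (intro psubset_card_mono) auto
    then have "P (y # zs)" using less.hyps c by blast
    then have "P (x # zs)" using exchange c b by blast
    then show ?thesis using perm[OF b _ zs(1)] by blast
  qed
qed

lemma gp_bases_eq_iff:
  assumes "alternating rk (ground M) \<phi>"
  shows "gp_bases rk (ground M) \<phi> = bases M \<longleftrightarrow> basis_function \<phi>"
proof
  assume eq: "gp_bases rk (ground M) \<phi> = bases M"
  show "basis_function \<phi>"
    unfolding basis_function_def
  proof (intro conjI ballI assms)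
    fix xs assume xs: "xs \<in> rank_tuples"
    show "\<phi> xs \<noteq> 0 \<longleftrightarrow> basis_list xs"
    proof
      assume "\<phi> xs \<noteq> 0"
      then show "basis_list xs"
        using xs eq alternating_not_distinct[OF assms xs]
        unfolding basis_list_def gp_bases_def by blast
    next
      assume "basis_list xs"
      then have "set xs \<in> gp_bases rk (ground M) \<phi>" "distinct xs"
        using eq by (auto simp: basis_list_def)
      then obtain ys where ys: "set ys = set xs" "ys \<in> rank_tuples" "\<phi> ys \<noteq> 0"
        unfolding gp_bases_def by auto
      then have "distinct ys" using alternating_not_distinct[OF assms ys(2)] by blast
      from alternating_perm[OF assms mset_eq_distinct[OF this \<open>distinct xs\<close> ys(1)]] obtain s where
        "s \<noteq> 0" "\<forall>A. A @ ys \<in> rank_tuples \<longrightarrow> \<phi> (A @ xs) = s * \<phi> (A @ ys)"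
        by blast
      then have "\<phi> xs = s * \<phi> ys" using ys(2) by (metis append_Nil)
      then show "\<phi> xs \<noteq> 0" using ys \<open>s \<noteq> 0\<close> by simp
    qed
  qed
next
  assume b: "basis_function \<phi>"
  then have *: "xs \<in> rank_tuples \<and> \<phi> xs \<noteq> 0 \<longleftrightarrow> basis_list xs" for xs
    using basis_list_nlists by (auto simp: basis_function_def)
  show "gp_bases rk (ground M) \<phi> = bases M"
    using ex_basis_list unfolding gp_bases_def * by (auto simp: basis_list_def)
qed

text \<open>The weak definition asks for some matroid with the right bases; \<open>M\<close> itself
  is that matroid.\<close>

lemma Np_iff: "\<phi> \<in> Np s rk M \<longleftrightarrow>
    \<phi> \<in> extensional (rank_tuples) \<and> basis_function \<phi> \<and>
    (\<forall>xs ys. set xs \<subseteq> ground M \<and> set ys \<subseteq> ground M \<and> distinct xs \<and> distinct ys \<and>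
      length xs = rk + 1 \<and> length ys + 1 = rk \<and>
      within_strength s (card (set xs - set ys)) \<longrightarrow> gp_relation \<phi> xs ys)"
proof -
  have nonzero: "\<exists>xs\<in>rank_tuples. \<phi> xs \<noteq> 0" if "basis_function \<phi>"
    using that bases_nonempty ex_basis_list basis_list_nlists basis_function_nonzero by metis
  have alt: "alternating rk (ground M) \<phi>" if "basis_function \<phi>"
    using that by (simp add: basis_function_def)
  show ?thesis
  proof (cases "basis_function \<phi>")
    case True
    then have "gp_bases rk (ground M) \<phi> = bases M"
      using gp_bases_eq_iff alt by blast
    with True nonzero alt matroid_axioms show ?thesis
      by (cases s) (auto simp: Np_def weak_gp_def strong_gp_def within_strength_def)
  next
    case False
    then show ?thesis
      using gp_bases_eq_iff[of \<phi>] by (cases s) (auto simp: Np_def weak_gp_def strong_gp_def)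
  qed
qed

lemma basis_list_exchange_cocircuit:
  assumes "D \<in> cocircuits M" "basis_list (x # zs)" "set zs \<inter> D = {}" "y \<in> D"
  shows "basis_list (y # zs)"
proof -
  have "D = {x\<in>ground M. insert x (set zs) \<in> bases M}"
    using cocircuit_eq_fundamental[OF assms(1) basis_list_tail[OF assms(2)] assms(3)] .
  then show ?thesis using assms by (auto simp: basis_list_def)
qed

text \<open>If \<open>y\<close> were missing from \<open>C\<close>, or already among
  \<open>x # zs\<close>, then \<open>C\<close> would lie in a basis.\<close>

lemma basis_list_circuit:
  assumes "C \<in> circuits M" "basis_list (x # zs)" "C \<subseteq> insert x (insert y (set zs))"
  shows "y \<in> C" "y \<notin> set (x # zs)"
    "C = {z \<in> insert x (insert y (set zs)). insert x (insert y (set zs)) - {z} \<in> bases M}"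
proof -
  let ?I = "insert x (insert y (set zs))"
  have b: "set (x # zs) \<in> bases M" using assms by (simp add: basis_list_def)
  have n: "\<not> C \<subseteq> set (x # zs)"
    using circuitD(2)[OF assms(1)] indep_subset[OF basis_indep[OF b]] by blast
  then show y: "y \<in> C" "y \<notin> set (x # zs)" using assms by auto
  have "card ?I = Suc rk"
    using y(2) basis_card[OF b] insert_commute[of x y "set zs"] by simp
  then show "C = {z \<in> ?I. ?I - {z} \<in> bases M}"
    using b by (intro circuit_eq_fundamental[OF assms(1,3) b]) auto
qed

lemma basis_list_exchange_circuit:
  assumes "C \<in> circuits M" "basis_list (x # zs)" "C \<subseteq> insert x (insert y (set zs))" "x \<in> C"
  shows "basis_list (y # zs)"
proof -
  have "insert x (insert y (set zs)) - {x} \<in> bases M"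
    using basis_list_circuit(3)[OF assms(1-3)] assms(4) by blast
  moreover have "insert x (insert y (set zs)) - {x} = set (y # zs)"
    using basis_list_circuit(2)[OF assms(1-3)] assms(2) by (auto simp: basis_list_def)
  ultimately show ?thesis
    using basis_list_circuit(2)[OF assms(1-3)] assms(2) by (auto simp: basis_list_def)
qed

lemma circuit_basis_list:
  assumes "C \<in> circuits M" "x \<in> C" "y \<in> C" "x \<noteq> y"
  shows "\<exists>zs. basis_list (x # zs) \<and> C \<subseteq> insert x (insert y (set zs))"
proof -
  obtain B where "B \<in> bases M" using bases_nonempty by blast
  then obtain I where I: "C \<subseteq> I" "card I = Suc rk" "C = {z\<in>I. I - {z} \<in> bases M}"
    using circuit_in_spanning[OF assms(1)] by blast
  then have b: "I - {y} \<in> bases M" using assms by blast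
  obtain zs where zs: "set zs = I - {y} - {x}" "distinct zs"
    using basis_finite[OF b] finite_distinct_list by (metis finite_Diff)
  have "insert x (set zs) = I - {y}" using zs I assms by auto
  then have "basis_list (x # zs)" using zs b by (simp add: basis_list_def)
  moreover have "C \<subseteq> insert x (insert y (set zs))" using zs I by auto
  ultimately show ?thesis by blast
qed

lemma cocircuit_basis_list:
  assumes "D \<in> cocircuits M" "x \<in> D"
  shows "\<exists>zs. basis_list (x # zs) \<and> set zs \<inter> D = {}"
proof -
  obtain B where B: "B \<in> bases M" "B \<inter> D = {x}" using cocircuit_inter_basis assms by blast
  obtain zs where zs: "set zs = B - {x}" "distinct zs"
    using basis_finite[OF B(1)] finite_distinct_list by (metis finite_Diff)
  have "insert x (set zs) = B" using zs B by auto
  then have "basis_list (x # zs)" using zs B by (simp add: basis_list_def)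
  moreover have "set zs \<inter> D = {}" using zs B by auto
  ultimately show ?thesis by blast
qed

end

section \<open>Deleting an entry from a list\<close>

lemma delete_nth:
  assumes "k \<in> {1..length xs}" "distinct xs"
  shows "set xs = insert (xs ! (k - 1)) (set (take (k - 1) xs @ drop k xs))"
    and "xs ! (k - 1) \<notin> set (take (k - 1) xs @ drop k xs)"
    and "distinct (take (k - 1) xs @ drop k xs)"
    and "Suc (length (take (k - 1) xs @ drop k xs)) = length xs"
proof -
  have "Suc (k - 1) = k" "k - 1 < length xs" using assms by auto
  then have eq: "xs = take (k - 1) xs @ xs ! (k - 1) # drop k xs"
    using id_take_nth_drop[of "k - 1" xs] by simp
  define A x B where "A = take (k - 1) xs" and "x = xs ! (k - 1)" and "B = drop k xs"
  have "xs = A @ x # B" using eq by (simp add: A_def x_def B_def)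
  with assms(2) show "set xs = insert (xs ! (k - 1)) (set (take (k - 1) xs @ drop k xs))"
    "xs ! (k - 1) \<notin> set (take (k - 1) xs @ drop k xs)" "distinct (take (k - 1) xs @ drop k xs)"
    "Suc (length (take (k - 1) xs @ drop k xs)) = length xs"
    unfolding A_def[symmetric] x_def[symmetric] B_def[symmetric] by auto
qed

text \<open>As in \<open>gp_relation\<close>, the index \<open>k\<close> counts from 1.\<close>

definition deleted_value :: "('e list \<Rightarrow> 'h::hyperfield) \<Rightarrow> 'e list \<Rightarrow> nat \<Rightarrow> 'h"
  where "deleted_value \<phi> xs k = (-1) ^ k * \<phi> (take (k - 1) xs @ drop k xs)"

text \<open>This is the origin of the minus sign in the circuit clause of \<open>compatible\<close>.
  After a deletion the surviving entry of the pair is moved to the front, so that both lists end in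
  the same \<open>W\<close>.\<close>

lemma deleted_value_pair:
  assumes alt: "alternating d E \<phi>" and xs: "length xs = Suc d" "set xs \<subseteq> E"
    and ij: "i \<noteq> j" "i \<in> {1..length xs}" "j \<in> {1..length xs}"
  shows "\<exists>s W. s \<noteq> 0 \<and> mset xs = mset (xs ! (i - 1) # xs ! (j - 1) # W) \<and>
    deleted_value \<phi> xs i = s * \<phi> (xs ! (j - 1) # W) \<and>
    deleted_value \<phi> xs j = - (s * \<phi> (xs ! (i - 1) # W))"
proof -
  have less: "\<exists>s W. s \<noteq> 0 \<and> mset xs = mset (xs ! (i - 1) # xs ! (j - 1) # W) \<and>
    deleted_value \<phi> xs i = s * \<phi> (xs ! (j - 1) # W) \<and>
    deleted_value \<phi> xs j = - (s * \<phi> (xs ! (i - 1) # W))"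
    if ij: "i < j" "i \<in> {1..length xs}" "j \<in> {1..length xs}" for i j
  proof -
    define a b x y where "a = i - 1" and "b = j - 1" and "x = xs ! a" and "y = xs ! b"
    have ab: "a < b" "b < length xs" "i = Suc a" "j = Suc b" using ij by (auto simp: a_def b_def)
    then obtain A B C where xs_eq': "xs = A @ x # B @ y # C" and len: "length A = a" "Suc (a + length B) = b"
      using split_nth_pair[OF ab(1,2)] unfolding x_def y_def by blast
    have split: "take (length P) (P @ z # Q) @ drop (Suc (length P)) (P @ z # Q) = P @ Q" for P Q :: "'e list" and z
      by simp
    have i: "take (i - 1) xs @ drop i xs = A @ B @ y # C"
      using split[of A x "B @ y # C"] xs_eq' len ab by simp
    have "j - 1 = length (A @ x # B)" "j = Suc (length (A @ x # B))" using len ab by simp_all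
    then have j: "take (j - 1) xs @ drop j xs = A @ x # B @ C"
      using split[of "A @ x # B" y C] xs_eq' by (simp only: append_assoc append_Cons)
    have N: "[] @ (A @ B) @ y # C \<in> nlists d E" "[] @ A @ x # B @ C \<in> nlists d E"
      using xs by (subst (asm) (1 2) xs_eq', simp add: in_nlists_iff)+
    have "\<phi> ([] @ (A @ B) @ y # C) = (-1) ^ length (A @ B) * \<phi> ([] @ y # (A @ B) @ C)"
      using alternating_swap[OF alt] by (intro swap_move[OF _ N(1)])
    then have 1: "\<phi> (A @ B @ y # C) = (-1) ^ (a + length B) * \<phi> (y # A @ B @ C)"
      using len by simp
    have "\<phi> ([] @ A @ x # B @ C) = (-1) ^ length A * \<phi> ([] @ x # A @ B @ C)"
      using alternating_swap[OF alt] by (intro swap_move[OF _ N(2)])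
    then have 2: "\<phi> (A @ x # B @ C) = (-1) ^ a * \<phi> (x # A @ B @ C)"
      using len by simp
    \<comment> \<open>The exponents to compare are \<open>i + a + length B\<close> and
      \<open>j + a\<close>. Since \<open>j = i + length B + 1\<close>, they differ by one, so the
      two signs are opposite.\<close>
    have "b = Suc (a + length B)" using len by simp
    then have "deleted_value \<phi> xs j = - ((-1) ^ i * (-1) ^ (a + length B) * \<phi> (x # A @ B @ C))"
      unfolding deleted_value_def j 2 by (simp add: ab power_add mult_ac)
    moreover have "deleted_value \<phi> xs i = (-1) ^ i * (-1) ^ (a + length B) * \<phi> (y # A @ B @ C)"
      unfolding deleted_value_def i 1 by (simp add: mult_ac)
    moreover have "mset xs = mset (x # y # A @ B @ C)"
      by (subst xs_eq') (simp add: add_mset_commute)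
    ultimately show ?thesis
      unfolding x_def y_def a_def b_def
      by (intro exI[of _ "(-1) ^ i * (-1) ^ (a + length B)"] exI[of _ "A @ B @ C"])
        (simp add: a_def)
  qed
  show ?thesis
  proof (cases "i < j")
    case True
    then show ?thesis using less ij by blast
  next
    case False
    then obtain s W where "s \<noteq> 0" "mset xs = mset (xs ! (j - 1) # xs ! (i - 1) # W)"
      "deleted_value \<phi> xs j = s * \<phi> (xs ! (i - 1) # W)"
      "deleted_value \<phi> xs i = - (s * \<phi> (xs ! (j - 1) # W))"
      using less[of j i] ij by auto
    then show ?thesis
      by (intro exI[of _ "- s"] exI[of _ W]) (simp add: add_mset_commute)
  qed
qed

section \<open>Compatible functions and signatures\<close>

locale matroid_involution = matroid M for M :: "'e pre_matroid" +
  fixes \<tau> :: "'h::hyperfield \<Rightarrow> 'h"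
  assumes involution: "hyperfield_involution \<tau>"
begin

lemmas involution_simps [simp] = hyperfield_involutionD[OF involution]

lemma involution_inject: "\<tau> a = \<tau> b \<longleftrightarrow> a = b"
  by (metis involution_simps(1))

text \<open>
  Up to a factor, \<open>\<gamma> C x\<close> is \<open>\<plusminus>\<phi> (I - x)\<close> for a spanning set \<open>I\<close> of \<open>d + 1\<close> elements containing
  \<open>C\<close>, and \<open>\<tau> (\<delta> D x)\<close> is \<open>\<phi> (x # J)\<close> for a basis \<open>J\<close> of the hyperplane complementary to \<open>D\<close>.
\<close>

definition compatible :: "('e, 'h) signature \<Rightarrow> ('e, 'h) signature \<Rightarrow> ('e list \<Rightarrow> 'h) \<Rightarrow> bool"
  where "compatible \<gamma> \<delta> \<phi> \<longleftrightarrow>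
    (\<forall>D\<in>cocircuits M. \<forall>zs x y. x \<in> D \<longrightarrow> y \<in> D \<longrightarrow> set zs \<inter> D = {} \<longrightarrow> basis_list (x # zs) \<longrightarrow>
      \<phi> (x # zs) * \<tau> (\<delta> D y) = \<phi> (y # zs) * \<tau> (\<delta> D x)) \<and>
    (\<forall>C\<in>circuits M. \<forall>zs x y. x \<in> C \<longrightarrow> y \<in> C \<longrightarrow> x \<noteq> y \<longrightarrow> C \<subseteq> insert x (insert y (set zs)) \<longrightarrow>
      basis_list (x # zs) \<longrightarrow> \<gamma> C x * \<phi> (x # zs) = - (\<gamma> C y * \<phi> (y # zs)))"

lemma compatible_cocircuit:
  "compatible \<gamma> \<delta> \<phi> \<Longrightarrow> D \<in> cocircuits M \<Longrightarrow> x \<in> D \<Longrightarrow> y \<in> D \<Longrightarrow> set zs \<inter> D = {} \<Longrightarrow>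
    basis_list (x # zs) \<Longrightarrow> \<phi> (x # zs) * \<tau> (\<delta> D y) = \<phi> (y # zs) * \<tau> (\<delta> D x)"
  unfolding compatible_def by blast

lemma compatible_circuit:
  "compatible \<gamma> \<delta> \<phi> \<Longrightarrow> C \<in> circuits M \<Longrightarrow> x \<in> C \<Longrightarrow> y \<in> C \<Longrightarrow> x \<noteq> y \<Longrightarrow>
    C \<subseteq> insert x (insert y (set zs)) \<Longrightarrow> basis_list (x # zs) \<Longrightarrow>
    \<gamma> C x * \<phi> (x # zs) = - (\<gamma> C y * \<phi> (y # zs))"
  unfolding compatible_def by blast

lemma signature_nonzero: "\<sigma> \<in> signatures F \<Longrightarrow> A \<in> F \<Longrightarrow> x \<in> A \<Longrightarrow> \<sigma> A x \<noteq> (0::'h)"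
  unfolding signatures_def by (metis ComplD PiE_mem singletonI)

lemma Nt_iff: "(\<gamma>, \<delta>) \<in> Nt s \<tau> M \<longleftrightarrow>
    \<gamma> \<in> signatures (circuits M) \<and> \<delta> \<in> signatures (cocircuits M) \<and>
    (\<forall>C\<in>circuits M. \<forall>D\<in>cocircuits M. within_strength s (card (C \<inter> D)) \<longrightarrow> orthogonal_on \<tau> \<gamma> \<delta> C D)"
  by (cases s) (auto simp: Nt_def weak_orthogonal_def strong_orthogonal_def within_strength_def)

text \<open>Any index is compared with one reference index \<open>k0\<close> by
  \<open>deleted_value_pair\<close>; the circuit clause of \<open>compatible\<close> then says that
  both deleted values have the same quotient by the signature.\<close>

lemma compatible_deleted_value:
  assumes comp: "compatible \<gamma> \<delta> \<phi>" and bf: "basis_function \<phi>" and \<gamma>: "\<gamma> \<in> signatures (circuits M)"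
    and C: "C \<in> circuits M"
    and xs: "distinct xs" "set xs \<subseteq> ground M" "length xs = Suc rk"
    and C_eq: "C = {z \<in> set xs. set xs - {z} \<in> bases M}"
  shows "\<exists>\<kappa>. \<kappa> \<noteq> 0 \<and> (\<forall>k\<in>{1..length xs}. xs ! (k - 1) \<in> C \<longrightarrow>
    deleted_value \<phi> xs k = \<kappa> * \<gamma> C (xs ! (k - 1)))"
proof -
  have alt: "alternating rk (ground M) \<phi>" using bf by (simp add: basis_function_def)
  obtain c where c: "c \<in> C" using circuitD(5)[OF C] by blast
  then have "c \<in> set xs" using C_eq by blast
  then obtain i where i: "i < length xs" "xs ! i = c" by (meson in_set_conv_nth)
  define k0 where "k0 = Suc i"
  have k0: "k0 \<in> {1..length xs}" "xs ! (k0 - 1) \<in> C" using i c by (simp_all add: k0_def)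
  let ?x = "\<lambda>k. xs ! (k - 1)"
  have nz: "\<gamma> C (?x k) \<noteq> 0" if "?x k \<in> C" for k
    using signature_nonzero[OF \<gamma> C that] .
  have step: "\<gamma> C (?x k) * deleted_value \<phi> xs k0 = \<gamma> C (?x k0) * deleted_value \<phi> xs k \<and>
      deleted_value \<phi> xs k0 \<noteq> 0"
    if k: "k \<in> {1..length xs}" "?x k \<in> C" "k \<noteq> k0" for k
  proof -
    obtain s W where sW: "s \<noteq> 0" "mset xs = mset (?x k # ?x k0 # W)"
      "deleted_value \<phi> xs k = s * \<phi> (?x k0 # W)" "deleted_value \<phi> xs k0 = - (s * \<phi> (?x k # W))"
      using deleted_value_pair[OF alt xs(3,2) k(3,1) k0(1)] by blast
    have W: "distinct (?x k # ?x k0 # W)" "set xs = set (?x k # ?x k0 # W)"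
      using sW(2) xs(1) mset_eq_imp_distinct_iff mset_eq_setD by blast+
    then have "set xs - {?x k0} = set (?x k # W)" by auto
    then have b: "basis_list (?x k # W)" using k0(2) C_eq W(1) by (auto simp: basis_list_def)
    have "C \<subseteq> set xs" using C_eq by blast
    then have "C \<subseteq> insert (?x k) (insert (?x k0) (set W))" using W(2) by simp
    then have "\<gamma> C (?x k) * \<phi> (?x k # W) = - (\<gamma> C (?x k0) * \<phi> (?x k0 # W))"
      using W(1) by (intro compatible_circuit[OF comp C k(2) k0(2) _ _ b]) auto
    moreover have "\<gamma> C (?x k) * (s * \<phi> (?x k # W)) = s * (\<gamma> C (?x k) * \<phi> (?x k # W))"
      by (simp add: mult_ac)
    ultimately show ?thesis
      using sW(1) basis_function_nonzero[OF bf b] unfolding sW(3,4) by (simp add: mult_ac)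
  qed
  define \<kappa> where "\<kappa> = deleted_value \<phi> xs k0 * inverse (\<gamma> C (?x k0))"
  have value0: "deleted_value \<phi> xs k0 \<noteq> 0"
  proof -
    have "set (take (k0 - 1) xs @ drop k0 xs) = set xs - {?x k0}"
      using delete_nth(1,2)[OF k0(1) xs(1)] by blast
    then have "basis_list (take (k0 - 1) xs @ drop k0 xs)"
      using k0(2) C_eq delete_nth(3)[OF k0(1) xs(1)] by (simp add: basis_list_def)
    then show ?thesis using basis_function_nonzero[OF bf] by (simp add: deleted_value_def)
  qed
  have "deleted_value \<phi> xs k = \<kappa> * \<gamma> C (?x k)" if k: "k \<in> {1..length xs}" "?x k \<in> C" for k
  proof (cases "k = k0")
    case True
    then show ?thesis using nz[OF k0(2)] by (simp add: \<kappa>_def mult.assoc inverse_hyper_left)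
  next
    case False
    have "\<kappa> * \<gamma> C (?x k) = inverse (\<gamma> C (?x k0)) * (\<gamma> C (?x k) * deleted_value \<phi> xs k0)"
      by (simp add: \<kappa>_def mult_ac)
    also have "\<dots> = (inverse (\<gamma> C (?x k0)) * \<gamma> C (?x k0)) * deleted_value \<phi> xs k"
      using step[OF k False] by (simp add: mult_ac)
    finally show ?thesis using nz[OF k0(2)] by (simp add: inverse_hyper_left)
  qed
  moreover have "\<kappa> \<noteq> 0" using value0 nz[OF k0(2)] by (simp add: \<kappa>_def)
  ultimately show ?thesis by blast
qed

lemma compatible_insert_value:
  assumes comp: "compatible \<gamma> \<delta> \<phi>" and bf: "basis_function \<phi>" and \<delta>: "\<delta> \<in> signatures (cocircuits M)"
    and D: "D \<in> cocircuits M" and b: "\<And>x. x \<in> D \<Longrightarrow> basis_list (x # zs)" and zs: "set zs \<inter> D = {}"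
  shows "\<exists>\<kappa>. \<kappa> \<noteq> 0 \<and> (\<forall>x\<in>D. \<phi> (x # zs) = \<kappa> * \<tau> (\<delta> D x))"
proof -
  obtain c where c: "c \<in> D" using cocircuit_nonempty[OF D] by blast
  have nz: "\<tau> (\<delta> D c) \<noteq> 0" using signature_nonzero[OF \<delta> D c] by simp
  define \<kappa> where "\<kappa> = \<phi> (c # zs) * inverse (\<tau> (\<delta> D c))"
  have "\<phi> (x # zs) = \<kappa> * \<tau> (\<delta> D x)" if x: "x \<in> D" for x
  proof -
    have "\<phi> (x # zs) = \<phi> (x # zs) * \<tau> (\<delta> D c) * inverse (\<tau> (\<delta> D c))"
      using hyper_inverse_right[OF nz] by (simp add: mult.assoc)
    also have "\<dots> = \<phi> (c # zs) * \<tau> (\<delta> D x) * inverse (\<tau> (\<delta> D c))"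
      using compatible_cocircuit[OF comp D x c zs b[OF x]] by simp
    finally show ?thesis by (simp add: \<kappa>_def mult_ac)
  qed
  moreover have "\<kappa> \<noteq> 0" using nz basis_function_nonzero[OF bf b[OF c]] by (simp add: \<kappa>_def)
  ultimately show ?thesis by blast
qed

lemma gp_relation_iff_orthogonal:
  assumes comp: "compatible \<gamma> \<delta> \<phi>" and bf: "basis_function \<phi>"
    and \<gamma>: "\<gamma> \<in> signatures (circuits M)" and \<delta>: "\<delta> \<in> signatures (cocircuits M)"
    and C: "C \<in> circuits M" and D: "D \<in> cocircuits M"
    and xs: "distinct xs" "set xs \<subseteq> ground M" "length xs = Suc rk"
    and C_eq: "C = {z \<in> set xs. set xs - {z} \<in> bases M}"
    and ys: "distinct ys" "set ys \<in> indep_sets M" "Suc (length ys) = rk" "set ys \<inter> D = {}"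
  shows "gp_relation \<phi> xs ys \<longleftrightarrow> orthogonal_on \<tau> \<gamma> \<delta> C D"
proof -
  let ?x = "\<lambda>k. xs ! (k - 1)"
  have D_eq: "D = {x\<in>ground M. insert x (set ys) \<in> bases M}"
    using cocircuit_eq_fundamental[OF D ys(2) _ ys(4)] ys(1,3) by (simp add: distinct_card)
  have b: "basis_list (x # ys)" if "x \<in> D" for x
    using that D_eq ys by (auto simp: basis_list_def)
  obtain \<kappa>1 where \<kappa>1: "\<kappa>1 \<noteq> 0"
    "\<And>k. k \<in> {1..length xs} \<Longrightarrow> ?x k \<in> C \<Longrightarrow> deleted_value \<phi> xs k = \<kappa>1 * \<gamma> C (?x k)"
    using compatible_deleted_value[OF comp bf \<gamma> C xs C_eq] by blast
  obtain \<kappa>2 where \<kappa>2: "\<kappa>2 \<noteq> 0" "\<And>x. x \<in> D \<Longrightarrow> \<phi> (x # ys) = \<kappa>2 * \<tau> (\<delta> D x)"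
    using compatible_insert_value[OF comp bf \<delta> D b ys(4)] by blast
  define K where "K = {k\<in>{1..length xs}. ?x k \<in> C \<inter> D}"
  have mem: "?x k \<in> set xs" if "k \<in> {1..length xs}" for k
    using that by (intro nth_mem) auto
  have inj: "inj_on ?x {1..length xs}"
    using xs(1) by (auto intro!: inj_onI simp: nth_eq_iff_index_eq)
  have image: "?x ` K = C \<inter> D"
  proof
    show "C \<inter> D \<subseteq> ?x ` K"
    proof
      fix z assume z: "z \<in> C \<inter> D"
      then have "z \<in> set xs" using C_eq by blast
      then obtain i where "i < length xs" "xs ! i = z" by (meson in_set_conv_nth)
      with z show "z \<in> ?x ` K" by (intro image_eqI[of _ _ "Suc i"]) (auto simp: K_def)
    qed
  qed (auto simp: K_def)
  \<comment> \<open>The first factor vanishes if the entry is outside \<open>C\<close>, the second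
    if it is outside \<open>D\<close>. Hence exactly the indices of entries in
    \<open>C \<inter> D\<close> remain.\<close>
  have zero: "(-1) ^ k * \<phi> (take (k - 1) xs @ drop k xs) * \<phi> (?x k # ys) = 0"
    if k: "k \<in> {1..length xs} - K" for k
  proof -
    note k' = DiffD1[OF k]
    note del = delete_nth[OF k' xs(1)]
    show ?thesis
    proof (cases "?x k \<in> C")
      case False
      have "set (take (k - 1) xs @ drop k xs) = set xs - {?x k}" using del(1,2) by blast
      moreover have "set xs - {?x k} \<notin> bases M" using False C_eq mem[OF k'] by blast
      ultimately have "\<not> basis_list (take (k - 1) xs @ drop k xs)"
        by (simp add: basis_list_def)
      moreover have "take (k - 1) xs @ drop k xs \<in> rank_tuples"
        using del(1,4) xs(2,3) unfolding in_nlists_iff by simp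
      ultimately show ?thesis using basis_function_eq_0[OF bf] by simp
    next
      case True
      then have "?x k \<notin> D" using k by (auto simp: K_def)
      moreover have "?x k \<in> ground M" using mem[OF k'] xs(2) by blast
      ultimately have "\<not> basis_list (?x k # ys)" using D_eq by (simp add: basis_list_def)
      moreover have "?x k # ys \<in> rank_tuples"
        using \<open>?x k \<in> ground M\<close> ys indep_subset_ground[OF ys(2)] by (auto simp: in_nlists_iff)
      ultimately show ?thesis using basis_function_eq_0[OF bf] by simp
    qed
  qed
  have "gp_relation \<phi> xs ys \<longleftrightarrow>
      0 \<in> hypersum (\<lambda>k. (-1) ^ k * \<phi> (take (k - 1) xs @ drop k xs) * \<phi> (?x k # ys)) K"
    unfolding gp_relation_def
    by (subst hypersum_neutral_cong[of "{1..length xs}" K]) (use zero in \<open>auto simp: K_def\<close>)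
  also have "hypersum (\<lambda>k. (-1) ^ k * \<phi> (take (k - 1) xs @ drop k xs) * \<phi> (?x k # ys)) K =
      hypersum (\<lambda>k. (\<kappa>1 * \<kappa>2) * (\<gamma> C (?x k) * \<tau> (\<delta> D (?x k)))) K"
  proof (rule hypersum_cong)
    fix k assume "k \<in> K"
    then have "deleted_value \<phi> xs k = \<kappa>1 * \<gamma> C (?x k)" "\<phi> (?x k # ys) = \<kappa>2 * \<tau> (\<delta> D (?x k))"
      using \<kappa>1(2) \<kappa>2(2) by (auto simp: K_def)
    then show "(-1) ^ k * \<phi> (take (k - 1) xs @ drop k xs) * \<phi> (?x k # ys) =
        (\<kappa>1 * \<kappa>2) * (\<gamma> C (?x k) * \<tau> (\<delta> D (?x k)))"
      by (simp add: deleted_value_def mult_ac)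
  qed
  also have "0 \<in> \<dots> \<longleftrightarrow> 0 \<in> hypersum (\<lambda>k. \<gamma> C (?x k) * \<tau> (\<delta> D (?x k))) K"
    using \<kappa>1(1) \<kappa>2(1) by (intro zero_in_hypersum_mult_iff) (auto simp: K_def)
  also have "hypersum (\<lambda>k. \<gamma> C (?x k) * \<tau> (\<delta> D (?x k))) K = hypersum (\<lambda>x. \<gamma> C x * \<tau> (\<delta> D x)) (C \<inter> D)"
    unfolding image[symmetric] using inj
    by (intro hypersum_reindex[symmetric] inj_on_subset[OF inj]) (auto simp: K_def)
  finally show ?thesis by (simp add: orthogonal_on_def)
qed

lemma within_strength_mono: "within_strength s n \<Longrightarrow> m \<le> n \<Longrightarrow> within_strength s m"
  by (auto simp: within_strength_def)

lemma Nt_if_Np: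
  assumes comp: "compatible \<gamma> \<delta> \<phi>" and \<phi>: "\<phi> \<in> Np s rk M"
    and \<gamma>: "\<gamma> \<in> signatures (circuits M)" and \<delta>: "\<delta> \<in> signatures (cocircuits M)"
  shows "(\<gamma>, \<delta>) \<in> Nt s \<tau> M"
  unfolding Nt_iff
proof (intro conjI \<gamma> \<delta> ballI impI)
  fix C D assume C: "C \<in> circuits M" and D: "D \<in> cocircuits M" and s: "within_strength s (card (C \<inter> D))"
  show "orthogonal_on \<tau> \<gamma> \<delta> C D"
  \<comment> \<open>Representatives \<open>I\<close> and \<open>J\<close> are available only for
    meeting sets; in the disjoint case the hypersum is \<open>{0}\<close>.\<close>
  proof (cases "C \<inter> D = {}")
    case True
    then show ?thesis by (simp add: orthogonal_on_def)
  next
    case False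
    then obtain I J where I: "C \<subseteq> I" "I \<subseteq> ground M" "card I = Suc rk"
        "C = {z\<in>I. I - {z} \<in> bases M}"
      and J: "J \<in> indep_sets M" "Suc (card J) = rk" "J \<inter> D = {}" "I - J \<subseteq> C \<inter> D"
      using circuit_cocircuit_representatives[OF C D] by blast
    obtain xs where xs: "set xs = I" "distinct xs"
      using I(2) finite_distinct_list finite_ground finite_subset by metis
    obtain ys where ys: "set ys = J" "distinct ys"
      using finite_distinct_list finite_indep[OF J(1)] by metis
    have "card (I - J) \<le> card (C \<inter> D)"
      using J(4) circuitD(4)[OF C] by (intro card_mono) auto
    then have "within_strength s (card (set xs - set ys))"
      using s within_strength_mono xs ys by blast
    moreover have len: "length xs = Suc rk" "Suc (length ys) = rk"
      using distinct_card[OF xs(2)] distinct_card[OF ys(2)] xs ys I J by simp_all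
    ultimately have "gp_relation \<phi> xs ys"
      using \<phi> xs ys I(2) indep_subset_ground[OF J(1)] unfolding Np_iff by simp
    moreover have "gp_relation \<phi> xs ys \<longleftrightarrow> orthogonal_on \<tau> \<gamma> \<delta> C D"
      using \<phi> xs ys I J len unfolding Np_iff
      by (intro gp_relation_iff_orthogonal[OF comp _ \<gamma> \<delta> C D]) auto
    ultimately show ?thesis by blast
  qed
qed

lemma Np_if_Nt:
  assumes comp: "compatible \<gamma> \<delta> \<phi>" and N: "(\<gamma>, \<delta>) \<in> Nt s \<tau> M"
    and ext: "\<phi> \<in> extensional (rank_tuples)" and bf: "basis_function \<phi>"
  shows "\<phi> \<in> Np s rk M"
  unfolding Np_iff
proof (intro conjI ext bf allI impI, elim conjE)
  fix xs ys
  assume xs: "set xs \<subseteq> ground M" "distinct xs" "length xs = rk + 1"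
    and ys: "set ys \<subseteq> ground M" "distinct ys" "length ys + 1 = rk"
    and s: "within_strength s (card (set xs - set ys))"
  show "gp_relation \<phi> xs ys"
  \<comment> \<open>One nonzero term makes both of its arguments bases, so \<open>xs\<close>
    contains a basis and \<open>ys\<close> extends to one. This gives the circuit in
    \<open>xs\<close> and the cocircuit avoiding \<open>ys\<close>. If all terms vanish there is
    nothing to show.\<close>
  proof (cases "\<exists>k\<in>{1..length xs}. \<phi> (take (k - 1) xs @ drop k xs) \<noteq> 0 \<and> \<phi> (xs ! (k - 1) # ys) \<noteq> 0")
    case False
    then have "hypersum (\<lambda>k. (- 1) ^ k * \<phi> (take (k - 1) xs @ drop k xs) * \<phi> (xs ! (k - 1) # ys))
        {1..length xs} =
      hypersum (\<lambda>k. (- 1) ^ k * \<phi> (take (k - 1) xs @ drop k xs) * \<phi> (xs ! (k - 1) # ys)) {}"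
      by (intro hypersum_neutral_cong) auto
    then show ?thesis by (simp add: gp_relation_def)
  next
    case True
    then obtain k where k: "k \<in> {1..length xs}" "\<phi> (take (k - 1) xs @ drop k xs) \<noteq> 0" "\<phi> (xs ! (k - 1) # ys) \<noteq> 0"
      by blast
    let ?x = "xs ! (k - 1)" and ?zs = "take (k - 1) xs @ drop k xs"
    note del = delete_nth[OF k(1) xs(2)]
    have x: "?x \<in> set xs" using del(1) by blast
    have zs: "?zs \<in> rank_tuples"
      using xs(1,3) del(1,4) unfolding in_nlists_iff by simp
    have zs_b: "basis_list ?zs" using k(2) basis_function_eq_0[OF bf zs] by blast
    have "?x # ys \<in> rank_tuples" using x xs ys by (auto simp: in_nlists_iff)
    with k(3) basis_function_eq_0[OF bf this] have ys_b: "basis_list (?x # ys)" by blast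
    define C where "C = {z \<in> set xs. set xs - {z} \<in> bases M}"
    define D where "D = {x\<in>ground M. insert x (set ys) \<in> bases M}"
    have C: "C \<in> circuits M"
      unfolding C_def
    proof (rule fundamental_circuit)
      show "set ?zs \<in> bases M" using zs_b by (simp only: basis_list_def)
      show "set ?zs \<subseteq> set xs" using del(1) by blast
      show "card (set xs) = Suc rk" using xs by (simp add: distinct_card)
    qed (rule xs(1))
    have D: "D \<in> cocircuits M"
      unfolding D_def using ys_b by (intro fundamental_cocircuit[of ?x]) (auto simp: basis_list_def)
    have J: "set ys \<in> indep_sets M" using basis_list_tail(1)[OF ys_b] .
    have JD: "set ys \<inter> D = {}"
      using insert_basis_notin[of "set ys"] ys by (auto simp: D_def distinct_card)
    \<comment> \<open>\<open>C\<close> lies in \<open>xs\<close> and \<open>D\<close> misses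
      \<open>ys\<close>; so the bound that imposes the Grassmann-Pluecker relation also imposes
      orthogonality.\<close>
    have "card (C \<inter> D) \<le> card (set xs - set ys)"
      using JD by (intro card_mono) (auto simp: C_def)
    then have "orthogonal_on \<tau> \<gamma> \<delta> C D"
      using N C D s within_strength_mono unfolding Nt_iff by blast
    moreover have "gp_relation \<phi> xs ys \<longleftrightarrow> orthogonal_on \<tau> \<gamma> \<delta> C D"
      using N xs ys J JD unfolding Nt_iff
      by (intro gp_relation_iff_orthogonal[OF comp bf _ _ C D]) (auto simp: C_def)
    ultimately show ?thesis by blast
  qed
qed

section \<open>Signatures of a function, and uniqueness up to scaling\<close>

lemma Np_basis_function: "\<phi> \<in> Np s rk M \<Longrightarrow> basis_function \<phi>"
  by (simp add: Np_iff)

lemma Np_Weak: "\<phi> \<in> Np s rk M \<Longrightarrow> \<phi> \<in> Np Weak rk M"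
  by (simp add: Np_iff within_strength_def)

text \<open>The relation for \<open>x # y # u # ws\<close> and \<open>v # ws\<close>. Its terms from
  the fourth on repeat an entry of \<open>ws\<close>, and \<open>zero\<close> kills the third one.
  What remains is a two-term relation, hence an equation even in a hyperfield.\<close>

lemma three_term:
  assumes \<phi>: "\<phi> \<in> Np Weak rk M"
    and xu: "basis_list (x # u # ws)" and yu: "basis_list (y # u # ws)" and xv: "basis_list (x # v # ws)"
    and "x \<noteq> y" and zero: "\<not> basis_list (x # y # ws) \<or> \<not> basis_list (u # v # ws)"
  shows "\<phi> (y # u # ws) * \<phi> (x # v # ws) = \<phi> (x # u # ws) * \<phi> (y # v # ws)"
proof -
  let ?xs = "x # y # u # ws" and ?ys = "v # ws"
  have bf: "basis_function \<phi>" using \<phi> by (rule Np_basis_function)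
  have E: "set ?xs \<subseteq> ground M" "v \<in> ground M"
    using xu yu xv basis_subset by (auto simp: basis_list_def)
  have len: "length ws + 2 = rk" using basis_list_Cons_rank[OF xu] by simp
  have dist: "distinct ?xs" "distinct ?ys" using xu yu xv \<open>x \<noteq> y\<close> by (auto simp: basis_list_def)
  have "card (set ?xs - set ?ys) \<le> card {x, y, u}" by (intro card_mono) auto
  also have "\<dots> \<le> 3" by (simp add: card_insert_if)
  finally have "gp_relation \<phi> ?xs ?ys"
    using \<phi> E len dist unfolding Np_iff within_strength_def by simp
  moreover have "hypersum (\<lambda>k. (- 1) ^ k * \<phi> (take (k - 1) ?xs @ drop k ?xs) * \<phi> (?xs ! (k - 1) # ?ys))
      {1..length ?xs} =
    hypersum (\<lambda>k. (- 1) ^ k * \<phi> (take (k - 1) ?xs @ drop k ?xs) * \<phi> (?xs ! (k - 1) # ?ys)) {1, 2}"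
  proof (rule hypersum_neutral_cong)
    fix k assume k: "k \<in> {1..length ?xs} - {1, 2}"
    show "(- 1) ^ k * \<phi> (take (k - 1) ?xs @ drop k ?xs) * \<phi> (?xs ! (k - 1) # ?ys) = 0"
    proof (cases "k = 3")
      case True
      have N: "x # y # ws \<in> rank_tuples" "u # v # ws \<in> rank_tuples"
        using E len by (auto simp: in_nlists_iff)
      then have "\<phi> (x # y # ws) = 0 \<or> \<phi> (u # v # ws) = 0"
        using zero basis_function_eq_0[OF bf N(1)] basis_function_eq_0[OF bf N(2)] by blast
      then show ?thesis unfolding True by (auto simp: numeral_3_eq_3)
    next
      case False
      then have k4: "3 \<le> k - 1" "k - 1 < length ?xs" using k by auto
      then obtain i where i: "k - 1 = Suc (Suc (Suc i))" "i < length ws"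
        by (metis (no_types, lifting) Suc_le_D Suc_le_mono Suc_less_eq length_Cons numeral_3_eq_3)
      then have "?xs ! (k - 1) = ws ! i" "ws ! i \<in> set ws" by simp_all
      moreover have "\<not> basis_list (ws ! i # v # ws)" using i by (simp add: basis_list_def)
      moreover have "ws ! i # v # ws \<in> rank_tuples"
        using E len i by (auto simp: in_nlists_iff)
      ultimately show ?thesis using basis_function_eq_0[OF bf] by simp
    qed
  qed auto
  ultimately have "0 \<in> hypersum (\<lambda>k. (- 1) ^ k * \<phi> (take (k - 1) ?xs @ drop k ?xs) * \<phi> (?xs ! (k - 1) # ?ys)) {1, 2}"
    by (simp only: gp_relation_def)
  then show ?thesis by (simp add: zero_in_hypersum_pair numeral_2_eq_2)
qed

lemma ratio_perm:
  assumes \<phi>: "basis_function \<phi>" and "mset zs = mset zs'" and "basis_list (x # zs)" "basis_list (y # zs)"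
  shows "\<phi> (x # zs) * \<phi> (y # zs') = \<phi> (y # zs) * \<phi> (x # zs')"
proof -
  obtain s where s: "\<And>A. A @ zs \<in> rank_tuples \<Longrightarrow> \<phi> (A @ zs') = s * \<phi> (A @ zs)"
    using alternating_perm[OF _ assms(2)] \<phi> unfolding basis_function_def by blast
  have "\<phi> (x # zs') = s * \<phi> (x # zs)" "\<phi> (y # zs') = s * \<phi> (y # zs)"
    using s[of "[x]"] s[of "[y]"] assms(3,4) basis_list_nlists by auto
  then show ?thesis by (simp add: mult_ac)
qed

text \<open>Both ratios that define signatures are shown to be well defined by moving along exchanges.\<close>

lemma ratio_independent:
  assumes \<phi>: "\<phi> \<in> Np Weak rk M" and "x \<noteq> y"
    and basis: "\<And>zs. Q zs \<Longrightarrow> basis_list (x # zs)" "\<And>zs. Q zs \<Longrightarrow> basis_list (y # zs)"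
    and step: "\<And>zs zs'. Q zs \<Longrightarrow> Q zs' \<Longrightarrow> set zs \<noteq> set zs' \<Longrightarrow>
      \<exists>u v ws. u \<in> set zs - set zs' \<and> v \<in> set zs' - set zs \<and> mset zs = mset (u # ws) \<and> Q (v # ws) \<and>
        (\<not> basis_list (x # y # ws) \<or> \<not> basis_list (u # v # ws))"
    and "Q zs" "Q zs'"
  shows "\<phi> (x # zs) * \<phi> (y # zs') = \<phi> (y # zs) * \<phi> (x # zs')"
  using \<open>Q zs\<close>
proof (induction "card (set zs - set zs')" arbitrary: zs rule: less_induct)
  case less
  have bf: "basis_function \<phi>" using \<phi> by (rule Np_basis_function)
  note b = basis[OF less.prems]
  note b' = basis[OF \<open>Q zs'\<close>]
  show ?case
  proof (cases "set zs = set zs'")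
    case True
    moreover have "distinct zs" "distinct zs'" using b b' by (auto simp: basis_list_def)
    ultimately have "mset zs = mset zs'" by (intro mset_eq_distinct)
    then show ?thesis using ratio_perm[OF bf _ b] by blast
  next
    case False
    then obtain u v ws where u: "u \<in> set zs - set zs'" and v: "v \<in> set zs' - set zs"
      and ws: "mset zs = mset (u # ws)" and Q: "Q (v # ws)"
      and zero: "\<not> basis_list (x # y # ws) \<or> \<not> basis_list (u # v # ws)"
      using step[OF less.prems \<open>Q zs'\<close>] by blast
    have set: "set zs = insert u (set ws)" using mset_eq_setD[OF ws] by simp
    have "set (v # ws) - set zs' \<subseteq> set zs - set zs'" using u v set by auto
    moreover have "u \<notin> set ws" using b(1) ws mset_eq_imp_distinct_iff[OF ws] by (auto simp: basis_list_def)
    then have "u \<notin> set (v # ws)" using u v by auto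
    ultimately have "set (v # ws) - set zs' \<subset> set zs - set zs'" using u by blast
    then have "card (set (v # ws) - set zs') < card (set zs - set zs')"
      by (intro psubset_card_mono) auto
    then have IH: "\<phi> (x # v # ws) * \<phi> (y # zs') = \<phi> (y # v # ws) * \<phi> (x # zs')"
      using less.hyps Q by blast
    have "basis_list (x # u # ws) \<longleftrightarrow> basis_list (x # zs)" "basis_list (y # u # ws) \<longleftrightarrow> basis_list (y # zs)"
      using ws by (intro basis_list_perm; simp)+
    then have bu: "basis_list (x # u # ws)" "basis_list (y # u # ws)" using b by blast+
    \<comment> \<open>The ratio is carried from \<open>zs\<close> to \<open>u # ws\<close> by
      reordering, to \<open>v # ws\<close> by the three-term relation, and to \<open>zs'\<close> by
      induction.\<close>
    have perm: "\<phi> (x # zs) * \<phi> (y # u # ws) = \<phi> (y # zs) * \<phi> (x # u # ws)"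
      using ratio_perm[OF bf ws b] .
    have "\<phi> (y # u # ws) * \<phi> (x # v # ws) = \<phi> (x # u # ws) * \<phi> (y # v # ws)"
      using three_term[OF \<phi> bu basis(1)[OF Q] \<open>x \<noteq> y\<close> zero] .
    then have "\<phi> (x # u # ws) * \<phi> (y # v # ws) = \<phi> (y # u # ws) * \<phi> (x # v # ws)" by simp
    from hyper_ratio_trans[OF perm this] have "\<phi> (x # zs) * \<phi> (y # v # ws) = \<phi> (y # zs) * \<phi> (x # v # ws)"
      using basis_function_nonzero[OF bf] bu by simp
    from hyper_ratio_trans[OF this IH] show ?thesis
      using basis_function_nonzero[OF bf] basis[OF Q] by simp
  qed
qed

text \<open>\<open>Q\<close> describes the bases of the hyperplane complementary to
  \<open>D\<close>. Exchanging \<open>u\<close> for \<open>v\<close> stays in this hyperplane, so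
  \<open>u # v # ws\<close> misses \<open>D\<close> and is not a basis: the third term vanishes
  through its second factor.\<close>

lemma cocircuit_ratio:
  assumes \<phi>: "\<phi> \<in> Np Weak rk M" and D: "D \<in> cocircuits M" and xy: "x \<in> D" "y \<in> D"
    and zs: "basis_list (x # zs)" "set zs \<inter> D = {}" and zs': "basis_list (x # zs')" "set zs' \<inter> D = {}"
  shows "\<phi> (x # zs) * \<phi> (y # zs') = \<phi> (y # zs) * \<phi> (x # zs')"
proof (cases "x = y")
  case False
  define Q where "Q zs \<longleftrightarrow> basis_list (x # zs) \<and> set zs \<inter> D = {}" for zs
  show ?thesis
  proof (rule ratio_independent[OF \<phi> False, of Q])
    fix zs zs' assume Q: "Q zs" "Q zs'" and neq: "set zs \<noteq> set zs'"
    have indep: "set l \<in> indep_sets M" "Suc (card (set l)) = rk" "distinct l" if "Q l" for l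
      using that basis_list_tail[of x l] by (auto simp: Q_def basis_list_def)
    have "\<not> set zs \<subseteq> set zs'"
      using neq indep(2)[OF Q(1)] indep(2)[OF Q(2)] by (metis List.finite_set Suc_inject card_subset_eq)
    then obtain u where u: "u \<in> set zs - set zs'" by blast
    define ws where "ws = remove1 u zs"
    have ws: "mset zs = mset (u # ws)" "set ws = set zs - {u}" "distinct ws"
      using u indep(3)[OF Q(1)] by (auto simp: ws_def)
    have "set ws \<in> indep_sets M" using indep_subset[OF indep(1)[OF Q(1)]] ws(2) by blast
    moreover have "card (set zs) = Suc (card (set ws))"
      using u ws(2) by (metis DiffD1 List.finite_set card_Suc_Diff1)
    then have "card (set ws) < card (set zs')" using indep(2)[OF Q(1)] indep(2)[OF Q(2)] by linarith
    ultimately obtain v where v: "v \<in> set zs' - set ws" "insert v (set ws) \<in> indep_sets M"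
      using indep_augment indep(1)[OF Q(2)] by blast
    have v': "v \<in> set zs' - set zs" using v u ws by auto
    have vD: "set (v # ws) \<inter> D = {}" using v' ws Q by (auto simp: Q_def)
    have "Suc (card (insert v (set ws))) = rk"
      using v(1) \<open>card (set zs) = Suc (card (set ws))\<close> indep(2)[OF Q(1)] by simp
    then have "D = {x\<in>ground M. insert x (insert v (set ws)) \<in> bases M}"
      using cocircuit_eq_fundamental[OF D v(2)] vD by simp
    then have "insert x (insert v (set ws)) \<in> bases M" using xy by blast
    moreover have "distinct (x # v # ws)" using v ws xy vD by auto
    ultimately have "Q (v # ws)" using vD by (simp add: Q_def basis_list_def)
    moreover have "\<not> basis_list (u # v # ws)"
    proof
      assume "basis_list (u # v # ws)"
      then have "set (u # v # ws) \<in> bases M" unfolding basis_list_def ..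
      then have "set (u # v # ws) \<inter> D \<noteq> {}" by (rule cocircuit_inter_nonempty[OF D])
      moreover have "u \<notin> D" using u Q(1) by (auto simp: Q_def)
      ultimately show False using vD by auto
    qed
    ultimately show "\<exists>u v ws. u \<in> set zs - set zs' \<and> v \<in> set zs' - set zs \<and> mset zs = mset (u # ws) \<and> Q (v # ws) \<and>
        (\<not> basis_list (x # y # ws) \<or> \<not> basis_list (u # v # ws))"
      using u v' ws(1) by blast
  next
    fix zs assume "Q zs"
    then show "basis_list (x # zs)" "basis_list (y # zs)"
      using basis_list_exchange_cocircuit[OF D] xy by (auto simp: Q_def)
  qed (use zs zs' in \<open>auto simp: Q_def\<close>)
qed simp

text \<open>An exchanged element \<open>u\<close> is outside \<open>C\<close>, so \<open>C\<close>
  stays inside \<open>x\<close>, \<open>y\<close> and \<open>ws\<close>. Hence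
  \<open>x # y # ws\<close> is dependent, and the third term vanishes through its first
  factor.\<close>

lemma circuit_ratio:
  assumes \<phi>: "\<phi> \<in> Np Weak rk M" and C: "C \<in> circuits M" and xy: "x \<in> C" "y \<in> C" "x \<noteq> y"
    and zs: "basis_list (x # zs)" "C \<subseteq> insert x (insert y (set zs))"
    and zs': "basis_list (x # zs')" "C \<subseteq> insert x (insert y (set zs'))"
  shows "\<phi> (x # zs) * \<phi> (y # zs') = \<phi> (y # zs) * \<phi> (x # zs')"
proof -
  define Q where "Q zs \<longleftrightarrow> basis_list (x # zs) \<and> C \<subseteq> insert x (insert y (set zs))" for zs
  show ?thesis
  proof (rule ratio_independent[OF \<phi> xy(3), of Q])
    fix zs zs' assume Q: "Q zs" "Q zs'" and neq: "set zs \<noteq> set zs'"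
    have basis: "set (x # l) \<in> bases M" "x \<notin> set l" "distinct l" if "Q l" for l
      using that by (simp_all add: Q_def basis_list_def)
    have "\<not> set (x # zs) \<subseteq> set (x # zs')"
    proof
      assume "set (x # zs) \<subseteq> set (x # zs')"
      then have "set (x # zs) = set (x # zs')"
        using basis(1)[OF Q(1)] basis(1)[OF Q(2)] by (metis List.finite_set card_subset_eq basis_card)
      then have "set zs = set zs'"
        using basis(2)[OF Q(1)] basis(2)[OF Q(2)] by (simp add: insert_ident)
      then show False using neq by blast
    qed
    then obtain u where u: "u \<in> set (x # zs) - set (x # zs')" by blast
    then obtain v where v: "v \<in> set (x # zs') - set (x # zs)" "insert v (set (x # zs) - {u}) \<in> bases M"
      using basis_exchange[OF basis(1)[OF Q(1)] basis(1)[OF Q(2)]] by blast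
    have u': "u \<in> set zs - set zs'" and v': "v \<in> set zs' - set zs" and ux: "u \<noteq> x" "v \<noteq> x"
      using u v(1) by auto
    define ws where "ws = remove1 u zs"
    have ws: "mset zs = mset (u # ws)" "set ws = set zs - {u}" "distinct ws"
      using u' basis(3)[OF Q(1)] by (auto simp: ws_def)
    have y: "y \<notin> set zs'" using basis_list_circuit(2)[OF C, of x zs' y] Q(2) by (simp add: Q_def)
    have "u \<notin> C \<or> u = y" using u' ux Q(2) by (auto simp: Q_def)
    moreover have "u \<noteq> y" using u' basis_list_circuit(2)[OF C, of x zs y] Q(1) by (auto simp: Q_def)
    ultimately have uC: "C \<subseteq> insert x (insert y (set ws))" using Q(1) ws(2) by (auto simp: Q_def)
    have "insert v (set (x # zs) - {u}) = set (x # v # ws)" using ux ws(2) by auto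
    then have "basis_list (x # v # ws)"
      using v v' ux ws basis(2)[OF Q(1)] by (simp add: basis_list_def)
    then have "Q (v # ws)" using uC by (auto simp: Q_def)
    moreover have "\<not> basis_list (x # y # ws)"
    proof
      assume "basis_list (x # y # ws)"
      then have "C \<in> indep_sets M"
        using uC indep_subset[OF basis_indep, of "set (x # y # ws)" C] by (simp add: basis_list_def)
      then show False using circuitD(2)[OF C] by blast
    qed
    ultimately show "\<exists>u v ws. u \<in> set zs - set zs' \<and> v \<in> set zs' - set zs \<and> mset zs = mset (u # ws) \<and> Q (v # ws) \<and>
        (\<not> basis_list (x # y # ws) \<or> \<not> basis_list (u # v # ws))"
      using u' v' ws(1) by blast
  next
    fix zs assume "Q zs"
    then show "basis_list (x # zs)" "basis_list (y # zs)"
      using basis_list_exchange_circuit[OF C] xy by (auto simp: Q_def)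
  qed (use zs zs' in \<open>auto simp: Q_def\<close>)
qed

text \<open>The choice depends on \<open>C\<close> alone and not on \<open>\<phi>\<close>, so an
  entry of \<open>circuit_signature\<close> is a fixed coordinate of \<open>\<phi>\<close> up to
  sign. \<open>cocircuit_list\<close> plays the same part.\<close>

definition circuit_list :: "'e set \<Rightarrow> 'e list"
  where "circuit_list C = (SOME xs. distinct xs \<and> set xs \<subseteq> ground M \<and>
    length xs = Suc rk \<and> C = {z \<in> set xs. set xs - {z} \<in> bases M})"

definition cocircuit_list :: "'e set \<Rightarrow> 'e list"
  where "cocircuit_list D = (SOME ys. set ys \<inter> D = {} \<and> (\<forall>x\<in>D. basis_list (x # ys)))"

definition entry_index :: "'e list \<Rightarrow> 'e \<Rightarrow> nat"
  where "entry_index xs x = (SOME k. k \<in> {1..length xs} \<and> xs ! (k - 1) = x)"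

definition circuit_signature :: "('e list \<Rightarrow> 'h) \<Rightarrow> ('e, 'h) signature"
  where "circuit_signature \<phi> = (\<lambda>C\<in>circuits M. \<lambda>x\<in>C.
    deleted_value \<phi> (circuit_list C) (entry_index (circuit_list C) x))"

text \<open>The outer \<open>\<tau>\<close> cancels the one that \<open>compatible\<close> applies
  to cocircuit entries.\<close>

definition cocircuit_signature :: "('e list \<Rightarrow> 'h) \<Rightarrow> ('e, 'h) signature"
  where "cocircuit_signature \<phi> = (\<lambda>D\<in>cocircuits M. \<lambda>x\<in>D. \<tau> (\<phi> (x # cocircuit_list D)))"

lemma circuit_list:
  assumes "C \<in> circuits M"
  shows "distinct (circuit_list C) \<and> set (circuit_list C) \<subseteq> ground M \<and>
    length (circuit_list C) = Suc rk \<and>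
    C = {z \<in> set (circuit_list C). set (circuit_list C) - {z} \<in> bases M}"
  unfolding circuit_list_def
proof (rule someI_ex)
  obtain B where B: "B \<in> bases M" using bases_nonempty by blast
  then obtain I where I: "I \<subseteq> C \<union> B" "card I = Suc rk" "C = {z\<in>I. I - {z} \<in> bases M}"
    using circuit_in_spanning[OF assms] by blast
  have IE: "I \<subseteq> ground M" using I(1) circuitD(1)[OF assms] basis_subset[OF B] by blast
  then obtain xs where xs: "set xs = I" "distinct xs"
    using finite_distinct_list finite_ground finite_subset by metis
  then have "length xs = Suc rk" using I(2) distinct_card by metis
  then show "\<exists>xs. distinct xs \<and> set xs \<subseteq> ground M \<and>
      length xs = Suc rk \<and> C = {z \<in> set xs. set xs - {z} \<in> bases M}"
    using xs IE I(3) by (intro exI[of _ xs]) simp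
qed

lemma cocircuit_list:
  assumes "D \<in> cocircuits M"
  shows "set (cocircuit_list D) \<inter> D = {} \<and> (\<forall>x\<in>D. basis_list (x # cocircuit_list D))"
  unfolding cocircuit_list_def
proof (rule someI_ex)
  obtain x where "x \<in> D" using cocircuit_nonempty assms by blast
  then obtain zs where "basis_list (x # zs)" "set zs \<inter> D = {}"
    using cocircuit_basis_list assms by blast
  then show "\<exists>ys. set ys \<inter> D = {} \<and> (\<forall>x\<in>D. basis_list (x # ys))"
    using basis_list_exchange_cocircuit assms by blast
qed

lemma entry_index:
  assumes "x \<in> set xs"
  shows "entry_index xs x \<in> {1..length xs} \<and> xs ! (entry_index xs x - 1) = x"
  unfolding entry_index_def
proof (rule someI_ex)
  obtain i where "i < length xs" "xs ! i = x" using assms by (meson in_set_conv_nth)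
  then show "\<exists>k. k \<in> {1..length xs} \<and> xs ! (k - 1) = x" by (intro exI[of _ "Suc i"]) auto
qed

lemma circuit_list_deleted:
  assumes C: "C \<in> circuits M" and x: "x \<in> C"
  defines "k \<equiv> entry_index (circuit_list C) x"
  shows "basis_list (take (k - 1) (circuit_list C) @ drop k (circuit_list C))"
proof -
  note cl = circuit_list[OF C]
  have "x \<in> set (circuit_list C)" using x cl by blast
  from entry_index[OF this] have k: "k \<in> {1..length (circuit_list C)}" "circuit_list C ! (k - 1) = x"
    by (simp_all add: k_def)
  note del = delete_nth[OF k(1) conjunct1[OF cl]]
  have "set (take (k - 1) (circuit_list C) @ drop k (circuit_list C)) = set (circuit_list C) - {x}"
    using del(1,2) unfolding k(2) by blast
  moreover have "set (circuit_list C) - {x} \<in> bases M" using cl x by blast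
  ultimately show ?thesis using del(3) by (simp only: basis_list_def)
qed

lemma circuit_signature_in:
  assumes "basis_function \<phi>"
  shows "circuit_signature \<phi> \<in> signatures (circuits M)"
  unfolding signatures_def circuit_signature_def
  using basis_function_nonzero[OF assms circuit_list_deleted]
  by (intro restrict_PiE_iff[THEN iffD2] ballI) (simp add: deleted_value_def)

lemma cocircuit_signature_in:
  assumes "basis_function \<phi>"
  shows "cocircuit_signature \<phi> \<in> signatures (cocircuits M)"
  unfolding signatures_def cocircuit_signature_def
  using basis_function_nonzero[OF assms] cocircuit_list
  by (intro restrict_PiE_iff[THEN iffD2] ballI) simp

text \<open>Each clause holds for the chosen lists by construction; \<open>cocircuit_ratio\<close>
  and \<open>circuit_ratio\<close> carry it over to an arbitrary \<open>zs\<close>.\<close>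

lemma compatible_signatures:
  assumes \<phi>: "\<phi> \<in> Np s rk M"
  shows "compatible (circuit_signature \<phi>) (cocircuit_signature \<phi>) \<phi>"
  unfolding compatible_def
proof (intro conjI ballI allI impI)
  fix D zs x y
  assume "D \<in> cocircuits M" "x \<in> D" "y \<in> D" "set zs \<inter> D = {}" "basis_list (x # zs)"
  then show "\<phi> (x # zs) * \<tau> (cocircuit_signature \<phi> D y) = \<phi> (y # zs) * \<tau> (cocircuit_signature \<phi> D x)"
    using cocircuit_ratio[OF Np_Weak[OF \<phi>], of D x y zs "cocircuit_list D"] cocircuit_list[of D]
    by (simp add: cocircuit_signature_def)
next
  fix C zs x y
  assume C: "C \<in> circuits M" and xy: "x \<in> C" "y \<in> C" "x \<noteq> y"
    and zs: "C \<subseteq> insert x (insert y (set zs))" "basis_list (x # zs)"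
  let ?xs = "circuit_list C"
  note cl = circuit_list[OF C]
  have bf: "basis_function \<phi>" using \<phi> by (rule Np_basis_function)
  then have alt: "alternating rk (ground M) \<phi>" by (simp add: basis_function_def)
  have "x \<in> set ?xs" "y \<in> set ?xs" using xy cl by blast+
  note ix = entry_index[OF this(1)] and iy = entry_index[OF this(2)]
  have "entry_index ?xs x \<noteq> entry_index ?xs y" using ix iy xy(3) by metis
  with cl ix iy obtain r W where rW: "r \<noteq> 0" "mset ?xs = mset (x # y # W)"
    "deleted_value \<phi> ?xs (entry_index ?xs x) = r * \<phi> (y # W)"
    "deleted_value \<phi> ?xs (entry_index ?xs y) = - (r * \<phi> (x # W))"
    using deleted_value_pair[OF alt, of ?xs "entry_index ?xs x" "entry_index ?xs y"] by metis
  have W: "distinct (x # y # W)" "set ?xs = set (x # y # W)"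
    using rW(2) cl mset_eq_imp_distinct_iff mset_eq_setD by blast+
  have "set ?xs - {y} = set (x # W)" using W by auto
  moreover have "set ?xs - {y} \<in> bases M" using cl xy(2) by blast
  ultimately have b: "basis_list (x # W)" using W(1) by (simp add: basis_list_def)
  have "C \<subseteq> insert x (insert y (set W))" using cl W(2) by auto
  then have "\<phi> (x # zs) * \<phi> (y # W) = \<phi> (y # zs) * \<phi> (x # W)"
    using circuit_ratio[OF Np_Weak[OF \<phi>] C xy zs(2,1) b] by blast
  moreover have "circuit_signature \<phi> C x = r * \<phi> (y # W)" "circuit_signature \<phi> C y = - (r * \<phi> (x # W))"
    using C xy rW(3,4) by (simp_all add: circuit_signature_def)
  ultimately show "circuit_signature \<phi> C x * \<phi> (x # zs) = - (circuit_signature \<phi> C y * \<phi> (y # zs))"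
    by (simp add: mult_ac)
qed

text \<open>The cocircuit entries prescribe the ratio of \<open>\<phi>\<close> along every exchange,
  through the fundamental cocircuit of the common tail. By connectivity, one value determines
  all.\<close>

lemma compatible_unique_function:
  assumes comp: "compatible \<gamma> \<delta> \<phi>" "compatible \<gamma> \<delta> \<phi>'" and bf: "basis_function \<phi>" "basis_function \<phi>'"
    and \<delta>: "\<delta> \<in> signatures (cocircuits M)"
  shows "\<exists>a. a \<noteq> 0 \<and> (\<forall>xs\<in>rank_tuples. \<phi> xs = a * \<phi>' xs)"
proof -
  obtain xs0 where xs0: "basis_list xs0" using bases_nonempty ex_basis_list by blast
  define a where "a = \<phi> xs0 * inverse (\<phi>' xs0)"
  have nz: "\<phi> xs0 \<noteq> 0" "\<phi>' xs0 \<noteq> 0" using basis_function_nonzero bf xs0 by auto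
  have "\<phi> xs = a * \<phi>' xs" if "basis_list xs" for xs
    using xs0 that
  proof (rule basis_list_induct)
    show "\<phi> xs0 = a * \<phi>' xs0" using nz by (simp add: a_def mult.assoc inverse_hyper_left)
  next
    fix A x y B assume b: "basis_list (A @ x # y # B)" and eq: "\<phi> (A @ x # y # B) = a * \<phi>' (A @ x # y # B)"
    show "\<phi> (A @ y # x # B) = a * \<phi>' (A @ y # x # B)"
      using basis_function_swap[OF bf(1) b] basis_function_swap[OF bf(2) b] eq by simp
  next
    fix x y zs
    assume b: "basis_list (x # zs)" "basis_list (y # zs)" and eq: "\<phi> (x # zs) = a * \<phi>' (x # zs)"
    define D where "D = {x\<in>ground M. insert x (set zs) \<in> bases M}"
    have D: "D \<in> cocircuits M"
      unfolding D_def using b(1) by (intro fundamental_cocircuit[of x]) (auto simp: basis_list_def)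
    have xy: "x \<in> D" "y \<in> D" using b basis_subset by (auto simp: D_def basis_list_def)
    have zs: "set zs \<inter> D = {}" using insert_basis_notin[OF basis_list_tail(2)[OF b(1)]] by (auto simp: D_def)
    have c: "\<phi> (x # zs) * \<tau> (\<delta> D y) = \<phi> (y # zs) * \<tau> (\<delta> D x)"
      "\<phi>' (x # zs) * \<tau> (\<delta> D y) = \<phi>' (y # zs) * \<tau> (\<delta> D x)"
      using compatible_cocircuit[OF comp(1) D xy zs b(1)] compatible_cocircuit[OF comp(2) D xy zs b(1)] .
    have "\<tau> (\<delta> D x) * \<phi> (y # zs) = a * (\<phi>' (x # zs) * \<tau> (\<delta> D y))"
      using c(1) eq by (simp add: mult_ac)
    also have "\<dots> = \<tau> (\<delta> D x) * (a * \<phi>' (y # zs))" unfolding c(2) by (simp add: mult_ac)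
    finally show "\<phi> (y # zs) = a * \<phi>' (y # zs)"
      using signature_nonzero[OF \<delta> D xy(1)] by (simp add: hyper_mult_left_cancel)
  qed
  moreover have "\<phi> xs = a * \<phi>' xs" if "xs \<in> rank_tuples" "\<not> basis_list xs" for xs
    using basis_function_eq_0[OF bf(1) that] basis_function_eq_0[OF bf(2) that] by simp
  ultimately show ?thesis using nz by (intro exI[of _ a]) (auto simp: a_def)
qed

text \<open>\<open>\<phi>\<close> determines all ratios within a circuit or cocircuit, and two
  nonvanishing functions with equal ratios differ by one factor. Applying \<open>\<tau>\<close> to
  the cocircuit equation is harmless because it is injective.\<close>

lemma compatible_unique_signatures:
  assumes comp: "compatible \<gamma> \<delta> \<phi>" "compatible \<gamma>' \<delta>' \<phi>" and bf: "basis_function \<phi>"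
    and sig: "\<gamma> \<in> signatures (circuits M)" "\<delta> \<in> signatures (cocircuits M)"
      "\<gamma>' \<in> signatures (circuits M)" "\<delta>' \<in> signatures (cocircuits M)"
  shows "\<exists>b l. (\<forall>C\<in>circuits M. b C \<noteq> 0 \<and> (\<forall>x\<in>C. \<gamma> C x = b C * \<gamma>' C x)) \<and>
    (\<forall>D\<in>cocircuits M. l D \<noteq> 0 \<and> (\<forall>y\<in>D. \<delta> D y = l D * \<delta>' D y))"
proof -
  have factor: "\<exists>a. a \<noteq> 0 \<and> (\<forall>x\<in>A. f x = a * g x)"
    if "A \<noteq> {}" and nz: "\<And>x. x \<in> A \<Longrightarrow> f x \<noteq> 0 \<and> g x \<noteq> 0"
      and eq: "\<And>x y. x \<in> A \<Longrightarrow> y \<in> A \<Longrightarrow> f x * g y = g x * f y" for A :: "'e set" and f g :: "'e \<Rightarrow> 'h"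
  proof -
    obtain c where c: "c \<in> A" using \<open>A \<noteq> {}\<close> by blast
    have "f x = (f c * inverse (g c)) * g x" if "x \<in> A" for x
    proof -
      have "f x = f x * g c * inverse (g c)" using nz[OF c] by (simp add: mult.assoc hyper_inverse_right)
      then show ?thesis unfolding eq[OF that c] by (simp add: mult_ac)
    qed
    then show ?thesis using nz[OF c] by (intro exI[of _ "f c * inverse (g c)"]) auto
  qed
  have "\<exists>a. a \<noteq> 0 \<and> (\<forall>x\<in>C. \<gamma> C x = a * \<gamma>' C x)" if C: "C \<in> circuits M" for C
  proof (rule factor)
    show "\<gamma> C x * \<gamma>' C y = \<gamma>' C x * \<gamma> C y" if xy: "x \<in> C" "y \<in> C" for x y
    proof (cases "x = y")
      case False
      obtain zs where zs: "basis_list (x # zs)" "C \<subseteq> insert x (insert y (set zs))"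
        using circuit_basis_list[OF C xy False] by blast
      have eqs: "\<gamma> C x * \<phi> (x # zs) = - (\<gamma> C y * \<phi> (y # zs))"
          "\<gamma>' C x * \<phi> (x # zs) = - (\<gamma>' C y * \<phi> (y # zs))"
        using compatible_circuit[OF _ C xy False zs(2,1)] comp by auto
      have "(\<phi> (x # zs) * \<phi> (y # zs)) * (\<gamma> C x * \<gamma>' C y) =
          (\<gamma> C x * \<phi> (x # zs)) * (\<gamma>' C y * \<phi> (y # zs))" by (simp add: mult_ac)
      also have "\<dots> = - (\<gamma>' C y * \<phi> (y # zs)) * (\<gamma> C y * \<phi> (y # zs))"
        unfolding eqs(1) by (simp add: mult_ac)
      also have "\<dots> = (\<phi> (x # zs) * \<phi> (y # zs)) * (\<gamma>' C x * \<gamma> C y)"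
        unfolding eqs(2)[symmetric] by (simp add: mult_ac)
      finally show ?thesis
        using basis_function_nonzero[OF bf zs(1)]
          basis_function_nonzero[OF bf basis_list_exchange_circuit[OF C zs xy(1)]]
        by (simp add: hyper_mult_left_cancel)
    qed (simp add: mult.commute)
  qed (use circuitD(5)[OF C] signature_nonzero[OF sig(1) C] signature_nonzero[OF sig(3) C] in auto)
  then obtain b where b: "\<And>C. C \<in> circuits M \<Longrightarrow> b C \<noteq> 0 \<and> (\<forall>x\<in>C. \<gamma> C x = b C * \<gamma>' C x)" by metis
  have "\<exists>a. a \<noteq> 0 \<and> (\<forall>x\<in>D. \<delta> D x = a * \<delta>' D x)" if D: "D \<in> cocircuits M" for D
  proof (rule factor)
    show "\<delta> D x * \<delta>' D y = \<delta>' D x * \<delta> D y" if xy: "x \<in> D" "y \<in> D" for x y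
    proof -
      obtain zs where zs: "basis_list (x # zs)" "set zs \<inter> D = {}"
        using cocircuit_basis_list[OF D xy(1)] by blast
      have b: "basis_list (y # zs)" using basis_list_exchange_cocircuit[OF D zs xy(2)] .
      have eqs: "\<phi> (x # zs) * \<tau> (\<delta> D y) = \<phi> (y # zs) * \<tau> (\<delta> D x)"
          "\<phi> (x # zs) * \<tau> (\<delta>' D y) = \<phi> (y # zs) * \<tau> (\<delta>' D x)"
        using compatible_cocircuit[OF _ D xy zs(2,1)] comp by auto
      have "(\<phi> (x # zs) * \<phi> (y # zs)) * \<tau> (\<delta> D x * \<delta>' D y) =
          (\<phi> (y # zs) * \<tau> (\<delta> D x)) * (\<phi> (x # zs) * \<tau> (\<delta>' D y))" by (simp add: mult_ac)
      also have "\<dots> = (\<phi> (x # zs) * \<tau> (\<delta> D y)) * (\<phi> (y # zs) * \<tau> (\<delta>' D x))"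
        by (simp only: eqs)
      also have "\<dots> = (\<phi> (x # zs) * \<phi> (y # zs)) * \<tau> (\<delta>' D x * \<delta> D y)" by (simp add: mult_ac)
      finally have "\<tau> (\<delta> D x * \<delta>' D y) = \<tau> (\<delta>' D x * \<delta> D y)"
        using basis_function_nonzero[OF bf zs(1)] basis_function_nonzero[OF bf b]
        by (simp add: hyper_mult_left_cancel del: involution_simps)
      then show ?thesis unfolding involution_inject .
    qed
  qed (use cocircuit_nonempty[OF D] signature_nonzero[OF sig(2) D] signature_nonzero[OF sig(4) D] in auto)
  then obtain l where "\<And>D. D \<in> cocircuits M \<Longrightarrow> l D \<noteq> 0 \<and> (\<forall>y\<in>D. \<delta> D y = l D * \<delta>' D y)" by metis
  with b show ?thesis by blast
qed

text \<open>One statement covers all scalings. On circuits \<open>h z\<close> cancels against the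
  inverse that \<open>z\<close> contributes to \<open>\<phi>' (z # zs)\<close>. On cocircuits both
  sides acquire the inverses of \<open>h x\<close> and \<open>h y\<close>.\<close>

lemma compatible_transform:
  assumes comp: "compatible \<gamma> \<delta> \<phi>" and h: "\<And>e. e \<in> ground M \<Longrightarrow> h e \<noteq> 0"
    and \<gamma>: "\<And>C x. C \<in> circuits M \<Longrightarrow> x \<in> C \<Longrightarrow> \<gamma>' C x = b C * (h x * \<gamma> C x)"
    and \<delta>: "\<And>D x. D \<in> cocircuits M \<Longrightarrow> x \<in> D \<Longrightarrow> \<delta>' D x = l D * (\<tau> (inverse (h x)) * \<delta> D x)"
    and \<phi>: "\<And>xs. xs \<in> rank_tuples \<Longrightarrow>
      \<phi>' xs = a * (prod_list (map (\<lambda>e. inverse (h e)) xs) * \<phi> xs)"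
  shows "compatible \<gamma>' \<delta>' \<phi>'"
  unfolding compatible_def
proof (intro conjI ballI allI impI)
  fix D zs x y
  assume *: "D \<in> cocircuits M" "x \<in> D" "y \<in> D" "set zs \<inter> D = {}" "basis_list (x # zs)"
  have b: "basis_list (y # zs)" using basis_list_exchange_cocircuit * by blast
  let ?p = "prod_list (map (\<lambda>e. inverse (h e)) zs)"
  have "\<phi>' (x # zs) * \<tau> (\<delta>' D y) =
      a * ?p * \<tau> (l D) * inverse (h x) * inverse (h y) * (\<phi> (x # zs) * \<tau> (\<delta> D y))"
    using * basis_list_nlists by (simp add: \<delta> \<phi> mult_ac)
  also have "\<phi> (x # zs) * \<tau> (\<delta> D y) = \<phi> (y # zs) * \<tau> (\<delta> D x)"
    using compatible_cocircuit[OF comp *] .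
  also have "a * ?p * \<tau> (l D) * inverse (h x) * inverse (h y) * (\<phi> (y # zs) * \<tau> (\<delta> D x)) =
      \<phi>' (y # zs) * \<tau> (\<delta>' D x)"
    using * b basis_list_nlists by (simp add: \<delta> \<phi> mult_ac)
  finally show "\<phi>' (x # zs) * \<tau> (\<delta>' D y) = \<phi>' (y # zs) * \<tau> (\<delta>' D x)" .
next
  fix C zs x y
  assume *: "C \<in> circuits M" "x \<in> C" "y \<in> C" "x \<noteq> y" "C \<subseteq> insert x (insert y (set zs))" "basis_list (x # zs)"
  have b: "basis_list (y # zs)" using basis_list_exchange_circuit * by blast
  let ?p = "prod_list (map (\<lambda>e. inverse (h e)) zs)"
  have cancel: "h z * inverse (h z) = 1" if "z \<in> C" for z
    using h[of z] that circuitD(1)[OF *(1)] by (intro hyper_inverse_right) auto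
  have scaled: "\<gamma>' C z * \<phi>' (z # zs) = b C * a * ?p * (\<gamma> C z * \<phi> (z # zs))" if "z \<in> C" "basis_list (z # zs)" for z
  proof -
    have "\<gamma>' C z * \<phi>' (z # zs) = b C * a * ?p * (h z * inverse (h z)) * (\<gamma> C z * \<phi> (z # zs))"
      using *(1) that basis_list_nlists by (simp add: \<gamma> \<phi> mult_ac)
    then show ?thesis using cancel[OF that(1)] by simp
  qed
  show "\<gamma>' C x * \<phi>' (x # zs) = - (\<gamma>' C y * \<phi>' (y # zs))"
    using scaled[OF *(2,6)] scaled[OF *(3) b] compatible_circuit[OF comp *] by simp
qed

end

section \<open>Constructing a function from a pair of signatures\<close>

typedef (overloaded) 'h hunit = "{x::'h::hyperfield. x \<noteq> 0}"
  by (rule exI[of _ 1]) simp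

text \<open>The multiplicative group is written additively so that \<open>exchange_family_potential\<close> applies.\<close>

instantiation hunit :: (hyperfield) ab_group_add
begin

definition "0 = Abs_hunit 1"
definition "a + b = Abs_hunit (Rep_hunit a * Rep_hunit b)"
definition "- a = Abs_hunit (inverse (Rep_hunit a))"
definition "a - b = a + - (b::'a hunit)"

instance
proof
  have nz: "Rep_hunit x \<noteq> 0" for x :: "'a hunit"
    using Rep_hunit[of x] by simp
  fix a b c :: "'a hunit"
  show "a + b + c = a + (b + c)" "a + b = b + a" "0 + a = a" "- a + a = 0" "a - b = a + - b"
    using nz by (simp_all add: plus_hunit_def zero_hunit_def uminus_hunit_def
        minus_hunit_def Abs_hunit_inverse Rep_hunit_inverse mult_ac hyper_inverse_right)
qed

end

lemma Rep_hunit_nonzero [simp]: "Rep_hunit a \<noteq> 0"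
  using Rep_hunit[of a] by simp

lemma Rep_hunit_plus: "Rep_hunit (a + b) = Rep_hunit a * Rep_hunit b"
  by (simp add: plus_hunit_def Abs_hunit_inverse)

section \<open>Consistency of the prescribed ratios\<close>

context matroid_involution
begin

definition fund_cocircuit :: "'e set \<Rightarrow> 'e set"
  where "fund_cocircuit Z = {x\<in>ground M. insert x Z \<in> bases M}"

lemma fund_cocircuit:
  assumes "insert x Z \<in> bases M" "x \<notin> Z"
  shows "fund_cocircuit Z \<in> cocircuits M" "x \<in> fund_cocircuit Z" "fund_cocircuit Z \<inter> Z = {}"
proof -
  show "fund_cocircuit Z \<in> cocircuits M" "x \<in> fund_cocircuit Z"
    using fundamental_cocircuit[OF assms] basis_subset[OF assms(1)] assms(1) by (auto simp: fund_cocircuit_def)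
  show "fund_cocircuit Z \<inter> Z = {}"
    using insert_basis_notin[OF insert_basis_card[OF assms(2,1)]] by (auto simp: fund_cocircuit_def)
qed

text \<open>The cocircuit misses \<open>Z\<close>, so it meets \<open>C\<close> exactly in
  \<open>x\<close> and \<open>y\<close>. Orthogonality on a pair is available for either strength
  and is an equation.\<close>

lemma edge_relation:
  assumes N: "(\<gamma>, \<delta>) \<in> Nt s \<tau> M" and Z: "insert x Z \<in> bases M" "x \<notin> Z" "insert y Z \<in> bases M" "y \<notin> Z"
    and "x \<noteq> y" and C: "C \<in> circuits M" "C \<subseteq> insert x (insert y Z)"
  shows "\<gamma> C x * \<tau> (\<delta> (fund_cocircuit Z) x) = - (\<gamma> C y * \<tau> (\<delta> (fund_cocircuit Z) y))"
proof -
  have "x \<in> C"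
    using circuitD(2)[OF C(1)] indep_subset[OF basis_indep[OF Z(3)], of C] C(2) by blast
  moreover have "y \<in> C"
    using circuitD(2)[OF C(1)] indep_subset[OF basis_indep[OF Z(1)], of C] C(2) by blast
  ultimately have eq: "C \<inter> fund_cocircuit Z = {x, y}"
    using fund_cocircuit[OF Z(1,2)] fund_cocircuit[OF Z(3,4)] C(2) by blast
  have "card {x, y} \<le> 3" by (simp add: card_insert_if)
  then have "orthogonal_on \<tau> \<gamma> \<delta> C (fund_cocircuit Z)"
    using N C(1) fund_cocircuit(1)[OF Z(1,2)] unfolding Nt_iff within_strength_def eq[symmetric] by blast
  then show ?thesis
    using \<open>x \<noteq> y\<close> unfolding orthogonal_on_def eq by (simp add: zero_in_hypersum_pair)
qed

text \<open>The circuit in \<open>Y\<close> with \<open>a\<close>, \<open>b\<close>,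
  \<open>c\<close> added contains all three. Its three edge relations are multiplied; the entries of
  \<open>\<gamma>\<close> cancel and three minus signs remain.\<close>

lemma triangle_relation:
  assumes N: "(\<gamma>, \<delta>) \<in> Nt s \<tau> M" and dist: "distinct [a, b, c]" "{a, b, c} \<inter> Y = {}"
    and B: "insert a (insert b Y) \<in> bases M" "insert a (insert c Y) \<in> bases M" "insert b (insert c Y) \<in> bases M"
  defines "t \<equiv> \<lambda>Z x. \<tau> (\<delta> (fund_cocircuit Z) x)"
  shows "t (insert a Y) b * t (insert b Y) c * t (insert c Y) a =
    - (t (insert a Y) c * t (insert b Y) a * t (insert c Y) b)"
proof -
  let ?I = "insert a (insert b (insert c Y))"
  define C where "C = {z\<in>?I. ?I - {z} \<in> bases M}"
  have C: "C \<in> circuits M"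
    unfolding C_def
  proof (rule fundamental_circuit[OF _ B(3)])
    show "card ?I = Suc rk"
      using basis_card[OF B(3)] basis_finite[OF B(3)] dist by simp
  qed (use basis_subset[OF B(3)] basis_subset[OF B(1)] in auto)
  have CI: "C \<subseteq> ?I" by (auto simp: C_def)
  have I: "?I - {a} = insert b (insert c Y)" "?I - {b} = insert a (insert c Y)" "?I - {c} = insert a (insert b Y)"
    using dist by auto
  have abc: "a \<in> C" "b \<in> C" "c \<in> C" using B by (simp_all add: C_def I)
  have sig: "\<gamma> \<in> signatures (circuits M)" using N by (simp add: Nt_iff)
  have 1: "\<gamma> C b * t (insert a Y) b = - (\<gamma> C c * t (insert a Y) c)"
    unfolding t_def using B dist CI
    by (intro edge_relation[OF N _ _ _ _ _ C]) (auto simp: insert_commute)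
  have 2: "\<gamma> C c * t (insert b Y) c = - (\<gamma> C a * t (insert b Y) a)"
    unfolding t_def using B dist CI
    by (intro edge_relation[OF N _ _ _ _ _ C]) (auto simp: insert_commute)
  have 3: "\<gamma> C a * t (insert c Y) a = - (\<gamma> C b * t (insert c Y) b)"
    unfolding t_def using B dist CI
    by (intro edge_relation[OF N _ _ _ _ _ C]) (auto simp: insert_commute)
  have "(\<gamma> C a * \<gamma> C b * \<gamma> C c) * (t (insert a Y) b * t (insert b Y) c * t (insert c Y) a) =
      (\<gamma> C b * t (insert a Y) b) * (\<gamma> C c * t (insert b Y) c) * (\<gamma> C a * t (insert c Y) a)"
    by (simp add: mult_ac)
  also have "\<dots> = - (\<gamma> C c * t (insert a Y) c) * - (\<gamma> C a * t (insert b Y) a) * - (\<gamma> C b * t (insert c Y) b)"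
    by (simp only: 1 2 3)
  also have "\<dots> = (\<gamma> C a * \<gamma> C b * \<gamma> C c) * - (t (insert a Y) c * t (insert b Y) a * t (insert c Y) b)"
    by (simp add: mult_ac)
  finally have eq: "(\<gamma> C a * \<gamma> C b * \<gamma> C c) * (t (insert a Y) b * t (insert b Y) c * t (insert c Y) a) =
      (\<gamma> C a * \<gamma> C b * \<gamma> C c) * - (t (insert a Y) c * t (insert b Y) a * t (insert c Y) b)" .
  have "\<gamma> C a * \<gamma> C b * \<gamma> C c \<noteq> 0" using signature_nonzero[OF sig C] abc by simp
  from hyper_mult_left_cancel[OF this, THEN iffD1, OF eq] show ?thesis .
qed

text \<open>As \<open>x\<close>, \<open>e\<close> and \<open>W\<close> do not form a basis, adding
  \<open>x\<close> or \<open>e\<close> to \<open>W\<close> yields the same cocircuit, so the factors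
  at \<open>u\<close> and \<open>v\<close> agree. For the same reason the circuit in
  \<open>W\<close> with \<open>x\<close>, \<open>e\<close>, \<open>u\<close> added avoids
  \<open>u\<close>; it therefore serves the edges over \<open>insert u W\<close> and over
  \<open>insert v W\<close> alike.\<close>

lemma square_relation:
  assumes N: "(\<gamma>, \<delta>) \<in> Nt s \<tau> M" and dist: "distinct [u, v, x, e]" "{u, v, x, e} \<inter> W = {}"
    and B: "insert u (insert x W) \<in> bases M" "insert v (insert x W) \<in> bases M"
      "insert u (insert e W) \<in> bases M" "insert v (insert e W) \<in> bases M" "insert x (insert e W) \<notin> bases M"
  defines "t \<equiv> \<lambda>Z x. \<tau> (\<delta> (fund_cocircuit Z) x)"
  shows "t (insert x W) u * t (insert v W) x * t (insert e W) v * t (insert u W) e =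
    t (insert x W) v * t (insert v W) e * t (insert e W) u * t (insert u W) x"
proof -
  let ?D = "fund_cocircuit (insert x W)"
  have D: "?D \<in> cocircuits M" "?D \<inter> insert x W = {}"
    using fund_cocircuit[OF B(1)] dist by auto
  have "?D = {z \<in> ground M. insert z (insert e W) \<in> bases M}"
  proof (rule cocircuit_eq_fundamental[OF D(1)])
    show "insert e W \<in> indep_sets M" using indep_subset[OF basis_indep[OF B(3)]] by blast
    show "Suc (card (insert e W)) = rk" using insert_basis_card[OF _ B(3)] dist by auto
    show "insert e W \<inter> ?D = {}" using D(2) B(5) by (auto simp: fund_cocircuit_def insert_commute)
  qed
  then have DD: "fund_cocircuit (insert e W) = ?D" by (simp add: fund_cocircuit_def)
  let ?I = "insert x (insert e (insert u W))"
  define C where "C = {z\<in>?I. ?I - {z} \<in> bases M}"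
  have C: "C \<in> circuits M"
    unfolding C_def
  proof (rule fundamental_circuit[OF _ B(3)])
    show "card ?I = Suc rk"
      using basis_card[OF B(3)] basis_finite[OF B(3)] dist by (auto simp: card_insert_if)
  qed (use basis_subset[OF B(3)] basis_subset[OF B(1)] in auto)
  have I: "?I - {x} = insert u (insert e W)" "?I - {e} = insert u (insert x W)" "?I - {u} = insert x (insert e W)"
    using dist by auto
  have xe: "x \<in> C" "e \<in> C" using B by (simp_all add: C_def I)
  have "u \<notin> C" using B by (simp add: C_def I)
  then have CI: "C \<subseteq> insert x (insert e W)" by (auto simp: C_def)
  have sig: "\<gamma> \<in> signatures (circuits M)" using N by (simp add: Nt_iff)
  have 1: "\<gamma> C x * t (insert u W) x = - (\<gamma> C e * t (insert u W) e)"
    unfolding t_def using B dist CI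
    by (intro edge_relation[OF N _ _ _ _ _ C]) (auto simp: insert_commute)
  have 2: "\<gamma> C x * t (insert v W) x = - (\<gamma> C e * t (insert v W) e)"
    unfolding t_def using B dist CI
    by (intro edge_relation[OF N _ _ _ _ _ C]) (auto simp: insert_commute)
  have "(\<gamma> C x * \<gamma> C e) * (t (insert v W) x * t (insert u W) e) =
      (\<gamma> C x * t (insert v W) x) * (\<gamma> C e * t (insert u W) e)" by (simp add: mult_ac)
  also have "\<dots> = (\<gamma> C e * t (insert v W) e) * - (\<gamma> C e * t (insert u W) e)"
    unfolding 2 by simp
  also have "\<dots> = (\<gamma> C x * \<gamma> C e) * (t (insert v W) e * t (insert u W) x)"
    unfolding 1[symmetric] by (simp add: mult_ac)
  finally have eq: "(\<gamma> C x * \<gamma> C e) * (t (insert v W) x * t (insert u W) e) =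
      (\<gamma> C x * \<gamma> C e) * (t (insert v W) e * t (insert u W) x)" .
  have "\<gamma> C x * \<gamma> C e \<noteq> 0" using signature_nonzero[OF sig C] xe by simp
  from hyper_mult_left_cancel[OF this, THEN iffD1, OF eq]
  have "(t (insert x W) u * t (insert e W) v) * (t (insert v W) x * t (insert u W) e) =
      (t (insert x W) v * t (insert e W) u) * (t (insert v W) e * t (insert u W) x)"
    unfolding t_def DD by (simp add: mult_ac)
  then show ?thesis by (simp add: mult_ac)
qed

text \<open>With the factor \<open>ins_sign\<close>, the minus of \<open>triangle_relation\<close>
  meets the minus of \<open>ins_sign_triangle\<close>, while the square needs no correction. Both
  become plain identities in \<open>hunit\<close>, as the gluing lemma requires.\<close>

lemma exists_potential:
  assumes N: "(\<gamma>, \<delta>) \<in> Nt s \<tau> M" and n: "inj_on n (ground M)"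
  shows "\<exists>f. (\<forall>B. f B \<noteq> 0) \<and> (\<forall>Z x y. x \<notin> Z \<longrightarrow> y \<notin> Z \<longrightarrow> insert x Z \<in> bases M \<longrightarrow> insert y Z \<in> bases M \<longrightarrow>
    f (insert x Z) * (ins_sign n y Z * \<tau> (\<delta> (fund_cocircuit Z) y)) =
    f (insert y Z) * (ins_sign n x Z * \<tau> (\<delta> (fund_cocircuit Z) x)))"
proof -
  define t where "t Z x = \<tau> (\<delta> (fund_cocircuit Z) x)" for Z x
  define \<rho> where "\<rho> Z x = Abs_hunit (ins_sign n x Z * t Z x)" for Z x
  have \<delta>: "\<delta> \<in> signatures (cocircuits M)" using N by (simp add: Nt_iff)
  have Rep_\<rho>: "Rep_hunit (\<rho> Z x) = ins_sign n x Z * t Z x" if "insert x Z \<in> bases M" "x \<notin> Z" for Z x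
    using signature_nonzero[OF \<delta> fund_cocircuit(1,2)[OF that]]
    by (simp add: \<rho>_def t_def Abs_hunit_inverse)
  have inj: "inj_on n A" if "A \<subseteq> B" "B \<subseteq> ground M" for A B
    using n that by (meson inj_on_subset order_trans)
  have "\<exists>f. \<forall>Z x y. x \<notin> Z \<longrightarrow> y \<notin> Z \<longrightarrow> insert x Z \<in> bases M \<longrightarrow> insert y Z \<in> bases M \<longrightarrow>
      f (insert x Z) + \<rho> Z y = f (insert y Z) + \<rho> Z x"
  proof (rule exchange_family_potential[OF finite_ground])
    fix B B' assume "B \<in> bases M" "B' \<in> bases M"
    then show "B - ground M = B' - ground M" using basis_subset by blast
  next
    fix Y a b c
    assume dist: "distinct [a, b, c]" "{a, b, c} \<inter> Y = {}"
      and B: "insert a (insert b Y) \<in> bases M" "insert a (insert c Y) \<in> bases M" "insert b (insert c Y) \<in> bases M"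
    have fin: "finite Y" using basis_finite[OF B(1)] by simp
    have ne: "b \<noteq> a" "c \<noteq> a" "c \<noteq> b" using dist by auto
    have "inj_on n {a, b, c}"
      using basis_subset[OF B(1)] basis_subset[OF B(2)] by (intro inj_on_subset[OF n]) auto
    note sgn = ins_sign_triangle[OF dist fin this]
    have tri: "t (insert a Y) b * t (insert b Y) c * t (insert c Y) a =
        - (t (insert a Y) c * t (insert b Y) a * t (insert c Y) b)"
      unfolding t_def by (rule triangle_relation[OF N dist B])
    have "Rep_hunit (\<rho> (insert a Y) b + \<rho> (insert b Y) c + \<rho> (insert c Y) a) =
        (ins_sign n b (insert a Y) * ins_sign n c (insert b Y) * ins_sign n a (insert c Y)) *
        (t (insert a Y) b * t (insert b Y) c * t (insert c Y) a)"
      using B dist ne by (simp add: Rep_hunit_plus Rep_\<rho> insert_commute mult_ac)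
    also have "\<dots> = (ins_sign n c (insert a Y) * ins_sign n a (insert b Y) * ins_sign n b (insert c Y)) *
        (t (insert a Y) c * t (insert b Y) a * t (insert c Y) b)"
      unfolding sgn tri by (simp only: hyper_mult_minus_left hyper_mult_minus_right hyper_uminus_uminus)
    also have "\<dots> = Rep_hunit (\<rho> (insert a Y) c + \<rho> (insert b Y) a + \<rho> (insert c Y) b)"
      using B dist ne by (simp add: Rep_hunit_plus Rep_\<rho> insert_commute mult_ac)
    finally show "\<rho> (insert a Y) b + \<rho> (insert b Y) c + \<rho> (insert c Y) a =
        \<rho> (insert a Y) c + \<rho> (insert b Y) a + \<rho> (insert c Y) b"
      by (simp only: Rep_hunit_inject)
  next
    fix W u v x e
    assume dist: "distinct [u, v, x, e]" "{u, v, x, e} \<inter> W = {}"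
      and B: "insert u (insert x W) \<in> bases M" "insert v (insert x W) \<in> bases M"
        "insert u (insert e W) \<in> bases M" "insert v (insert e W) \<in> bases M" "insert x (insert e W) \<notin> bases M"
    have fin: "finite W" using basis_finite[OF B(1)] by simp
    have ne: "x \<noteq> u" "x \<noteq> v" "e \<noteq> u" "e \<noteq> v" "e \<noteq> x" using dist by auto
    have "inj_on n {u, v, x, e}"
      using basis_subset[OF B(1)] basis_subset[OF B(4)] by (intro inj_on_subset[OF n]) auto
    note sgn = ins_sign_square_relation[OF dist fin this]
    have sq: "t (insert x W) u * t (insert v W) x * t (insert e W) v * t (insert u W) e =
        t (insert x W) v * t (insert v W) e * t (insert e W) u * t (insert u W) x"
      unfolding t_def by (rule square_relation[OF N dist B])
    have "Rep_hunit (\<rho> (insert x W) u + \<rho> (insert v W) x + \<rho> (insert e W) v + \<rho> (insert u W) e) =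
        (ins_sign n u (insert x W) * ins_sign n x (insert v W) * ins_sign n v (insert e W) *
          ins_sign n e (insert u W)) *
        (t (insert x W) u * t (insert v W) x * t (insert e W) v * t (insert u W) e)"
      using B dist ne by (simp add: Rep_hunit_plus Rep_\<rho> insert_commute mult_ac)
    also have "\<dots> = Rep_hunit (\<rho> (insert x W) v + \<rho> (insert v W) e + \<rho> (insert e W) u + \<rho> (insert u W) x)"
      unfolding sgn sq using B dist ne by (simp add: Rep_hunit_plus Rep_\<rho> insert_commute mult_ac)
    finally show "\<rho> (insert x W) u + \<rho> (insert v W) x + \<rho> (insert e W) v + \<rho> (insert u W) e =
        \<rho> (insert x W) v + \<rho> (insert v W) e + \<rho> (insert e W) u + \<rho> (insert u W) x"
      by (simp only: Rep_hunit_inject)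
  qed (use basis_finite basis_exchange basis_exchange_dual in blast)+
  then obtain f where f: "\<And>Z x y. x \<notin> Z \<Longrightarrow> y \<notin> Z \<Longrightarrow> insert x Z \<in> bases M \<Longrightarrow> insert y Z \<in> bases M \<Longrightarrow>
      f (insert x Z) + \<rho> Z y = f (insert y Z) + \<rho> Z x"
    by blast
  have "Rep_hunit (f (insert x Z)) * (ins_sign n y Z * t Z y) =
      Rep_hunit (f (insert y Z)) * (ins_sign n x Z * t Z x)"
    if "x \<notin> Z" "y \<notin> Z" "insert x Z \<in> bases M" "insert y Z \<in> bases M" for Z x y
    using arg_cong[OF f[OF that], of Rep_hunit] that by (simp add: Rep_hunit_plus Rep_\<rho>)
  then show ?thesis
    unfolding t_def by (intro exI[of _ "\<lambda>B. Rep_hunit (f B)"]) simp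
qed

text \<open>\<open>list_sign\<close> makes the potential alternating. Compatibility then implies the
  Grassmann-Pluecker relations of the wanted strength through \<open>Np_if_Nt\<close>.\<close>

lemma exists_compatible:
  assumes N: "(\<gamma>, \<delta>) \<in> Nt s \<tau> M"
  shows "\<exists>\<phi>\<in>Np s rk M. compatible \<gamma> \<delta> \<phi>"
proof -
  have \<gamma>: "\<gamma> \<in> signatures (circuits M)" and \<delta>: "\<delta> \<in> signatures (cocircuits M)" using N by (simp_all add: Nt_iff)
  obtain n :: "'e \<Rightarrow> nat" where n: "inj_on n (ground M)"
    using finite_imp_inj_to_nat_seg[OF finite_ground] by blast
  obtain f where f: "\<And>B. f B \<noteq> 0"
    "\<And>Z x y. x \<notin> Z \<Longrightarrow> y \<notin> Z \<Longrightarrow> insert x Z \<in> bases M \<Longrightarrow> insert y Z \<in> bases M \<Longrightarrow>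
      f (insert x Z) * (ins_sign n y Z * \<tau> (\<delta> (fund_cocircuit Z) y)) =
      f (insert y Z) * (ins_sign n x Z * \<tau> (\<delta> (fund_cocircuit Z) x))"
    using exists_potential[OF N n] by blast
  define \<phi> where "\<phi> = (\<lambda>xs\<in>rank_tuples.
    if basis_list xs then list_sign n xs * f (set xs) else 0)"
  have \<phi>: "\<phi> xs = list_sign n xs * f (set xs)" if "basis_list xs" for xs
    using that basis_list_nlists by (simp add: \<phi>_def)
  have \<phi>_0: "\<phi> xs = 0" if "xs \<in> rank_tuples" "\<not> basis_list xs" for xs
    using that by (simp add: \<phi>_def)
  have ext: "\<phi> \<in> extensional (rank_tuples)" by (simp add: \<phi>_def)
  have alt: "alternating rk (ground M) \<phi>"
  proof (rule alternating_if_swap)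
    fix A x y B assume xs: "A @ x # y # B \<in> rank_tuples"
    have perm: "basis_list (A @ y # x # B) \<longleftrightarrow> basis_list (A @ x # y # B)"
      by (rule basis_list_perm) (simp add: add_mset_commute)
    show "\<phi> (A @ y # x # B) = - \<phi> (A @ x # y # B)"
    proof (cases "basis_list (A @ x # y # B)")
      case True
      then have dist: "distinct (A @ x # y # B)" by (simp only: basis_list_def)
      have "inj_on n {x, y}"
        using xs by (intro inj_on_subset[OF n]) (simp add: in_nlists_iff)
      moreover have "set (A @ y # x # B) = set (A @ x # y # B)" by auto
      ultimately show ?thesis
        using \<phi>[OF True] \<phi>[OF perm[THEN iffD2, OF True]]
        by (simp only: list_sign_swap[OF dist] hyper_mult_minus_left)
    next
      case False
      have "A @ y # x # B \<in> rank_tuples" using xs by (auto simp: in_nlists_iff)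
      then show ?thesis using \<phi>_0[OF xs False] \<phi>_0 False perm by simp
    qed
  next
    fix xs assume "xs \<in> rank_tuples" "\<not> distinct xs"
    then show "\<phi> xs = 0" by (intro \<phi>_0) (auto simp: basis_list_def)
  qed
  have bf: "basis_function \<phi>"
    unfolding basis_function_def
  proof (intro conjI ballI alt)
    fix xs assume "xs \<in> rank_tuples"
    then show "\<phi> xs \<noteq> 0 \<longleftrightarrow> basis_list xs"
      using \<phi>[of xs] \<phi>_0[of xs] f(1) by (cases "basis_list xs") auto
  qed
  have edge: "\<phi> (x # zs) * \<tau> (\<delta> (fund_cocircuit (set zs)) y) = \<phi> (y # zs) * \<tau> (\<delta> (fund_cocircuit (set zs)) x)"
    if b: "basis_list (x # zs)" "basis_list (y # zs)" for x y zs
  proof -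
    let ?Z = "set zs" and ?t = "\<lambda>x. \<tau> (\<delta> (fund_cocircuit (set zs)) x)"
    let ?s = "\<lambda>x. ins_sign n x (set zs)"
    have eq: "f (insert x ?Z) * (?s y * ?t y) = f (insert y ?Z) * (?s x * ?t x)"
      using b by (intro f(2)) (auto simp: basis_list_def)
    \<comment> \<open>The inserted square of a sign completes the factor that the equation for
      \<open>f\<close> expects; the sign of \<open>x\<close> is already part of
      \<open>list_sign\<close>.\<close>
    have "\<phi> (x # zs) * ?t y = (?s y * ?s y) * \<phi> (x # zs) * ?t y" by simp
    also have "\<dots> = ?s x * ?s y * list_sign n zs * (f (insert x ?Z) * (?s y * ?t y))"
      unfolding \<phi>[OF b(1)] by (simp only: list_sign.simps list.set) (simp only: mult_ac)
    also have "\<dots> = ?s x * ?s x * \<phi> (y # zs) * ?t x"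
      unfolding eq \<phi>[OF b(2)] by (simp only: list_sign.simps list.set) (simp only: mult_ac)
    finally show ?thesis by simp
  qed
  have "compatible \<gamma> \<delta> \<phi>"
    unfolding compatible_def
  proof (intro conjI ballI allI impI)
    fix D zs x y
    assume *: "D \<in> cocircuits M" "x \<in> D" "y \<in> D" "set zs \<inter> D = {}" "basis_list (x # zs)"
    have b: "basis_list (y # zs)" using basis_list_exchange_cocircuit[OF *(1,5,4,3)] .
    have "D = fund_cocircuit (set zs)"
      using cocircuit_eq_fundamental[OF *(1) basis_list_tail[OF *(5)] *(4)] by (simp add: fund_cocircuit_def)
    then show "\<phi> (x # zs) * \<tau> (\<delta> D y) = \<phi> (y # zs) * \<tau> (\<delta> D x)" using edge[OF *(5) b] by simp
  next
    fix C zs x y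
    assume *: "C \<in> circuits M" "x \<in> C" "y \<in> C" "x \<noteq> y" "C \<subseteq> insert x (insert y (set zs))" "basis_list (x # zs)"
    have b: "basis_list (y # zs)" using basis_list_exchange_circuit[OF *(1,6,5,2)] .
    let ?t = "\<lambda>x. \<tau> (\<delta> (fund_cocircuit (set zs)) x)"
    have Z: "insert x (set zs) \<in> bases M" "x \<notin> set zs" "insert y (set zs) \<in> bases M" "y \<notin> set zs"
      using *(6) b by (simp_all add: basis_list_def)
    \<comment> \<open>Orthogonality on a pair expresses the ratio of the circuit entries by that of
      the cocircuit entries, so the circuit clause follows from \<open>edge\<close>.\<close>
    have e: "\<gamma> C x * ?t x = - (\<gamma> C y * ?t y)" by (rule edge_relation[OF N Z *(4,1,5)])
    have "?t x * (\<gamma> C x * \<phi> (x # zs)) = (\<gamma> C x * ?t x) * \<phi> (x # zs)" by (simp only: mult_ac)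
    also have "\<dots> = - (\<gamma> C y * (\<phi> (x # zs) * ?t y))" unfolding e by (simp add: mult_ac)
    also have "\<dots> = ?t x * - (\<gamma> C y * \<phi> (y # zs))" unfolding edge[OF *(6) b] by (simp add: mult_ac)
    finally have eq: "?t x * (\<gamma> C x * \<phi> (x # zs)) = ?t x * - (\<gamma> C y * \<phi> (y # zs))" .
    have "?t x \<noteq> 0" using signature_nonzero[OF \<delta> fund_cocircuit(1,2)[OF Z(1,2)]] by simp
    from hyper_mult_left_cancel[OF this, THEN iffD1, OF eq]
    show "\<gamma> C x * \<phi> (x # zs) = - (\<gamma> C y * \<phi> (y # zs))" .
  qed
  then show ?thesis using Np_if_Nt[OF _ N ext bf] by blast
qed

lemma basis_function_scale:
  assumes bf: "basis_function \<phi>" and "a \<noteq> 0" and h: "\<And>e. e \<in> ground M \<Longrightarrow> h e \<noteq> 0"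
    and \<phi>': "\<And>xs. xs \<in> rank_tuples \<Longrightarrow> \<phi>' xs = a * (prod_list (map h xs) * \<phi> xs)"
  shows "basis_function \<phi>'"
  unfolding basis_function_def
proof (intro conjI ballI)
  have alt: "alternating rk (ground M) \<phi>" using bf by (simp add: basis_function_def)
  show "alternating rk (ground M) \<phi>'"
  proof (rule alternating_if_swap)
    fix A x y B assume xs: "A @ x # y # B \<in> rank_tuples"
    then have ys: "A @ y # x # B \<in> rank_tuples" by (auto simp: in_nlists_iff)
    have "prod_list (map h (A @ y # x # B)) = prod_list (map h (A @ x # y # B))" by (simp add: mult_ac)
    then show "\<phi>' (A @ y # x # B) = - \<phi>' (A @ x # y # B)"
      unfolding \<phi>'[OF xs] \<phi>'[OF ys] alternating_swap[OF alt xs] by simp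
  next
    fix xs assume "xs \<in> rank_tuples" "\<not> distinct xs"
    then show "\<phi>' xs = 0" using alternating_not_distinct[OF alt] by (simp add: \<phi>')
  qed
  fix xs assume xs: "xs \<in> rank_tuples"
  have "prod_list (map h ys) \<noteq> 0" if "set ys \<subseteq> ground M" for ys
    using that h by (induction ys) auto
  with xs have "prod_list (map h xs) \<noteq> 0" by (simp add: in_nlists_iff)
  then show "\<phi>' xs \<noteq> 0 \<longleftrightarrow> basis_list xs"
    using bf xs \<open>a \<noteq> 0\<close> by (simp add: \<phi>' basis_function_def)
qed

end

section \<open>Induced maps on quotients\<close>

lemma continuous_map_quotient:
  assumes "continuous_map X Y f" and H: "\<And>x. x \<in> topspace X \<Longrightarrow> H (r `` {x}) = q `` {f x}"
  shows "continuous_map (quotient_topology X r) (quotient_topology Y q) H"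
proof -
  have f: "f x \<in> topspace Y" if "x \<in> topspace X" for x
    using assms(1) that by (auto simp: continuous_map_def)
  show ?thesis
    unfolding continuous_map_def
  proof (intro conjI allI impI)
    show "H \<in> topspace (quotient_topology X r) \<rightarrow> topspace (quotient_topology Y q)"
      using H f by (auto elim!: quotientE intro!: quotientI)
  next
    fix U assume U: "openin (quotient_topology Y q) U"
    have "{x \<in> topspace X. r `` {x} \<in> {Z \<in> topspace (quotient_topology X r). H Z \<in> U}} =
        {x \<in> topspace X. f x \<in> {y \<in> topspace Y. q `` {y} \<in> U}}"
      using H f by (auto intro: quotientI)
    moreover have "openin X {x \<in> topspace X. f x \<in> {y \<in> topspace Y. q `` {y} \<in> U}}"
      using U by (intro openin_continuous_map_preimage[OF assms(1)]) (simp add: openin_quotient_topology)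
    ultimately show "openin (quotient_topology X r) {Z \<in> topspace (quotient_topology X r). H Z \<in> U}"
      unfolding openin_quotient_topology by auto
  qed
qed

text \<open>\<open>K\<close> is saturated for both relations and matches classes one to one. The map
  on classes is the image under \<open>K\<close>, hence independent of the selections
  \<open>f\<close> and \<open>g\<close>; these witness that images are nonempty and carry the
  continuity.\<close>

locale class_correspondence =
  fixes N :: "'a set" and r :: "('a \<times> 'a) set" and P :: "'b set" and q :: "('b \<times> 'b) set"
    and K :: "('a \<times> 'b) set" and f :: "'a \<Rightarrow> 'b" and g :: "'b \<Rightarrow> 'a"
  assumes r: "equiv N r" and q: "equiv P q" and K_subset: "K \<subseteq> N \<times> P"
    and f: "x \<in> N \<Longrightarrow> (x, f x) \<in> K" and g: "y \<in> P \<Longrightarrow> (g y, y) \<in> K"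
    and r_if_K: "(x, y) \<in> K \<Longrightarrow> (x', y) \<in> K \<Longrightarrow> (x, x') \<in> r"
    and K_if_r: "(x, x') \<in> r \<Longrightarrow> (x, y) \<in> K \<Longrightarrow> (x', y) \<in> K"
    and q_if_K: "(x, y) \<in> K \<Longrightarrow> (x, y') \<in> K \<Longrightarrow> (y, y') \<in> q"
    and K_if_q: "(y, y') \<in> q \<Longrightarrow> (x, y) \<in> K \<Longrightarrow> (x, y') \<in> K"
begin

lemma class_correspondence_converse: "class_correspondence P q N r (K\<inverse>) g f"
proof
  show "equiv P q" "equiv N r" by (rule q, rule r)
  show "K\<inverse> \<subseteq> P \<times> N" using K_subset by blast
  show "(y, g y) \<in> K\<inverse>" if "y \<in> P" for y using g[OF that] by simp
  show "(f x, x) \<in> K\<inverse>" if "x \<in> N" for x using f[OF that] by simp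
  show "(y, y') \<in> q" if "(y, x) \<in> K\<inverse>" "(y', x) \<in> K\<inverse>" for x y y'
    using q_if_K that by simp
  show "(y', x) \<in> K\<inverse>" if "(y, y') \<in> q" "(y, x) \<in> K\<inverse>" for x y y'
    using K_if_q that by simp
  show "(x, x') \<in> r" if "(y, x) \<in> K\<inverse>" "(y, x') \<in> K\<inverse>" for x x' y
    using r_if_K that by simp
  show "(y, x') \<in> K\<inverse>" if "(x, x') \<in> r" "(y, x) \<in> K\<inverse>" for x x' y
    using K_if_r that by simp
qed

lemma Image_class:
  assumes "x \<in> N"
  shows "K `` (r `` {x}) = q `` {f x}"
proof (intro equalityI subsetI)
  fix y assume "y \<in> K `` (r `` {x})"
  then obtain x' where "(x, x') \<in> r" "(x', y) \<in> K" by blast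
  then have "(x, y) \<in> K" using K_if_r r by (meson equiv_def symD)
  then show "y \<in> q `` {f x}" using q_if_K f[OF assms] by blast
next
  fix y assume "y \<in> q `` {f x}"
  then have "(x, y) \<in> K" using K_if_q f[OF assms] by blast
  moreover have "(x, x) \<in> r" using r assms by (meson equiv_def refl_onD)
  ultimately show "y \<in> K `` (r `` {x})" by blast
qed

lemma Image_in_quotient:
  assumes "X \<in> N // r"
  shows "K `` X \<in> P // q"
proof -
  obtain x where x: "x \<in> N" "X = r `` {x}" using assms by (auto elim: quotientE)
  then have "f x \<in> P" using f K_subset by blast
  then show ?thesis unfolding x(2) Image_class[OF x(1)] by (rule quotientI)
qed

lemma converse_Image_Image:
  assumes "X \<in> N // r"
  shows "K\<inverse> `` (K `` X) = X"
proof -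
  interpret conv: class_correspondence P q N r "K\<inverse>" g f by (rule class_correspondence_converse)
  obtain x where x: "x \<in> N" "X = r `` {x}" using assms by (auto elim: quotientE)
  have "f x \<in> P" using f[OF x(1)] K_subset by blast
  then have "K\<inverse> `` (K `` X) = r `` {g (f x)}" using x Image_class conv.Image_class by simp
  moreover have "(g (f x), x) \<in> r" using r_if_K g[OF \<open>f x \<in> P\<close>] f[OF x(1)] by blast
  ultimately show ?thesis using equiv_class_eq[OF r] x(2) by simp
qed

lemma bij_betw_Image: "bij_betw ((``) K) (N // r) (P // q)"
proof -
  interpret conv: class_correspondence P q N r "K\<inverse>" g f by (rule class_correspondence_converse)
  show ?thesis
    using converse_Image_Image conv.converse_Image_Image Image_in_quotient conv.Image_in_quotient
    by (intro bij_betw_byWitness[where f' = "(``) (K\<inverse>)"]) auto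
qed

lemma homeomorphic_map_Image:
  assumes top: "topspace X = N" "topspace Y = P" and cont: "continuous_map X Y f" "continuous_map Y X g"
  shows "homeomorphic_map (quotient_topology X r) (quotient_topology Y q) ((``) K)"
proof -
  interpret conv: class_correspondence P q N r "K\<inverse>" g f by (rule class_correspondence_converse)
  have "homeomorphic_maps (quotient_topology X r) (quotient_topology Y q) ((``) K) ((``) (K\<inverse>))"
    unfolding homeomorphic_maps_def topspace_quotient_topology top
  proof (intro conjI ballI)
    show "continuous_map (quotient_topology X r) (quotient_topology Y q) ((``) K)"
      by (rule continuous_map_quotient[OF cont(1)]) (simp only: top Image_class)
    show "continuous_map (quotient_topology Y q) (quotient_topology X r) ((``) (K\<inverse>))"
      by (rule continuous_map_quotient[OF cont(2)]) (simp only: top conv.Image_class)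
    show "K\<inverse> `` (K `` Z) = Z" if "Z \<in> N // r" for Z using converse_Image_Image[OF that] .
    show "K `` (K\<inverse> `` Z) = Z" if "Z \<in> P // q" for Z using conv.converse_Image_Image[OF that] by simp
  qed
  then show ?thesis by (auto simp: homeomorphic_map_maps)
qed

end

text \<open>The relations \<open>c\<close> and \<open>c'\<close> stand for \<open>cong_t\<close> and
  \<open>cong_p\<close>: a bijection that carries one relation onto the other carries classes onto
  classes.\<close>

lemma image_relation_class:
  assumes "bij_betw h A B" "c \<subseteq> A \<times> A" "c' \<subseteq> B \<times> B"
    and "\<And>X Y. X \<in> A \<Longrightarrow> Y \<in> A \<Longrightarrow> (X, Y) \<in> c \<longleftrightarrow> (h X, h Y) \<in> c'" and "X \<in> A"
  shows "h ` (c `` {X}) = c' `` {h X}"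
proof (intro equalityI subsetI)
  fix Y assume "Y \<in> c' `` {h X}"
  then have Y: "(h X, Y) \<in> c'" "Y \<in> B" using assms(3) by auto
  then obtain Y' where "Y' \<in> A" "Y = h Y'" using assms(1) by (auto simp: bij_betw_def)
  then show "Y \<in> h ` (c `` {X})" using Y assms(4,5) by auto
qed (use assms in auto)

lemma bij_betw_image_quotient:
  assumes "bij_betw h A B" "c \<subseteq> A \<times> A" "c' \<subseteq> B \<times> B"
    and "\<And>X Y. X \<in> A \<Longrightarrow> Y \<in> A \<Longrightarrow> (X, Y) \<in> c \<longleftrightarrow> (h X, h Y) \<in> c'"
  shows "bij_betw ((`) h) (A // c) (B // c')"
  unfolding bij_betw_def
proof
  have "A // c \<subseteq> Pow A" using assms(2) by (auto simp: quotient_def)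
  moreover have "inj_on ((`) h) (Pow A)" using assms(1) by (simp add: bij_betw_def inj_on_image_Pow)
  ultimately show "inj_on ((`) h) (A // c)" by (rule inj_on_subset[rotated])
  have "(`) h ` (A // c) = (\<lambda>X. h ` (c `` {X})) ` A" by (auto simp: quotient_def)
  also have "\<dots> = (\<lambda>X. c' `` {h X}) ` A" using image_relation_class[OF assms] by simp
  also have "\<dots> = (\<lambda>Y. c' `` {Y}) ` B" using assms(1) by (auto simp: bij_betw_def)
  finally show "(`) h ` (A // c) = B // c'" by (auto simp: quotient_def)
qed

lemma homeomorphic_map_image_quotient:
  assumes hom: "homeomorphic_map S T h" and c: "c \<subseteq> topspace S \<times> topspace S" "c' \<subseteq> topspace T \<times> topspace T"
    and iff: "\<And>X Y. X \<in> topspace S \<Longrightarrow> Y \<in> topspace S \<Longrightarrow> (X, Y) \<in> c \<longleftrightarrow> (h X, h Y) \<in> c'"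
  shows "homeomorphic_map (quotient_topology S c) (quotient_topology T c') ((`) h)"
proof -
  obtain k where k: "homeomorphic_maps S T h k" using hom by (auto simp: homeomorphic_map_maps)
  then have cont: "continuous_map S T h" "continuous_map T S k"
    and inv: "\<And>x. x \<in> topspace S \<Longrightarrow> k (h x) = x" "\<And>y. y \<in> topspace T \<Longrightarrow> h (k y) = y"
    by (auto simp: homeomorphic_maps_def)
  have mem: "\<And>x. x \<in> topspace S \<Longrightarrow> h x \<in> topspace T" "\<And>y. y \<in> topspace T \<Longrightarrow> k y \<in> topspace S"
    using cont by (auto simp: continuous_map_def)
  have bij: "bij_betw h (topspace S) (topspace T)" "bij_betw k (topspace T) (topspace S)"
    using inv mem by (auto intro!: bij_betw_byWitness[where f' = k] bij_betw_byWitness[where f' = h])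
  have "homeomorphic_maps (quotient_topology S c) (quotient_topology T c') ((`) h) ((`) k)"
    unfolding homeomorphic_maps_def
  proof (intro conjI ballI)
    show "continuous_map (quotient_topology S c) (quotient_topology T c') ((`) h)"
      using image_relation_class[OF bij(1) c iff] by (intro continuous_map_quotient[OF cont(1)])
    have "(X, Y) \<in> c' \<longleftrightarrow> (k X, k Y) \<in> c" if "X \<in> topspace T" "Y \<in> topspace T" for X Y
      using iff[of "k X" "k Y"] inv mem that by simp
    from image_relation_class[OF bij(2) c(2,1) this]
    show "continuous_map (quotient_topology T c') (quotient_topology S c) ((`) k)"
      by (intro continuous_map_quotient[OF cont(2)])
  next
    fix X assume "X \<in> topspace (quotient_topology S c)"
    then have "X \<subseteq> topspace S" using c(1) by (auto simp: quotient_def)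
    then show "k ` h ` X = X" using inv(1) by (force simp: image_image)
  next
    fix Y assume "Y \<in> topspace (quotient_topology T c')"
    then have "Y \<subseteq> topspace T" using c(2) by (auto simp: quotient_def)
    then show "h ` k ` Y = Y" using inv(2) by (force simp: image_image)
  qed
  then show ?thesis by (auto simp: homeomorphic_map_maps)
qed

section \<open>Continuous functions into a topological hyperfield\<close>

context
  fixes T :: "'h::hyperfield topology"
  assumes T: "topological_hyperfield T"
begin

lemma topspace_hyperfield: "topspace T = UNIV"
  using T by (simp add: topological_hyperfield_def)

lemma continuous_hyper_const: "continuous_map X T (\<lambda>x. c)"
  by (simp add: topspace_hyperfield)

lemma continuous_hyper_mult:
  assumes "continuous_map X T f" "continuous_map X T g"
  shows "continuous_map X T (\<lambda>x. f x * g x)"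
proof -
  have "continuous_map (prod_topology T T) T (\<lambda>(x, y). x * y)"
    using T by (simp add: topological_hyperfield_def)
  from continuous_map_compose[OF continuous_map_pairedI[OF assms] this]
  show ?thesis by (simp add: o_def)
qed

text \<open>Negation is multiplication by -1, so its continuity comes from that of the
  product.\<close>

lemma continuous_hyper_uminus: "continuous_map X T f \<Longrightarrow> continuous_map X T (\<lambda>x. - f x)"
  using continuous_hyper_mult[OF continuous_hyper_const[of X "- 1"], of f] by simp

lemma continuous_hyper_inverse:
  assumes "continuous_map X T f" "\<And>x. x \<in> topspace X \<Longrightarrow> f x \<noteq> 0"
  shows "continuous_map X T (\<lambda>x. inverse (f x))"
proof -
  have "continuous_map X (subtopology T (- {0})) f"
    using assms by (auto simp: continuous_map_in_subtopology)
  moreover have "continuous_map (subtopology T (- {0})) T inverse"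
    using T continuous_map_into_fulltopology by (auto simp: topological_hyperfield_def)
  ultimately show ?thesis using continuous_map_compose by (force simp: o_def)
qed

lemma topspace_signature_topology: "topspace (signature_topology T F) = signatures F"
  by (simp add: signature_topology_def signatures_def topspace_hyperfield)

lemma continuous_map_signature:
  assumes "\<And>x. x \<in> topspace X \<Longrightarrow> S x \<in> signatures F"
    and "\<And>A e. A \<in> F \<Longrightarrow> e \<in> A \<Longrightarrow> continuous_map X T (\<lambda>x. S x A e)"
  shows "continuous_map X (signature_topology T F) S"
  unfolding signature_topology_def continuous_map_componentwise
proof (intro conjI ballI)
  show "S ` topspace X \<subseteq> extensional F"
    using assms(1) by (auto simp: signatures_def PiE_def)
  fix A assume A: "A \<in> F"
  show "(\<lambda>x. S x A) ` topspace X \<subseteq> extensional A"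
    using assms(1) A by (fastforce simp: signatures_def PiE_def)
  fix e assume e: "e \<in> A"
  show "continuous_map X (subtopology T (- {0})) (\<lambda>x. S x A e)"
    using assms(1) assms(2)[OF A e] A e
    by (intro continuous_map_into_subtopology) (fastforce simp: signatures_def PiE_def)+
qed

lemma continuous_map_signature_entry:
  assumes "A \<in> F" "e \<in> A"
  shows "continuous_map (signature_topology T F) T (\<lambda>\<sigma>. \<sigma> A e)"
proof -
  have "continuous_map (signature_topology T F) (product_topology (\<lambda>_. subtopology T (- {0})) A) (\<lambda>\<sigma>. \<sigma> A)"
    unfolding signature_topology_def by (rule continuous_map_product_projection[OF assms(1)])
  from continuous_map_compose[OF this continuous_map_product_projection[OF assms(2)]]
  show ?thesis by (auto simp: o_def intro: continuous_map_into_fulltopology)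
qed

end

section \<open>The correspondence\<close>

lemma sim_p_iff: "(\<phi>1, \<phi>2) \<in> sim_p s d M \<longleftrightarrow> \<phi>1 \<in> Np s d M \<and> \<phi>2 \<in> Np s d M \<and>
    (\<exists>a. a \<noteq> 0 \<and> (\<forall>xs\<in>nlists d (ground M). \<phi>1 xs = a * \<phi>2 xs))"
  by (auto simp: sim_p_def)

lemma equiv_sim_p: "equiv (Np s d M) (sim_p s d (M :: 'e pre_matroid) :: (('e list \<Rightarrow> 'h::hyperfield) \<times> _) set)"
proof (rule equivI)
  show "refl_on (Np s d M) (sim_p s d M :: (('e list \<Rightarrow> 'h) \<times> _) set)"
    by (rule refl_onI) (auto simp: sim_p_iff intro: exI[of _ 1])
  show "sym (sim_p s d M :: (('e list \<Rightarrow> 'h) \<times> _) set)"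
  proof (rule symI)
    fix \<phi>1 \<phi>2 :: "'e list \<Rightarrow> 'h" assume "(\<phi>1, \<phi>2) \<in> sim_p s d M"
    then obtain a where a: "\<phi>1 \<in> Np s d M" "\<phi>2 \<in> Np s d M" "a \<noteq> 0"
      "\<And>xs. xs \<in> nlists d (ground M) \<Longrightarrow> \<phi>1 xs = a * \<phi>2 xs" by (auto simp: sim_p_iff)
    then have "\<phi>2 xs = inverse a * \<phi>1 xs" if "xs \<in> nlists d (ground M)" for xs
      using that by (simp add: mult.assoc[symmetric] inverse_hyper_left)
    with a show "(\<phi>2, \<phi>1) \<in> sim_p s d M" unfolding sim_p_iff by (metis hyper_inverse_eq_0_iff)
  qed
  show "trans (sim_p s d M :: (('e list \<Rightarrow> 'h) \<times> _) set)"
  proof (rule transI)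
    fix \<phi>1 \<phi>2 \<phi>3 :: "'e list \<Rightarrow> 'h" assume "(\<phi>1, \<phi>2) \<in> sim_p s d M" "(\<phi>2, \<phi>3) \<in> sim_p s d M"
    then obtain a b where ab: "\<phi>1 \<in> Np s d M" "\<phi>3 \<in> Np s d M" "a \<noteq> 0" "b \<noteq> 0"
      "\<And>xs. xs \<in> nlists d (ground M) \<Longrightarrow> \<phi>1 xs = a * \<phi>2 xs"
      "\<And>xs. xs \<in> nlists d (ground M) \<Longrightarrow> \<phi>2 xs = b * \<phi>3 xs" by (auto simp: sim_p_iff)
    then have "\<phi>1 xs = (a * b) * \<phi>3 xs" if "xs \<in> nlists d (ground M)" for xs
      using that by (simp add: mult.assoc)
    with ab show "(\<phi>1, \<phi>3) \<in> sim_p s d M" unfolding sim_p_iff by (metis hyper_mult_eq_0_iff)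
  qed
qed (auto simp: sim_p_iff)

lemma sim_t_iff: "((\<gamma>1, \<delta>1), (\<gamma>2, \<delta>2)) \<in> sim_t s \<tau> M \<longleftrightarrow>
    (\<gamma>1, \<delta>1) \<in> Nt s \<tau> M \<and> (\<gamma>2, \<delta>2) \<in> Nt s \<tau> M \<and>
    (\<exists>b. \<forall>C\<in>circuits M. b C \<noteq> 0 \<and> (\<forall>x\<in>C. \<gamma>1 C x = b C * \<gamma>2 C x)) \<and>
    (\<exists>l. \<forall>D\<in>cocircuits M. l D \<noteq> 0 \<and> (\<forall>y\<in>D. \<delta>1 D y = l D * \<delta>2 D y))"
  by (auto simp: sim_t_def)

lemma rescaling_refl: "\<exists>b. \<forall>C\<in>F. b C \<noteq> 0 \<and> (\<forall>x\<in>C. \<sigma> C x = b C * (\<sigma> C x :: 'h::hyperfield))"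
  by (rule exI[of _ "\<lambda>_. 1"]) simp

lemma rescaling_sym:
  fixes \<sigma>1 \<sigma>2 :: "'e set \<Rightarrow> 'e \<Rightarrow> 'h::hyperfield"
  assumes "\<exists>b. \<forall>C\<in>F. b C \<noteq> 0 \<and> (\<forall>x\<in>C. \<sigma>1 C x = b C * \<sigma>2 C x)"
  shows "\<exists>b. \<forall>C\<in>F. b C \<noteq> 0 \<and> (\<forall>x\<in>C. \<sigma>2 C x = b C * \<sigma>1 C x)"
proof -
  obtain b where b: "\<forall>C\<in>F. b C \<noteq> 0 \<and> (\<forall>x\<in>C. \<sigma>1 C x = b C * \<sigma>2 C x)" using assms by blast
  then show ?thesis
    by (intro exI[of _ "\<lambda>C. inverse (b C)"]) (simp add: mult.assoc[symmetric] inverse_hyper_left)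
qed

lemma rescaling_trans:
  fixes \<sigma>1 \<sigma>2 \<sigma>3 :: "'e set \<Rightarrow> 'e \<Rightarrow> 'h::hyperfield"
  assumes "\<exists>b. \<forall>C\<in>F. b C \<noteq> 0 \<and> (\<forall>x\<in>C. \<sigma>1 C x = b C * \<sigma>2 C x)"
    and "\<exists>b. \<forall>C\<in>F. b C \<noteq> 0 \<and> (\<forall>x\<in>C. \<sigma>2 C x = b C * \<sigma>3 C x)"
  shows "\<exists>b. \<forall>C\<in>F. b C \<noteq> 0 \<and> (\<forall>x\<in>C. \<sigma>1 C x = b C * \<sigma>3 C x)"
proof -
  obtain b b' where "\<forall>C\<in>F. b C \<noteq> 0 \<and> (\<forall>x\<in>C. \<sigma>1 C x = b C * \<sigma>2 C x)"
    "\<forall>C\<in>F. b' C \<noteq> 0 \<and> (\<forall>x\<in>C. \<sigma>2 C x = b' C * \<sigma>3 C x)" using assms by blast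
  then show ?thesis by (intro exI[of _ "\<lambda>C. b C * b' C"]) (simp add: mult.assoc)
qed

lemma equiv_sim_t: "equiv (Nt s \<tau> M) (sim_t s \<tau> M)"
proof (rule equivI)
  show "refl_on (Nt s \<tau> M) (sim_t s \<tau> M)"
    by (rule refl_onI) (auto simp: sim_t_iff rescaling_refl)
  show "sym (sim_t s \<tau> M)"
  proof (rule symI)
    fix P Q assume "(P, Q) \<in> sim_t s \<tau> M"
    then show "(Q, P) \<in> sim_t s \<tau> M"
      by (cases P; cases Q) (simp add: sim_t_iff rescaling_sym)
  qed
  show "trans (sim_t s \<tau> M)"
  proof (rule transI)
    fix P Q R assume PQ: "(P, Q) \<in> sim_t s \<tau> M" and QR: "(Q, R) \<in> sim_t s \<tau> M"
    obtain \<gamma>1 \<delta>1 \<gamma>2 \<delta>2 \<gamma>3 \<delta>3 where eqs: "P = (\<gamma>1, \<delta>1)" "Q = (\<gamma>2, \<delta>2)" "R = (\<gamma>3, \<delta>3)"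
      by (cases P; cases Q; cases R)
    show "(P, R) \<in> sim_t s \<tau> M"
      using PQ QR unfolding eqs sim_t_iff
      by (elim conjE, intro conjI) (assumption | erule (1) rescaling_trans)+
  qed
qed (auto simp: sim_t_def)

context matroid_involution
begin

definition correspondence :: "strength \<Rightarrow>
    ((('e, 'h) signature \<times> ('e, 'h) signature) \<times> ('e list \<Rightarrow> 'h)) set"
  where "correspondence s = {((\<gamma>, \<delta>), \<phi>). (\<gamma>, \<delta>) \<in> Nt s \<tau> M \<and> \<phi> \<in> Np s rk M \<and> compatible \<gamma> \<delta> \<phi>}"

lemma correspondence_iff: "((\<gamma>, \<delta>), \<phi>) \<in> correspondence s \<longleftrightarrow>
    (\<gamma>, \<delta>) \<in> Nt s \<tau> M \<and> \<phi> \<in> Np s rk M \<and> compatible \<gamma> \<delta> \<phi>"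
  by (simp add: correspondence_def)

definition signatures_of :: "('e list \<Rightarrow> 'h) \<Rightarrow> ('e, 'h) signature \<times> ('e, 'h) signature"
  where "signatures_of \<phi> = (circuit_signature \<phi>, cocircuit_signature \<phi>)"

definition base_list :: "'e list"
  where "base_list = (SOME xs. basis_list xs)"

text \<open>The normalisation at \<open>base_list\<close> makes the choice of \<open>\<phi>\<close> continuous.\<close>

definition function_of :: "strength \<Rightarrow> ('e, 'h) signature \<times> ('e, 'h) signature \<Rightarrow> 'e list \<Rightarrow> 'h"
  where "function_of s P = (SOME \<phi>. (P, \<phi>) \<in> correspondence s \<and> \<phi> base_list = 1)"

lemma basis_list_base_list: "basis_list base_list"
  unfolding base_list_def
proof (rule someI_ex)
  obtain B where "B \<in> bases M" using bases_nonempty by blast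
  then show "\<exists>xs. basis_list xs" using ex_basis_list by blast
qed

text \<open>The relations for \<open>\<phi>'\<close> are not checked by scaling them; they are
  inherited from the orthogonality of the new pair.\<close>

lemma correspondence_transform:
  assumes K: "((\<gamma>, \<delta>), \<phi>) \<in> correspondence s" and "a \<noteq> 0" and h: "\<And>e. e \<in> ground M \<Longrightarrow> h e \<noteq> 0"
    and N: "(\<gamma>', \<delta>') \<in> Nt s \<tau> M"
    and \<gamma>: "\<And>C x. C \<in> circuits M \<Longrightarrow> x \<in> C \<Longrightarrow> \<gamma>' C x = b C * (h x * \<gamma> C x)"
    and \<delta>: "\<And>D x. D \<in> cocircuits M \<Longrightarrow> x \<in> D \<Longrightarrow> \<delta>' D x = l D * (\<tau> (inverse (h x)) * \<delta> D x)"
    and ext: "\<phi>' \<in> extensional (rank_tuples)"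
    and \<phi>: "\<And>xs. xs \<in> rank_tuples \<Longrightarrow>
      \<phi>' xs = a * (prod_list (map (\<lambda>e. inverse (h e)) xs) * \<phi> xs)"
  shows "((\<gamma>', \<delta>'), \<phi>') \<in> correspondence s"
proof -
  have comp: "compatible \<gamma>' \<delta>' \<phi>'"
    using K compatible_transform[OF _ h \<gamma> \<delta> \<phi>] by (simp add: correspondence_iff)
  have "basis_function \<phi>'"
    using K Np_basis_function h \<open>a \<noteq> 0\<close>
    by (intro basis_function_scale[OF _ \<open>a \<noteq> 0\<close> _ \<phi>]) (auto simp: correspondence_iff)
  then show ?thesis using comp N Np_if_Nt[OF comp N ext] by (simp add: correspondence_iff)
qed

lemma correspondence_rescale_function:
  assumes K: "(P, \<phi>) \<in> correspondence s" and "a \<noteq> 0"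
    and ext: "\<phi>' \<in> extensional (rank_tuples)"
    and \<phi>: "\<And>xs. xs \<in> rank_tuples \<Longrightarrow> \<phi>' xs = a * \<phi> xs"
  shows "(P, \<phi>') \<in> correspondence s"
proof -
  obtain \<gamma> \<delta> where P: "P = (\<gamma>, \<delta>)" by (cases P)
  show ?thesis
    unfolding P
  proof (rule correspondence_transform[where h = "\<lambda>_. 1" and b = "\<lambda>_. 1" and l = "\<lambda>_. 1"])
    show "((\<gamma>, \<delta>), \<phi>) \<in> correspondence s" using K by (simp only: P)
    then show "(\<gamma>, \<delta>) \<in> Nt s \<tau> M" by (simp only: correspondence_iff)
    show "\<phi>' xs = a * (prod_list (map (\<lambda>e. inverse 1) xs) * \<phi> xs)"
      if "xs \<in> rank_tuples" for xs
      using \<phi>[OF that] by (simp add: prod_list_map_1)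
  qed (use \<open>a \<noteq> 0\<close> ext in simp_all)
qed

lemma function_of:
  assumes "P \<in> Nt s \<tau> M"
  shows "(P, function_of s P) \<in> correspondence s" "function_of s P base_list = 1"
proof -
  obtain \<gamma> \<delta> where P: "P = (\<gamma>, \<delta>)" by (cases P)
  obtain \<phi> where \<phi>: "(P, \<phi>) \<in> correspondence s"
    using exists_compatible assms unfolding P correspondence_iff by blast
  have nz: "\<phi> base_list \<noteq> 0"
    using \<phi> basis_function_nonzero[OF Np_basis_function basis_list_base_list] by (auto simp: P correspondence_iff)
  let ?\<phi> = "\<lambda>xs\<in>rank_tuples. inverse (\<phi> base_list) * \<phi> xs"
  have "(P, ?\<phi>) \<in> correspondence s"
    using nz by (intro correspondence_rescale_function[OF \<phi>, of "inverse (\<phi> base_list)"]) auto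
  moreover have "?\<phi> base_list = 1"
    using nz basis_list_nlists[OF basis_list_base_list] by (simp add: inverse_hyper_left)
  ultimately have "\<exists>\<phi>. (P, \<phi>) \<in> correspondence s \<and> \<phi> base_list = 1" by blast
  from someI_ex[OF this] show "(P, function_of s P) \<in> correspondence s" "function_of s P base_list = 1"
    unfolding function_of_def by auto
qed

lemma signatures_of:
  assumes "\<phi> \<in> Np s rk M"
  shows "(signatures_of \<phi>, \<phi>) \<in> correspondence s"
  using assms compatible_signatures[OF assms] Np_basis_function[OF assms]
    Nt_if_Np[OF compatible_signatures[OF assms] assms] circuit_signature_in cocircuit_signature_in
  by (simp add: signatures_of_def correspondence_iff)

lemma class_correspondence: "class_correspondence (Nt s \<tau> M) (sim_t s \<tau> M)
    (Np s rk M) (sim_p s rk M) (correspondence s) (function_of s) signatures_of"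
proof
  show "equiv (Nt s \<tau> M) (sim_t s \<tau> M)" by (rule equiv_sim_t)
  show "equiv (Np s rk M) (sim_p s rk M :: (('e list \<Rightarrow> 'h) \<times> _) set)"
    by (rule equiv_sim_p)
  show "correspondence s \<subseteq> Nt s \<tau> M \<times> Np s rk M"
    by (auto simp: correspondence_def)
  show "(P, function_of s P) \<in> correspondence s" if "P \<in> Nt s \<tau> M" for P
    using function_of that by blast
  show "(signatures_of \<phi>, \<phi>) \<in> correspondence s" if "\<phi> \<in> Np s rk M" for \<phi>
    using signatures_of that by blast
next
  fix P P' \<phi> assume K: "(P, \<phi>) \<in> correspondence s" "(P', \<phi>) \<in> correspondence s"
  obtain \<gamma> \<delta> \<gamma>' \<delta>' where P: "P = (\<gamma>, \<delta>)" "P' = (\<gamma>', \<delta>')" by (cases P; cases P')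
  have N: "(\<gamma>, \<delta>) \<in> Nt s \<tau> M" "(\<gamma>', \<delta>') \<in> Nt s \<tau> M" "\<phi> \<in> Np s rk M"
    and comp: "compatible \<gamma> \<delta> \<phi>" "compatible \<gamma>' \<delta>' \<phi>"
    using K by (simp_all only: P correspondence_iff)
  have "\<gamma> \<in> signatures (circuits M)" "\<delta> \<in> signatures (cocircuits M)"
    "\<gamma>' \<in> signatures (circuits M)" "\<delta>' \<in> signatures (cocircuits M)"
    using N(1,2) by (simp_all only: Nt_iff)
  from compatible_unique_signatures[OF comp Np_basis_function[OF N(3)] this]
  show "(P, P') \<in> sim_t s \<tau> M" unfolding P sim_t_iff using N(1,2) by blast
next
  fix P P' \<phi> assume PP': "(P, P') \<in> sim_t s \<tau> M" and K: "(P, \<phi>) \<in> correspondence s"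
  obtain \<gamma> \<delta> \<gamma>' \<delta>' where P: "P = (\<gamma>, \<delta>)" "P' = (\<gamma>', \<delta>')" by (cases P; cases P')
  have "(P', P) \<in> sim_t s \<tau> M" using PP' equiv_sim_t by (meson equiv_def symD)
  then obtain b l where "(\<gamma>', \<delta>') \<in> Nt s \<tau> M"
    "\<forall>C\<in>circuits M. b C \<noteq> 0 \<and> (\<forall>x\<in>C. \<gamma>' C x = b C * \<gamma> C x)"
    "\<forall>D\<in>cocircuits M. l D \<noteq> 0 \<and> (\<forall>x\<in>D. \<delta>' D x = l D * \<delta> D x)"
    unfolding P sim_t_iff by (elim conjE exE)
  then have bl: "(\<gamma>', \<delta>') \<in> Nt s \<tau> M"
    "\<And>C x. C \<in> circuits M \<Longrightarrow> x \<in> C \<Longrightarrow> \<gamma>' C x = b C * \<gamma> C x"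
    "\<And>D x. D \<in> cocircuits M \<Longrightarrow> x \<in> D \<Longrightarrow> \<delta>' D x = l D * \<delta> D x"
    by simp_all
  show "(P', \<phi>) \<in> correspondence s"
    unfolding P
  proof (rule correspondence_transform[where h = "\<lambda>_. 1" and a = 1])
    show K': "((\<gamma>, \<delta>), \<phi>) \<in> correspondence s" using K by (simp only: P)
    show "\<phi> \<in> extensional (rank_tuples)"
      using K' unfolding correspondence_iff Np_iff by blast
    show "\<gamma>' C x = b C * (1 * \<gamma> C x)" if "C \<in> circuits M" "x \<in> C" for C x
      using bl(2)[OF that] by simp
    show "\<delta>' D x = l D * (\<tau> (inverse 1) * \<delta> D x)" if "D \<in> cocircuits M" "x \<in> D" for D x
      using bl(3)[OF that] by simp
  qed (use bl(1) in \<open>simp_all add: prod_list_map_1\<close>)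
next
  fix P \<phi> \<phi>' assume K: "(P, \<phi>) \<in> correspondence s" "(P, \<phi>') \<in> correspondence s"
  obtain \<gamma> \<delta> where P: "P = (\<gamma>, \<delta>)" by (cases P)
  have N: "(\<gamma>, \<delta>) \<in> Nt s \<tau> M" "\<phi> \<in> Np s rk M" "\<phi>' \<in> Np s rk M"
    and comp: "compatible \<gamma> \<delta> \<phi>" "compatible \<gamma> \<delta> \<phi>'"
    using K by (simp_all only: P correspondence_iff)
  have "\<delta> \<in> signatures (cocircuits M)" using N(1) by (simp only: Nt_iff)
  from compatible_unique_function[OF comp Np_basis_function[OF N(2)] Np_basis_function[OF N(3)] this]
  show "(\<phi>, \<phi>') \<in> sim_p s rk M" unfolding sim_p_iff using N(2,3) by blast
next
  fix P \<phi> \<phi>' assume sim: "(\<phi>, \<phi>') \<in> sim_p s rk M" and K: "(P, \<phi>) \<in> correspondence s"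
  have "(\<phi>', \<phi>) \<in> sim_p s rk M" using sim equiv_sim_p by (meson equiv_def symD)
  then obtain a where "a \<noteq> 0" "\<phi>' \<in> Np s rk M"
    "\<And>xs. xs \<in> rank_tuples \<Longrightarrow> \<phi>' xs = a * \<phi> xs"
    unfolding sim_p_iff by blast
  then show "(P, \<phi>') \<in> correspondence s"
    by (intro correspondence_rescale_function[OF K]) (auto simp: Np_iff)
qed

text \<open>The inverse of \<open>h\<close> scales \<open>\<psi>\<close>, by the cancellation in
  \<open>compatible_transform\<close>. The result corresponds to \<open>P\<close> but may differ
  from \<open>\<phi>\<close> by a scalar, hence the existential.\<close>

lemma approx_p_if_approx_t:
  assumes K: "(P, \<phi>) \<in> correspondence s" "(Q, \<psi>) \<in> correspondence s" and PQ: "approx_t \<tau> M P Q"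
  shows "\<exists>\<phi>'. (P, \<phi>') \<in> correspondence s \<and> approx_p rk M \<phi>' \<psi>"
proof -
  obtain \<gamma>1 \<delta>1 \<gamma>2 \<delta>2 where P: "P = (\<gamma>1, \<delta>1)" "Q = (\<gamma>2, \<delta>2)" by (cases P; cases Q)
  obtain h where "\<forall>e\<in>ground M. h e \<noteq> 0"
    "\<forall>C\<in>circuits M. \<forall>x\<in>C. \<gamma>1 C x = h x * \<gamma>2 C x"
    "\<forall>D\<in>cocircuits M. \<forall>y\<in>D. \<delta>1 D y = \<tau> (inverse (h y)) * \<delta>2 D y"
    using PQ unfolding approx_t_def P prod.case by (elim conjE exE)
  then have h: "\<And>e. e \<in> ground M \<Longrightarrow> h e \<noteq> 0"
    "\<And>C x. C \<in> circuits M \<Longrightarrow> x \<in> C \<Longrightarrow> \<gamma>1 C x = h x * \<gamma>2 C x"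
    "\<And>D y. D \<in> cocircuits M \<Longrightarrow> y \<in> D \<Longrightarrow> \<delta>1 D y = \<tau> (inverse (h y)) * \<delta>2 D y"
    by simp_all
  let ?\<phi> = "\<lambda>xs\<in>rank_tuples. prod_list (map (\<lambda>e. inverse (h e)) xs) * \<psi> xs"
  have "(P, ?\<phi>) \<in> correspondence s"
    unfolding P
  proof (rule correspondence_transform[where h = h and a = 1 and b = "\<lambda>_. 1" and l = "\<lambda>_. 1"])
    show "((\<gamma>2, \<delta>2), \<psi>) \<in> correspondence s" using K(2) by (simp only: P)
    show "(\<gamma>1, \<delta>1) \<in> Nt s \<tau> M" using K(1) by (simp only: P correspondence_iff)
  qed (use h in simp_all)
  moreover have "approx_p rk M ?\<phi> \<psi>"
    unfolding approx_p_def using h(1) by (intro exI[of _ "\<lambda>e. inverse (h e)"]) simp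
  ultimately show ?thesis by blast
qed

text \<open>The pair of \<open>Q\<close> is scaled by the inverse of \<open>h\<close>, so that its
  cocircuit part acquires the factor \<open>\<tau> (h x)\<close>.\<close>

lemma approx_t_if_approx_p:
  assumes K: "(P, \<phi>) \<in> correspondence s" "(Q, \<psi>) \<in> correspondence s"
    and approx: "approx_p rk M \<phi> \<psi>"
  shows "\<exists>P'. (P', \<phi>) \<in> correspondence s \<and> approx_t \<tau> M P' Q"
proof -
  obtain \<gamma> \<delta> where Q: "Q = (\<gamma>, \<delta>)" by (cases Q)
  obtain h where "\<forall>e\<in>ground M. h e \<noteq> 0"
    "\<forall>xs\<in>rank_tuples. \<phi> xs = prod_list (map h xs) * \<psi> xs"
    using approx unfolding approx_p_def by (elim conjE exE)
  then have h: "\<And>e. e \<in> ground M \<Longrightarrow> h e \<noteq> 0"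
    "\<And>xs. xs \<in> rank_tuples \<Longrightarrow> \<phi> xs = prod_list (map h xs) * \<psi> xs"
    by simp_all
  define \<gamma>' where "\<gamma>' = (\<lambda>C\<in>circuits M. \<lambda>x\<in>C. inverse (h x) * \<gamma> C x)"
  define \<delta>' where "\<delta>' = (\<lambda>D\<in>cocircuits M. \<lambda>x\<in>D. \<tau> (h x) * \<delta> D x)"
  have \<gamma>: "\<gamma> \<in> signatures (circuits M)" and \<delta>: "\<delta> \<in> signatures (cocircuits M)"
    using K(2) by (simp_all add: Q correspondence_iff Nt_iff)
  have hC: "h x \<noteq> 0" if "C \<in> circuits M" "x \<in> C" for C x using h(1) circuitD(1)[OF that(1)] that(2) by blast
  have hD: "h x \<noteq> 0" if "D \<in> cocircuits M" "x \<in> D" for D x using h(1) cocircuit_subset[OF that(1)] that(2) by blast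
  have \<gamma>'_in: "\<gamma>' \<in> signatures (circuits M)"
    unfolding signatures_def \<gamma>'_def
    using hC signature_nonzero[OF \<gamma>] by (intro restrict_PiE_iff[THEN iffD2] ballI) auto
  have \<delta>'_in: "\<delta>' \<in> signatures (cocircuits M)"
    unfolding signatures_def \<delta>'_def
    using hD signature_nonzero[OF \<delta>] by (intro restrict_PiE_iff[THEN iffD2] ballI) auto
  have \<phi>: "\<phi> \<in> Np s rk M" using K(1) by (cases P) (simp add: correspondence_iff)
  have "compatible \<gamma>' \<delta>' \<phi>"
  proof (rule compatible_transform[where h = "\<lambda>e. inverse (h e)" and a = 1 and b = "\<lambda>_. 1" and l = "\<lambda>_. 1"])
    show "compatible \<gamma> \<delta> \<psi>" using K(2) by (simp only: Q correspondence_iff)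
  qed (use h in \<open>simp_all add: \<gamma>'_def \<delta>'_def\<close>)
  then have "((\<gamma>', \<delta>'), \<phi>) \<in> correspondence s"
    using Nt_if_Np \<phi> \<gamma>'_in \<delta>'_in by (simp add: correspondence_iff)
  moreover have "approx_t \<tau> M (\<gamma>', \<delta>') Q"
    unfolding approx_t_def Q prod.case using h(1)
    by (intro exI[of _ "\<lambda>e. inverse (h e)"]) (auto simp: \<gamma>'_def \<delta>'_def)
  ultimately show ?thesis by blast
qed

lemma cong_iff:
  assumes X: "X \<in> Mt s \<tau> M" and Y: "Y \<in> Mt s \<tau> M"
  shows "(X, Y) \<in> cong_t s \<tau> M \<longleftrightarrow>
    (correspondence s `` X, correspondence s `` Y) \<in> cong_p s rk M"
proof -
  interpret class_correspondence "Nt s \<tau> M" "sim_t s \<tau> M" "Np s rk M"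
    "sim_p s rk M" "correspondence s" "function_of s" signatures_of
    by (rule class_correspondence)
  have XY: "X \<in> Nt s \<tau> M // sim_t s \<tau> M" "Y \<in> Nt s \<tau> M // sim_t s \<tau> M"
    using X Y by (simp_all add: Mt_def)
  then have images: "correspondence s `` X \<in> Mp s rk M" "correspondence s `` Y \<in> Mp s rk M"
    using Image_in_quotient by (simp_all add: Mp_def)
  have ex: "\<exists>\<phi>. (P, \<phi>) \<in> correspondence s" if "P \<in> X \<or> P \<in> Y" for P
    using that XY in_quotient_imp_subset[OF equiv_sim_t] f by blast
  have "(\<exists>P\<in>X. \<exists>Q\<in>Y. approx_t \<tau> M P Q) \<longleftrightarrow>
      (\<exists>\<phi>\<in>correspondence s `` X. \<exists>\<psi>\<in>correspondence s `` Y. approx_p rk M \<phi> \<psi>)"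
  proof
    assume "\<exists>P\<in>X. \<exists>Q\<in>Y. approx_t \<tau> M P Q"
    then obtain P Q where PQ: "P \<in> X" "Q \<in> Y" "approx_t \<tau> M P Q" by blast
    obtain \<phi> \<psi> where "(P, \<phi>) \<in> correspondence s" "(Q, \<psi>) \<in> correspondence s"
      using ex PQ(1,2) by blast
    with approx_p_if_approx_t[OF this PQ(3)] PQ(1,2)
    show "\<exists>\<phi>\<in>correspondence s `` X. \<exists>\<psi>\<in>correspondence s `` Y. approx_p rk M \<phi> \<psi>" by blast
  next
    assume "\<exists>\<phi>\<in>correspondence s `` X. \<exists>\<psi>\<in>correspondence s `` Y. approx_p rk M \<phi> \<psi>"
    then obtain P Q \<phi> \<psi> where PQ: "P \<in> X" "Q \<in> Y"
      and K: "(P, \<phi>) \<in> correspondence s" "(Q, \<psi>) \<in> correspondence s"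
      and approx: "approx_p rk M \<phi> \<psi>" by blast
    obtain P' where P': "(P', \<phi>) \<in> correspondence s" "approx_t \<tau> M P' Q"
      using approx_t_if_approx_p[OF K approx] by blast
    \<comment> \<open>\<open>P\<close> and \<open>P'\<close> correspond to the same
      \<open>\<phi>\<close>, so they lie in one class.\<close>
    then have "P' \<in> X"
      using in_quotient_imp_closed[OF equiv_sim_t XY(1) PQ(1)] r_if_K[OF K(1)] by blast
    with P' PQ show "\<exists>P\<in>X. \<exists>Q\<in>Y. approx_t \<tau> M P Q" by blast
  qed
  then show ?thesis using X Y images by (simp add: cong_t_def cong_p_def)
qed

section \<open>Continuity of the chosen representatives\<close>

context
  fixes T :: "'h topology"
  assumes T: "topological_hyperfield T" and cont_\<tau>: "continuous_map T T \<tau>"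
begin

lemma topspace_Np_topology: "topspace (Np_topology T s rk M) = Np s rk M"
  using topspace_hyperfield[OF T] by (auto simp: Np_topology_def Np_iff PiE_def)

lemma topspace_Nt_topology: "topspace (Nt_topology T s \<tau> M) = Nt s \<tau> M"
  by (auto simp: Nt_topology_def Nt_iff topspace_signature_topology[OF T])

lemma continuous_map_involution: "continuous_map X T f \<Longrightarrow> continuous_map X T (\<lambda>x. \<tau> (f x))"
  using continuous_map_compose[OF _ cont_\<tau>] by (simp add: o_def)

lemma continuous_map_Np_value:
  assumes "xs \<in> rank_tuples"
  shows "continuous_map (Np_topology T s rk M) T (\<lambda>\<phi>. \<phi> xs)"
  unfolding Np_topology_def
  by (intro continuous_map_from_subtopology continuous_map_product_projection[OF assms])

lemma continuous_map_signatures_of: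
  "continuous_map (Np_topology T s rk M) (Nt_topology T s \<tau> M) signatures_of"
proof -
  let ?X = "Np_topology T s rk M"
  have bf: "basis_function \<phi>" if "\<phi> \<in> topspace ?X" for \<phi>
    using that Np_basis_function unfolding topspace_Np_topology by blast
  have "continuous_map ?X (signature_topology T (circuits M)) circuit_signature"
  proof (rule continuous_map_signature[OF T])
    fix C x assume C: "C \<in> circuits M" and x: "x \<in> C"
    let ?k = "entry_index (circuit_list C) x"
    have "continuous_map ?X T
        (\<lambda>\<phi>. (-1) ^ ?k * \<phi> (take (?k - 1) (circuit_list C) @ drop ?k (circuit_list C)))"
      by (intro continuous_hyper_mult[OF T] continuous_hyper_const[OF T] continuous_map_Np_value
          basis_list_nlists circuit_list_deleted C x)
    with C x show "continuous_map ?X T (\<lambda>\<phi>. circuit_signature \<phi> C x)"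
      by (simp add: circuit_signature_def deleted_value_def)
  qed (use bf circuit_signature_in in blast)
  moreover have "continuous_map ?X (signature_topology T (cocircuits M)) cocircuit_signature"
  proof (rule continuous_map_signature[OF T])
    fix D x assume D: "D \<in> cocircuits M" and x: "x \<in> D"
    then have "x # cocircuit_list D \<in> rank_tuples"
      using cocircuit_list basis_list_nlists by blast
    then show "continuous_map ?X T (\<lambda>\<phi>. cocircuit_signature \<phi> D x)"
      using D x by (simp add: cocircuit_signature_def continuous_map_involution continuous_map_Np_value)
  qed (use bf cocircuit_signature_in in blast)
  moreover have "signatures_of \<phi> \<in> Nt s \<tau> M" if "\<phi> \<in> topspace ?X" for \<phi>
    using signatures_of that unfolding topspace_Np_topology by (fastforce simp: correspondence_def)
  ultimately show ?thesis
    unfolding Nt_topology_def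
    by (intro continuous_map_into_subtopology) (auto simp: signatures_of_def[abs_def] continuous_map_paired)
qed

lemma continuous_map_cocircuit_value:
  assumes "D \<in> cocircuits M" "x \<in> D"
  shows "continuous_map (Nt_topology T s \<tau> M) T (\<lambda>P. \<tau> (snd P D x))"
proof (rule continuous_map_involution)
  have "continuous_map (Nt_topology T s \<tau> M) (signature_topology T (cocircuits M)) snd"
    unfolding Nt_topology_def by (intro continuous_map_from_subtopology continuous_map_snd)
  from continuous_map_compose[OF this continuous_map_signature_entry[OF T assms]]
  show "continuous_map (Nt_topology T s \<tau> M) T (\<lambda>P. snd P D x)" by (simp add: o_def)
qed

text \<open>Although the function is selected by \<open>SOME\<close>, its value is 1 at
  \<open>base_list\<close>, and compatibility forces all others: a swap negates, and an exchange
  multiplies by a quotient of entries of \<open>\<tau> (\<delta> D _)\<close>. Continuity thus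
  propagates along the basis graph.\<close>

lemma continuous_map_function_of:
  "continuous_map (Nt_topology T s \<tau> M) (Np_topology T s rk M) (function_of s)"
proof -
  let ?X = "Nt_topology T s \<tau> M"
  have K: "(P, function_of s P) \<in> correspondence s" "function_of s P base_list = 1" if "P \<in> topspace ?X" for P
    using function_of that unfolding topspace_Nt_topology by blast+
  have Np: "function_of s P \<in> Np s rk M" if "P \<in> topspace ?X" for P
    using K(1)[OF that] by (cases P) (simp add: correspondence_iff)
  have basis: "continuous_map ?X T (\<lambda>P. function_of s P xs)" if "basis_list xs" for xs
    using basis_list_base_list that
  proof (rule basis_list_induct)
    show "continuous_map ?X T (\<lambda>P. function_of s P base_list)"
      using K(2) by (intro continuous_map_eq[OF continuous_hyper_const[OF T, of ?X 1]]) simp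
  next
    fix A x y B
    assume b: "basis_list (A @ x # y # B)"
      and cont: "continuous_map ?X T (\<lambda>P. function_of s P (A @ x # y # B))"
    show "continuous_map ?X T (\<lambda>P. function_of s P (A @ y # x # B))"
      by (rule continuous_map_eq[OF continuous_hyper_uminus[OF T cont]])
        (simp only: basis_function_swap[OF Np_basis_function[OF Np] b])
  next
    fix x y zs
    assume b: "basis_list (x # zs)" "basis_list (y # zs)"
      and cont: "continuous_map ?X T (\<lambda>P. function_of s P (x # zs))"
    define D where "D = fund_cocircuit (set zs)"
    have D: "D \<in> cocircuits M" "x \<in> D" "y \<in> D" "set zs \<inter> D = {}"
      using fund_cocircuit[of x "set zs"] fund_cocircuit[of y "set zs"] b
      by (auto simp: D_def basis_list_def)
    have nz: "\<tau> (snd P D x) \<noteq> 0" if "P \<in> topspace ?X" for P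
      using that D(1,2) signature_nonzero[of "snd P" "cocircuits M" D x] unfolding topspace_Nt_topology
      by (cases P) (simp add: Nt_iff)
    have "function_of s P (x # zs) * \<tau> (snd P D y) * inverse (\<tau> (snd P D x)) = function_of s P (y # zs)"
      if "P \<in> topspace ?X" for P
    proof -
      have "compatible (fst P) (snd P) (function_of s P)"
        using K(1)[OF that] by (cases P) (simp add: correspondence_iff)
      from compatible_cocircuit[OF this D b(1)] show ?thesis
        using hyper_inverse_right[OF nz[OF that]] by (simp add: mult.assoc)
    qed
    moreover have "continuous_map ?X T (\<lambda>P. function_of s P (x # zs) * \<tau> (snd P D y) * inverse (\<tau> (snd P D x)))"
      using nz D by (intro continuous_hyper_mult[OF T] continuous_hyper_inverse[OF T] cont
          continuous_map_cocircuit_value) auto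
    ultimately show "continuous_map ?X T (\<lambda>P. function_of s P (y # zs))" by (rule continuous_map_eq[rotated])
  qed
  have "continuous_map ?X T (\<lambda>P. function_of s P xs)" if xs: "xs \<in> rank_tuples" for xs
  proof (cases "basis_list xs")
    case False
    then show ?thesis
      using basis_function_eq_0[OF Np_basis_function[OF Np] xs False]
      by (intro continuous_map_eq[OF continuous_hyper_const[OF T, of ?X 0]]) simp
  qed (rule basis)
  then show ?thesis
    unfolding Np_topology_def using Np
    by (intro continuous_map_into_subtopology) (auto simp: continuous_map_componentwise Np_iff)
qed

end

end

theorem proposition2p15:
  fixes M :: "'e pre_matroid" and d :: nat and \<tau> :: "'h::hyperfield \<Rightarrow> 'h" and s :: strength
  assumes "matroid M" and "matroid_rank M = d" and "hyperfield_involution \<tau>"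
  shows "\<exists>\<Upsilon> \<Upsilon>'.
    bij_betw \<Upsilon> (Mt s \<tau> M) (Mp s d M) \<and>
    bij_betw \<Upsilon>' (Rt s \<tau> M) (Rp s d M) \<and>
    (\<forall>X\<in>Mt s \<tau> M. \<Upsilon>' (cong_t s \<tau> M `` {X}) = cong_p s d M `` {\<Upsilon> X}) \<and>
    (\<forall>T. topological_hyperfield T \<and> continuous_map T T \<tau> \<longrightarrow>
      homeomorphic_map (Mt_topology T s \<tau> M) (Mp_topology T s d M) \<Upsilon> \<and>
      homeomorphic_map (Rt_topology T s \<tau> M) (Rp_topology T s d M) \<Upsilon>')"
proof -
  interpret matroid_involution M \<tau>
    using assms by (intro matroid_involution.intro matroid_involution_axioms.intro)
  interpret class_correspondence "Nt s \<tau> M" "sim_t s \<tau> M" "Np s d M" "sim_p s d M"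
    "correspondence s" "function_of s" signatures_of
    using class_correspondence[of s] assms(2) by simp
  \<comment> \<open>This map involves neither the selected representatives nor a topology, so it can
    be given before \<open>T\<close> is quantified. The second map is its image on sets of classes,
    and the square commutes by \<open>image_relation_class\<close>.\<close>
  let ?\<Upsilon> = "(``) (correspondence s)"
  have bij: "bij_betw ?\<Upsilon> (Mt s \<tau> M) (Mp s d M)"
    unfolding Mt_def Mp_def by (rule bij_betw_Image)
  have c: "cong_t s \<tau> M \<subseteq> Mt s \<tau> M \<times> Mt s \<tau> M"
      "(cong_p s d M :: (('e list \<Rightarrow> 'h) set \<times> _) set) \<subseteq> Mp s d M \<times> Mp s d M"
    by (auto simp: cong_t_def cong_p_def)
  note iff = cong_iff[of _ s, unfolded assms(2)]
  have hom: "homeomorphic_map (Mt_topology T s \<tau> M) (Mp_topology T s d M) ?\<Upsilon>"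
    if "topological_hyperfield T" "continuous_map T T \<tau>" for T
    unfolding Mt_topology_def Mp_topology_def
    using topspace_Nt_topology[OF that] topspace_Np_topology[OF that]
      continuous_map_function_of[OF that] continuous_map_signatures_of[OF that]
    unfolding assms(2) by (rule homeomorphic_map_Image)
  have "homeomorphic_map (Rt_topology T s \<tau> M) (Rp_topology T s d M) ((`) ?\<Upsilon>)"
    if T: "topological_hyperfield T" "continuous_map T T \<tau>" for T
  proof -
    have top: "topspace (Mt_topology T s \<tau> M) = Mt s \<tau> M" "topspace (Mp_topology T s d M) = Mp s d M"
      using topspace_Nt_topology[OF T] topspace_Np_topology[OF T]
      by (simp_all add: Mt_topology_def Mp_topology_def Mt_def Mp_def assms(2))
    show ?thesis
      unfolding Rt_topology_def Rp_topology_def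
      using c iff by (intro homeomorphic_map_image_quotient[OF hom[OF T]]) (simp_all only: top)
  qed
  then show ?thesis
    using bij bij_betw_image_quotient[OF bij c iff] image_relation_class[OF bij c iff] hom
    unfolding Rt_def Rp_def by (intro exI[of _ ?\<Upsilon>] exI[of _ "(`) ?\<Upsilon>"]) simp
qed

end
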